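(* Let $\mathcal N$ be a skew-symmetric vector bundle endomorphism of a Courant algebroid $(E,\langle\cdot,\cdot\rangle,\Theta)$. Then $\{\widetilde{\mathcal N},\Theta\}$ is a Courant algebroid structure on $(E,\langle\cdot,\cdot\rangle)$ if and only if $\mathcal N$ is a weak deforming tensor for $\Theta$.
   Context: Vector bundles are smooth, real, of finite rank over a manifold $M$; $\Gamma E$ denotes sections. Let $(E,\langle\cdot,\cdot\rangle)$ be a vector bundle with a fiberwise non-degenerate symmetric bilinear form. Its minimal symplectic realization is the graded manifold $\widetilde E=j^!(T^*[2]E[1])$, where $j:E[1]\to E[1]\oplus E^*[1]$, $u\mapsto(u,\frac12\langle u,\cdot\rangle)$, and $j^!$ denotes pull-back by $j$. $\mathcal A=\bigoplus_k\mathcal A^k$ is the graded algebra of functions on $\widetilde E$, with its canonical Poisson bracket $\{\cdot,\cdot\}$ of degree $-2$: $\{a,b\}=-(-1)^{|a||b|}\{b,a\}$, $\{a,bc\}=\{a,b\}c+(-1)^{|a||b|}b\{a,c\}$, $\{a,\{b,c\}\}=\{\{a,b\},c\}+(-1)^{|a||b|}\{b,\{a,c\}\}$. For a local basis $(e_a)$ of $\Gamma E$ with $g_{ab}=\langle e_a,e_b\rangle$ constant, local coordinates on $\widetilde E$ are $(q^i,\tau^a,p_i)$ of degrees $0,1,2$, whose non-vanishing brackets are $\{q^i,p_j\}=\delta^i_j$, $\{\tau^a,\tau^b\}=g^{ab}$. One has $\mathcal A^0=C^\infty(M)$, $\mathcal A^1=\Gamma E$, and $\{u,v\}=\langle u,v\rangle$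 for sections $u,v$. A Courant algebroid structure on $(E,\langle\cdot,\cdot\rangle)$ is an element $\Theta\in\mathcal A^3$ with $\{\Theta,\Theta\}=0$; its anchor is $\rho(u)f=\{\{u,\Theta\},f\}$ and its (Dorfman) bracket is $[u,v]=\{\{u,\Theta\},v\}$. The operator $\mathrm d_\Theta=\{\Theta,\cdot\}$ on $\mathcal A$ has square zero. An endomorphism $\mathcal N$ of $E$ is skew-symmetric if $\langle\mathcal Nu,v\rangle+\langle u,\mathcal Nv\rangle=0$ for all $u,v$; then $\widetilde{\mathcal N}\in\mathcal A^2$ denotes the unique element with $\mathcal N(u)=\{u,\widetilde{\mathcal N}\}$ for all $u\in\Gamma E$. A skew-symmetric endomorphism $\mathcal N$ is a weak deforming tensor for $\Theta$ if $\{\{\widetilde{\mathcal N},\Theta\},\widetilde{\mathcal N}\}$ is a $\mathrm d_\Theta$-cocycle. *)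

theory Defs
  imports "HOL-Analysis.Analysis" "HOL-Library.Multiset"
begin

section \<open>Smooth manifolds\<close>

text \<open>
  \<open>\<real>\<^sup>n\<close> is the library's \<^const>\<open>Euclidean_space\<close> \<open>n\<close>, the sequences vanishing from index \<open>n\<close> on;
  this allows \<open>n = 0\<close>. Smoothness means that all iterated partial derivatives
  exist and are continuous.
\<close>

definition partial_deriv :: "nat \<Rightarrow> ((nat \<Rightarrow> real) \<Rightarrow> real) \<Rightarrow> (nat \<Rightarrow> real) \<Rightarrow> real" where
  "partial_deriv i f x = deriv (\<lambda>t. f (x(i := t))) (x i)"

primrec Ck_on :: "nat \<Rightarrow> nat \<Rightarrow> (nat \<Rightarrow> real) set \<Rightarrow> ((nat \<Rightarrow> real) \<Rightarrow> real) \<Rightarrow> bool" where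
  "Ck_on n 0 W f \<longleftrightarrow> continuous_on W f"
| "Ck_on n (Suc k) W f \<longleftrightarrow> continuous_on W f \<and>
     (\<forall>i<n. (\<forall>x\<in>W. (\<lambda>t. f (x(i := t))) differentiable (at (x i))) \<and>
            Ck_on n k W (partial_deriv i f))"

definition smooth_on :: "nat \<Rightarrow> (nat \<Rightarrow> real) set \<Rightarrow> ((nat \<Rightarrow> real) \<Rightarrow> real) \<Rightarrow> bool" where
  "smooth_on n W f \<longleftrightarrow> (\<forall>k. Ck_on n k W f)"

definition chart_on ::
  "nat \<Rightarrow> 'm::topological_space set \<Rightarrow> ('m \<Rightarrow> nat \<Rightarrow> real) \<Rightarrow> bool" where
  "chart_on n U q \<longleftrightarrow> open U \<and> openin (Euclidean_space n) (q ` U) \<and>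
     homeomorphism U (q ` U) q (inv_into U q)"

definition smooth_transition ::
  "nat \<Rightarrow> 'm set \<times> ('m \<Rightarrow> nat \<Rightarrow> real) \<Rightarrow> 'm set \<times> ('m \<Rightarrow> nat \<Rightarrow> real) \<Rightarrow> bool" where
  "smooth_transition n c c' \<longleftrightarrow> (case (c, c') of ((U, q), (V, q')) \<Rightarrow>
     \<forall>j<n. smooth_on n (q ` (U \<inter> V)) (\<lambda>x. q' (inv_into U q x) j))"

record 'm manifold =
  base_dim :: nat
  charts :: "('m set \<times> ('m \<Rightarrow> nat \<Rightarrow> real)) set"

locale smooth_manifold =
  fixes M :: "('m::{t2_space, second_countable_topology}, 'z) manifold_scheme"
  assumes chart: "(U, q) \<in> charts M \<Longrightarrow> chart_on (base_dim M) U q"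
    and charts_cover: "\<exists>(U, q)\<in>charts M. m \<in> U"
    and charts_compatible: "c \<in> charts M \<Longrightarrow> c' \<in> charts M \<Longrightarrow> smooth_transition (base_dim M) c c'"
    and charts_maximal: "chart_on (base_dim M) U q \<Longrightarrow>
      (\<And>c. c \<in> charts M \<Longrightarrow> smooth_transition (base_dim M) (U, q) c \<and>
                            smooth_transition (base_dim M) c (U, q)) \<Longrightarrow> (U, q) \<in> charts M"

definition smooth_fun :: "('m, 'z) manifold_scheme \<Rightarrow> 'm set \<Rightarrow> ('m \<Rightarrow> real) \<Rightarrow> bool" where
  "smooth_fun M U f \<longleftrightarrow>
     (\<forall>(V, q)\<in>charts M. smooth_on (base_dim M) (q ` (U \<inter> V)) (\<lambda>x. f (inv_into V q x)))"


section \<open>Vector bundles with a non-degenerate symmetric form\<close>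

text \<open>
  The fibres are linear subspaces of one ambient real vector space, which carries no further
  structure (for an abstract bundle one may take the direct sum of all its fibres). The smooth
  structure is given by the maximal family of smooth local frames \<open>(U, e)\<close>, where only \<open>e a m\<close> with
  \<open>a < rank\<close> and \<open>m \<in> U\<close> matters.
\<close>

record ('m, 'v) vector_bundle = "'m manifold" +
  rank :: nat
  fibre :: "'m \<Rightarrow> 'v set"
  frames :: "('m set \<times> (nat \<Rightarrow> 'm \<Rightarrow> 'v)) set"

definition frame_on ::
  "('m::topological_space, 'v::real_vector, 'z) vector_bundle_scheme \<Rightarrow>
    'm set \<Rightarrow> (nat \<Rightarrow> 'm \<Rightarrow> 'v) \<Rightarrow> bool" where
  "frame_on E U e \<longleftrightarrow> open U \<and>
     (\<forall>m\<in>U. inj_on (\<lambda>a. e a m) {..<rank E} \<and>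
            independent ((\<lambda>a. e a m) ` {..<rank E}) \<and>
            span ((\<lambda>a. e a m) ` {..<rank E}) = fibre E m)"

definition component ::
  "('m, 'v::real_vector, 'z) vector_bundle_scheme \<Rightarrow>
    (nat \<Rightarrow> 'm \<Rightarrow> 'v) \<Rightarrow> 'm \<Rightarrow> 'v \<Rightarrow> nat \<Rightarrow> real" where
  "component E e m v a = representation ((\<lambda>b. e b m) ` {..<rank E}) v (e a m)"

definition smooth_frame_change ::
  "('m, 'v::real_vector, 'z) vector_bundle_scheme \<Rightarrow>
    'm set \<times> (nat \<Rightarrow> 'm \<Rightarrow> 'v) \<Rightarrow> 'm set \<times> (nat \<Rightarrow> 'm \<Rightarrow> 'v) \<Rightarrow> bool" where
  "smooth_frame_change E F F' \<longleftrightarrow> (case (F, F') of ((U, e), (V, e')) \<Rightarrow>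
     \<forall>a<rank E. \<forall>b<rank E. smooth_fun E (U \<inter> V) (\<lambda>m. component E e' m (e a m) b))"

locale vector_bundle = smooth_manifold E
  for E :: "('m::{t2_space, second_countable_topology}, 'v::real_vector, 'z) vector_bundle_scheme" +
  assumes frame: "(U, e) \<in> frames E \<Longrightarrow> frame_on E U e"
    and frames_cover: "\<exists>(U, e)\<in>frames E. m \<in> U"
    and frames_compatible: "F \<in> frames E \<Longrightarrow> F' \<in> frames E \<Longrightarrow> smooth_frame_change E F F'"
    and frames_maximal: "frame_on E U e \<Longrightarrow>
      (\<And>F. F \<in> frames E \<Longrightarrow> smooth_frame_change E (U, e) F \<and>
                            smooth_frame_change E F (U, e)) \<Longrightarrow> (U, e) \<in> frames E"

definition sections :: "('m, 'v::real_vector, 'z) vector_bundle_scheme \<Rightarrow> ('m \<Rightarrow> 'v) set" where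
  "sections E = {u. (\<forall>m. u m \<in> fibre E m) \<and>
     (\<forall>(U, e)\<in>frames E. \<forall>a<rank E. smooth_fun E U (\<lambda>m. component E e m (u m) a))}"

definition bundle_endomorphism ::
  "('m, 'v::real_vector, 'z) vector_bundle_scheme \<Rightarrow> ('m \<Rightarrow> 'v \<Rightarrow> 'v) \<Rightarrow> bool" where
  "bundle_endomorphism E N \<longleftrightarrow>
     (\<forall>m. N m ` fibre E m \<subseteq> fibre E m) \<and>
     (\<forall>m. \<forall>u\<in>fibre E m. \<forall>v\<in>fibre E m. N m (u + v) = N m u + N m v) \<and>
     (\<forall>m c. \<forall>u\<in>fibre E m. N m (c *\<^sub>R u) = c *\<^sub>R N m u) \<and>
     (\<forall>(U, e)\<in>frames E. \<forall>a<rank E. \<forall>b<rank E.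
        smooth_fun E U (\<lambda>m. component E e m (N m (e a m)) b))"

record ('m, 'v) metric_bundle = "('m, 'v) vector_bundle" +
  form :: "'m \<Rightarrow> 'v \<Rightarrow> 'v \<Rightarrow> real"

locale metric_bundle = vector_bundle E
  for E :: "('m::{t2_space, second_countable_topology}, 'v::real_vector, 'z) metric_bundle_scheme" +
  assumes form_add: "\<lbrakk>u \<in> fibre E m; v \<in> fibre E m; w \<in> fibre E m\<rbrakk> \<Longrightarrow>
      form E m (u + v) w = form E m u w + form E m v w"
    and form_scale: "\<lbrakk>u \<in> fibre E m; w \<in> fibre E m\<rbrakk> \<Longrightarrow>
      form E m (c *\<^sub>R u) w = c * form E m u w"
    and form_sym: "\<lbrakk>u \<in> fibre E m; v \<in> fibre E m\<rbrakk> \<Longrightarrow> form E m u v = form E m v u"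
    and form_nondegenerate: "\<lbrakk>u \<in> fibre E m; \<And>v. v \<in> fibre E m \<Longrightarrow> form E m u v = 0\<rbrakk> \<Longrightarrow> u = 0"
    and form_smooth: "\<lbrakk>(U, e) \<in> frames E; a < rank E; b < rank E\<rbrakk> \<Longrightarrow>
      smooth_fun E U (\<lambda>m. form E m (e a m) (e b m))"

definition skew_endomorphism ::
  "('m, 'v::real_vector, 'z) metric_bundle_scheme \<Rightarrow> ('m \<Rightarrow> 'v \<Rightarrow> 'v) \<Rightarrow> bool" where
  "skew_endomorphism E N \<longleftrightarrow> bundle_endomorphism E N \<and>
     (\<forall>m. \<forall>u\<in>fibre E m. \<forall>v\<in>fibre E m. form E m (N m u) v + form E m u (N m v) = 0)"


section \<open>Superpolynomials in the fibre coordinates\<close>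

text \<open>
  An element \<open>A\<close> stands for \<open>\<Sum> A S K \<tau>\<^sup>S p\<^sup>K\<close>, where \<open>\<tau>\<^sup>S\<close> is the product of the anticommuting
  \<open>\<tau>\<^sup>s\<close>, \<open>s \<in> S\<close>, in increasing order, and \<open>p\<^sup>K\<close> the product of the commuting \<open>p\<^sub>i\<close>, \<open>i \<in># K\<close>.
\<close>

type_synonym superpoly = "nat set \<Rightarrow> nat multiset \<Rightarrow> real"

definition super_one :: superpoly where
  "super_one = (\<lambda>S K. if S = {} \<and> K = {#} then 1 else 0)"

definition tau_var :: "nat \<Rightarrow> superpoly" where
  "tau_var a = (\<lambda>S K. if S = {a} \<and> K = {#} then 1 else 0)"

definition p_var :: "nat \<Rightarrow> superpoly" where
  "p_var i = (\<lambda>S K. if S = {} \<and> K = {#i#} then 1 else 0)"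

text \<open>\<open>\<tau>\<^sup>S \<tau>\<^sup>T = shuffle_sign S T \<tau>\<^sup>S\<^sup>\<union>\<^sup>T\<close> for disjoint finite \<open>S\<close> and \<open>T\<close>.\<close>

definition shuffle_sign :: "nat set \<Rightarrow> nat set \<Rightarrow> real" where
  "shuffle_sign S T = (-1) ^ card {(s, t). s \<in> S \<and> t \<in> T \<and> t < s}"

definition super_mult :: "superpoly \<Rightarrow> superpoly \<Rightarrow> superpoly" where
  "super_mult A B = (\<lambda>S K. \<Sum>S1\<in>Pow S. \<Sum>K1\<in>{K1. K1 \<subseteq># K}.
     shuffle_sign S1 (S - S1) * A S1 K1 * B (S - S1) (K - K1))"

definition super_prod :: "superpoly list \<Rightarrow> superpoly" where
  "super_prod As = foldr super_mult As super_one"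

definition dp :: "nat \<Rightarrow> superpoly \<Rightarrow> superpoly" where
  "dp i A = (\<lambda>S K. real (count K i + 1) * A S (add_mset i K))"

definition dtau_left :: "nat \<Rightarrow> superpoly \<Rightarrow> superpoly" where
  "dtau_left c A = (\<lambda>S K. if c \<in> S then 0 else (-1) ^ card {s\<in>S. s < c} * A (insert c S) K)"

definition dtau_right :: "nat \<Rightarrow> superpoly \<Rightarrow> superpoly" where
  "dtau_right c A = (\<lambda>S K. if c \<in> S then 0 else (-1) ^ card {s\<in>S. c < s} * A (insert c S) K)"

text \<open>The algebra homomorphism \<open>\<tau>\<^sup>a \<mapsto> T a\<close>, \<open>p\<^sub>i \<mapsto> P i\<close>, applied to an element of finite support.\<close>

definition super_subst ::
  "(nat \<Rightarrow> superpoly) \<Rightarrow> (nat \<Rightarrow> superpoly) \<Rightarrow> superpoly \<Rightarrow> superpoly" where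
  "super_subst T P A = (\<lambda>S K. \<Sum>(S', K') | A S' K' \<noteq> 0. A S' K' *
     super_prod (map T (sorted_list_of_set S') @ map P (sorted_list_of_multiset K')) S K)"


section \<open>Functions on the minimal symplectic realization\<close>

text \<open>
  A local coordinate system on \<open>j\<^sup>!(T\<^sup>*[2]E[1])\<close> is determined by a chart \<open>q\<close> of \<open>M\<close> and a local frame
  \<open>e\<close> over the same open set for which \<open>g\<^sub>a\<^sub>b = \<langle>e\<^sub>a, e\<^sub>b\<rangle>\<close> is constant.
\<close>

record ('m, 'v) coords =
  patch :: "'m set"
  q_coord :: "'m \<Rightarrow> nat \<Rightarrow> real"
  e_frame :: "nat \<Rightarrow> 'm \<Rightarrow> 'v"

definition coord_systems ::
  "('m, 'v::real_vector, 'z) metric_bundle_scheme \<Rightarrow> ('m, 'v) coords set" where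
  "coord_systems E = {k. (patch k, q_coord k) \<in> charts E \<and> (patch k, e_frame k) \<in> frames E \<and>
     (\<forall>a<rank E. \<forall>b<rank E. \<exists>c. \<forall>m\<in>patch k. form E m (e_frame k a m) (e_frame k b m) = c)}"

definition gram :: "('m, 'v, 'z) metric_bundle_scheme \<Rightarrow> ('m, 'v) coords \<Rightarrow> 'm \<Rightarrow> nat \<Rightarrow> nat \<Rightarrow> real"
  where "gram E k m a b = form E m (e_frame k a m) (e_frame k b m)"

definition inverse_matrix :: "nat \<Rightarrow> (nat \<Rightarrow> nat \<Rightarrow> real) \<Rightarrow> nat \<Rightarrow> nat \<Rightarrow> real" where
  "inverse_matrix r g = (THE h. (\<forall>a b. a \<ge> r \<or> b \<ge> r \<longrightarrow> h a b = 0) \<and>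
     (\<forall>a<r. \<forall>c<r. (\<Sum>b<r. h a b * g b c) = (if a = c then 1 else 0)))"

definition dq :: "('m, 'v) coords \<Rightarrow> nat \<Rightarrow> ('m \<Rightarrow> real) \<Rightarrow> 'm \<Rightarrow> real" where
  "dq k i f m = partial_deriv i (\<lambda>x. f (inv_into (patch k) (q_coord k) x)) (q_coord k m)"

text \<open>
  Let \<open>k\<close> and \<open>k'\<close> be two coordinate systems, with \<open>e\<^sub>a = C\<^sup>b\<^sub>a e'\<^sub>b\<close> and \<open>e'\<^sub>b = B\<^sup>a\<^sub>b e\<^sub>a\<close> on the overlap.
  The coordinates \<open>(q, \<tau>, p, \<theta>)\<close> of \<open>T\<^sup>*[2]E[1]\<close> change by \<open>\<tau>\<^sup>a = B\<^sup>a\<^sub>b \<tau>'\<^sup>b\<close>, and invariance of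
  the Liouville form \<open>p\<^sub>i dq\<^sup>i + \<theta>\<^sub>a d\<tau>\<^sup>a\<close> gives
  \<open>p\<^sub>i = (\<partial>\<^sub>iq'\<^sup>j) p'\<^sub>j + \<theta>'\<^sub>b (\<partial>\<^sub>iC\<^sup>b\<^sub>a) \<tau>\<^sup>a\<close>. Pulling back by \<open>j\<close> replaces \<open>\<theta>'\<^sub>b\<close> by \<open>\<onehalf> g'\<^sub>b\<^sub>c \<tau>'\<^sup>c\<close>.
\<close>

definition tau_change ::
  "('m, 'v::real_vector, 'z) metric_bundle_scheme \<Rightarrow> ('m, 'v) coords \<Rightarrow> ('m, 'v) coords \<Rightarrow>
    'm \<Rightarrow> nat \<Rightarrow> superpoly" where
  "tau_change E k k' m a = (\<lambda>S K. \<Sum>b<rank E.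
     component E (e_frame k) m (e_frame k' b m) a * tau_var b S K)"

definition p_change ::
  "('m, 'v::real_vector, 'z) metric_bundle_scheme \<Rightarrow> ('m, 'v) coords \<Rightarrow> ('m, 'v) coords \<Rightarrow>
    'm \<Rightarrow> nat \<Rightarrow> superpoly" where
  "p_change E k k' m i = (\<lambda>S K.
     (\<Sum>j<base_dim E. dq k i (\<lambda>x. q_coord k' x j) m * p_var j S K) +
     1/2 * (\<Sum>a<rank E. \<Sum>b<rank E. \<Sum>c<rank E.
        gram E k' m b c * dq k i (\<lambda>x. component E (e_frame k') x (e_frame k a x) b) m *
        super_mult (tau_var c) (tau_change E k k' m a) S K))"

text \<open>
  A function of degree \<open>d\<close> is a family of local expressions, one for each coordinate system, that
  transform into each other on overlaps. By convention, a local expression vanishes outside its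
  domain, so that functions agree iff they are equal as families.
\<close>

type_synonym ('m, 'v) family = "('m, 'v) coords \<Rightarrow> 'm \<Rightarrow> superpoly"

definition graded_functions ::
  "('m, 'v::real_vector, 'z) metric_bundle_scheme \<Rightarrow> nat \<Rightarrow> ('m, 'v) family set" where
  "graded_functions E d = {F.
     (\<forall>k m S K. F k m S K \<noteq> 0 \<longrightarrow> k \<in> coord_systems E \<and> m \<in> patch k \<and>
        S \<subseteq> {..<rank E} \<and> set_mset K \<subseteq> {..<base_dim E} \<and> card S + 2 * size K = d) \<and>
     (\<forall>k\<in>coord_systems E. \<forall>S K. smooth_on (base_dim E) (q_coord k ` patch k)
        (\<lambda>x. F k (inv_into (patch k) (q_coord k) x) S K)) \<and>
     (\<forall>k\<in>coord_systems E. \<forall>k'\<in>coord_systems E. \<forall>m\<in>patch k \<inter> patch k'.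
        F k' m = super_subst (tau_change E k k' m) (p_change E k k' m) (F k m))}"

definition zero_function :: "('m, 'v) family" where
  "zero_function = (\<lambda>k m S K. 0)"

text \<open>
  The Poisson bracket with \<open>{q\<^sup>i, p\<^sub>j} = \<delta>\<^sup>i\<^sub>j\<close> and \<open>{\<tau>\<^sup>a, \<tau>\<^sup>b} = g\<^sup>a\<^sup>b\<close>. Using right derivatives in the
  first argument absorbs all signs depending on the degrees of \<open>F\<close> and \<open>G\<close>.
\<close>

definition bracket ::
  "('m, 'v::real_vector, 'z) metric_bundle_scheme \<Rightarrow> ('m, 'v) family \<Rightarrow> ('m, 'v) family \<Rightarrow>
    ('m, 'v) family" where
  "bracket E F G = (\<lambda>k m S K. if k \<in> coord_systems E \<and> m \<in> patch k then
     (\<Sum>i<base_dim E.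
        super_mult (\<lambda>S K. dq k i (\<lambda>x. F k x S K) m) (dp i (G k m)) S K -
        super_mult (dp i (F k m)) (\<lambda>S K. dq k i (\<lambda>x. G k x S K) m) S K) +
     (\<Sum>a<rank E. \<Sum>b<rank E. inverse_matrix (rank E) (gram E k m) a b *
        super_mult (dtau_right a (F k m)) (dtau_left b (G k m)) S K)
     else 0)"

text \<open>The identification of sections with functions of degree 1: \<open>u\<close> is mapped to \<open>\<langle>u, e\<^sub>b\<rangle> \<tau>\<^sup>b\<close>.\<close>

definition section_function ::
  "('m, 'v::real_vector, 'z) metric_bundle_scheme \<Rightarrow> ('m \<Rightarrow> 'v) \<Rightarrow> ('m, 'v) family" where
  "section_function E u = (\<lambda>k m S K. if k \<in> coord_systems E \<and> m \<in> patch k then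
     (\<Sum>b<rank E. form E m (u m) (e_frame k b m) * tau_var b S K) else 0)"


section \<open>Courant algebroids and weak deforming tensors\<close>

definition courant_structure ::
  "('m, 'v::real_vector, 'z) metric_bundle_scheme \<Rightarrow> ('m, 'v) family \<Rightarrow> bool" where
  "courant_structure E \<Theta> \<longleftrightarrow> \<Theta> \<in> graded_functions E 3 \<and> bracket E \<Theta> \<Theta> = zero_function"

definition d_Theta ::
  "('m, 'v::real_vector, 'z) metric_bundle_scheme \<Rightarrow> ('m, 'v) family \<Rightarrow> ('m, 'v) family \<Rightarrow>
    ('m, 'v) family" where
  "d_Theta E \<Theta> F = bracket E \<Theta> F"

text \<open>For skew-symmetric \<open>N\<close> there is exactly one such function, so the choice is immaterial.\<close>

definition tilde ::
  "('m, 'v::real_vector, 'z) metric_bundle_scheme \<Rightarrow> ('m \<Rightarrow> 'v \<Rightarrow> 'v) \<Rightarrow> ('m, 'v) family" where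
  "tilde E N = (SOME n. n \<in> graded_functions E 2 \<and>
     (\<forall>u\<in>sections E. section_function E (\<lambda>m. N m (u m)) = bracket E (section_function E u) n))"

definition weak_deforming_tensor ::
  "('m, 'v::real_vector, 'z) metric_bundle_scheme \<Rightarrow> ('m, 'v) family \<Rightarrow> ('m \<Rightarrow> 'v \<Rightarrow> 'v) \<Rightarrow> bool"
  where
  "weak_deforming_tensor E \<Theta> N \<longleftrightarrow> skew_endomorphism E N \<and>
     d_Theta E \<Theta> (bracket E (bracket E (tilde E N) \<Theta>) (tilde E N)) = zero_function"

end

theory Submission
  imports Defs
begin

text \<open>
Write \<open>\<Theta>'\<close> for \<open>{n, \<Theta>}\<close>, where \<open>n\<close> is the function of degree 2 belonging to \<open>N\<close>. Since \<open>{\<Theta>, \<Theta>} = 0\<close>,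
the Jacobi identity gives \<open>2 {\<Theta>, {\<Theta>, n}} = {{\<Theta>, \<Theta>}, n} = 0\<close>, so \<open>{\<Theta>, \<Theta>'} = 0\<close>, and hence
\<open>{\<Theta>, {\<Theta>', n}} = {{\<Theta>, \<Theta>'}, n} - {\<Theta>', {\<Theta>, n}} = {\<Theta>', \<Theta>'}\<close>. The left-hand side vanishes iff
\<open>N\<close> is a weak deforming tensor and the right-hand side vanishes iff \<open>\<Theta>'\<close> is a Courant algebroid
structure (\<open>deformed_square\<close>). Everything else establishes the facts about the algebra of functions that
this computation rests on.

\<^item> The Jacobi identity (\<open>jacobi_pointwise\<close>, \<open>pbracket_jacobi\<close>). In one coordinate system the bracket is
\<open>\<Sum> \<omega> I J \<partial>\<^sub>I F \<partial>\<^sub>J G\<close> up to signs, with a constant matrix \<open>\<omega>\<close>, and the identity follows from the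
Leibniz rule and the graded symmetry of second derivatives. For the base coordinates these need the
product rule and the equality of mixed partial derivatives.

\<^item> \<open>\<Theta>'\<close> is again a function of degree 3 (\<open>bracket_graded\<close>), that is, the local formulas for the bracket
are compatible with changes of coordinates. Let \<open>X\<close> run through the old coordinates as functions of
the new ones. The chain rule expresses \<open>{F, G}\<close> computed in the new coordinates through the
derivatives of \<open>F\<close> and \<open>G\<close> in the old ones and the brackets of the \<open>X\<close>
(\<open>bracket_invariance_pointwise\<close>), so it remains to compute the latter. Writing \<open>e\<^sub>a = C\<^sup>b\<^sub>a e'\<^sub>b\<close>, all of
them reduce to the matrices \<open>M\<^sub>s = (\<partial>\<^sub>s C) C\<^sup>-\<^sup>1\<close>, which are skew-symmetric for the constant metric \<open>g'\<close>, and
to the symmetry of the second derivatives of \<open>C\<close> and of the coordinate change on the base. That the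
\<open>p\<^sub>i\<close> commute is the flatness identity
\<open>\<partial>\<^sub>s M\<^sub>i - \<partial>\<^sub>i M\<^sub>s = M\<^sub>s M\<^sub>i - M\<^sub>i M\<^sub>s\<close> in disguise (\<open>dP_antisym\<close>).

\<^item> The function \<open>n\<close> exists (\<open>tilde_graded\<close>): in local coordinates it is
\<open>\<onehalf> \<langle>N e\<^sub>a, e\<^sub>b\<rangle> \<tau>\<^sup>a \<tau>\<^sup>b\<close>.
\<close>

section \<open>The superalgebra of polynomials in \<open>\<tau>\<close> and \<open>p\<close>\<close>

text \<open>
The elements of finite support, whose index sets are finite, form an associative unital real algebra
under \<^const>\<open>super_mult\<close>. Making them a type gives access to the ring simplification rules.
\<close>

typedef spoly = "{A :: superpoly. finite {(S, K). A S K \<noteq> 0} \<and> (\<forall>S K. A S K \<noteq> 0 \<longrightarrow> finite S)}"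
  morphisms coef Spoly
  by (rule exI[of _ "\<lambda>S K. 0"]) simp

setup_lifting type_definition_spoly

lemma finite_submultisets: "finite {M. M \<subseteq># (K :: 'a multiset)}"
proof (induction K)
  case (add x K)
  have "{M. M \<subseteq># add_mset x K} \<subseteq> {M. M \<subseteq># K} \<union> add_mset x ` {M. M \<subseteq># K}"
  proof
    fix M assume "M \<in> {M. M \<subseteq># add_mset x K}"
    hence M: "M \<subseteq># add_mset x K" by simp
    show "M \<in> {M. M \<subseteq># K} \<union> add_mset x ` {M. M \<subseteq># K}"
    proof (cases "x \<in># M")
      case True
      then obtain M' where "M = add_mset x M'" by (metis insert_DiffM)
      thus ?thesis using M by auto
    next
      case False
      hence "M \<subseteq># K" using M
        by (metis add_mset_remove_trivial diff_single_trivial mset_subset_eq_exists_conv subset_eq_diff_conv add_mset_add_single)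
      thus ?thesis by simp
    qed
  qed
  thus ?case using add finite_subset by blast
qed (simp add: subset_mset.le_zero_eq)

lemma super_mult_nonzeroE:
  assumes "super_mult A B S K \<noteq> 0"
  obtains S1 K1 where "finite S" "S1 \<subseteq> S" "K1 \<subseteq># K" "A S1 K1 \<noteq> 0" "B (S - S1) (K - K1) \<noteq> 0"
proof -
  have fin: "finite S"
  proof (rule ccontr)
    assume "infinite S"
    hence "infinite (Pow S)" by simp
    thus False using assms by (simp add: super_mult_def)
  qed
  obtain S1 where 1: "S1 \<in> Pow S" "(\<Sum>K1\<in>{K1. K1 \<subseteq># K}.
     shuffle_sign S1 (S - S1) * A S1 K1 * B (S - S1) (K - K1)) \<noteq> 0"
    using assms unfolding super_mult_def by (meson sum.neutral)
  obtain K1 where 2: "K1 \<subseteq># K" "shuffle_sign S1 (S - S1) * A S1 K1 * B (S - S1) (K - K1) \<noteq> 0"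
    using 1(2) by (metis (no_types, lifting) mem_Collect_eq sum.neutral)
  show thesis using that[of S1 K1] 1 2 fin by auto
qed

lemma finite_super_mult:
  assumes "finite {(S, K). A S K \<noteq> 0}" "finite {(S, K). B S K \<noteq> 0}"
  shows "finite {(S, K). super_mult A B S K \<noteq> 0}"
proof (rule finite_subset)
  show "{(S, K). super_mult A B S K \<noteq> 0} \<subseteq> (\<lambda>((S1, K1), (S2, K2)). (S1 \<union> S2, K1 + K2)) `
      ({(S, K). A S K \<noteq> 0} \<times> {(S, K). B S K \<noteq> 0})"
  proof clarify
    fix S K assume "super_mult A B S K \<noteq> 0"
    then obtain S1 K1 where *: "S1 \<subseteq> S" "K1 \<subseteq># K" "A S1 K1 \<noteq> 0" "B (S - S1) (K - K1) \<noteq> 0"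
      by (rule super_mult_nonzeroE)
    have "(S, K) = (\<lambda>((S1, K1), (S2, K2)). (S1 \<union> S2, K1 + K2)) ((S1, K1), (S - S1, K - K1))"
      using * by auto
    thus "(S, K) \<in> (\<lambda>((S1, K1), (S2, K2)). (S1 \<union> S2, K1 + K2)) `
      ({(S, K). A S K \<noteq> 0} \<times> {(S, K). B S K \<noteq> 0})"
      using * by (intro image_eqI) auto
  qed
qed (use assms in auto)

lemma shuffle_sign_Un_left:
  assumes "finite A" "finite B" "finite C" "A \<inter> B = {}"
  shows "shuffle_sign (A \<union> B) C = shuffle_sign A C * shuffle_sign B C"
proof -
  have eq: "{(s, t). s \<in> A \<union> B \<and> t \<in> C \<and> t < s} =
     {(s, t). s \<in> A \<and> t \<in> C \<and> t < s} \<union> {(s, t). s \<in> B \<and> t \<in> C \<and> t < s}" by auto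
  have f: "finite {(s, t). s \<in> X \<and> t \<in> C \<and> t < s}" if "finite X" for X
    by (rule finite_subset[of _ "X \<times> C"]) (use that assms in auto)
  show ?thesis unfolding shuffle_sign_def eq
    by (subst card_Un_disjoint) (use f assms in \<open>auto simp: power_add\<close>)
qed

lemma shuffle_sign_Un_right:
  assumes "finite A" "finite B" "finite C" "B \<inter> C = {}"
  shows "shuffle_sign A (B \<union> C) = shuffle_sign A B * shuffle_sign A C"
proof -
  have eq: "{(s, t). s \<in> A \<and> t \<in> B \<union> C \<and> t < s} =
     {(s, t). s \<in> A \<and> t \<in> B \<and> t < s} \<union> {(s, t). s \<in> A \<and> t \<in> C \<and> t < s}" by auto
  have f: "finite {(s, t). s \<in> A \<and> t \<in> X \<and> t < s}" if "finite X" for X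
    by (rule finite_subset[of _ "A \<times> X"]) (use that assms in auto)
  show ?thesis unfolding shuffle_sign_def eq
    by (subst card_Un_disjoint) (use f assms in \<open>auto simp: power_add\<close>)
qed

lemma shuffle_sign_swap:
  assumes "finite A" "finite B" "A \<inter> B = {}"
  shows "shuffle_sign B A = (-1) ^ (card A * card B) * shuffle_sign A B"
proof -
  let ?X = "{(s, t). s \<in> A \<and> t \<in> B \<and> t < s}" and ?Y = "{(s, t). s \<in> B \<and> t \<in> A \<and> t < s}"
  have f: "finite ?X" "finite ?Y"
    by (rule finite_subset[of _ "A \<times> B"], use assms in auto)
       (rule finite_subset[of _ "B \<times> A"], use assms in auto)
  have "card ?Y = card (prod.swap ` ?Y)" by (simp add: card_image)
  moreover have "A \<times> B = ?X \<union> prod.swap ` ?Y"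
  proof (intro set_eqI iffI)
    fix z assume z: "z \<in> A \<times> B"
    obtain s t where st: "z = (s,t)" by force
    with z assms have "s \<noteq> t" by auto
    hence "t < s \<or> s < t" by auto
    thus "z \<in> ?X \<union> prod.swap ` ?Y"
    proof
      assume "t < s" thus ?thesis using z st by auto
    next
      assume "s < t"
      hence "(t,s) \<in> ?Y" using z st by auto
      hence "prod.swap (t,s) \<in> prod.swap ` ?Y" by (rule imageI)
      thus ?thesis using st by simp
    qed
  qed auto
  moreover have "?X \<inter> prod.swap ` ?Y = {}" by auto
  ultimately have "card A * card B = card ?X + card ?Y"
    using f card_Un_disjoint[of ?X "prod.swap ` ?Y"] by (simp add: card_cartesian_product[symmetric])
  hence "(-1::real) ^ (card A * card B) = (-1) ^ card ?X * (-1) ^ card ?Y"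
    by (simp add: power_add)
  moreover have "(-1::real) ^ card ?X * (-1) ^ card ?X = 1" by (simp flip: power_mult_distrib)
  ultimately show ?thesis unfolding shuffle_sign_def
    by (metis (no_types, lifting) mult.commute mult.left_commute mult.right_neutral)
qed

lemma shuffle_sign_empty: "shuffle_sign {} S = 1" "shuffle_sign S {} = 1"
  by (simp_all add: shuffle_sign_def)

lemma super_mult_assoc:
  "super_mult (super_mult A B) C S K = super_mult A (super_mult B C) S K"
proof (cases "finite S")
  case False
  hence "infinite (Pow S)" by simp
  thus ?thesis by (simp add: super_mult_def)
next
  case fin: True
  have finsub: "finite X" if "X \<subseteq> S" for X using fin that finite_subset by auto
  let ?I = "SIGMA X:Pow S. SIGMA M:{M. M \<subseteq># K}. SIGMA Y:Pow X. {N. N \<subseteq># M}"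
  let ?J = "SIGMA Y:Pow S. SIGMA N:{N. N \<subseteq># K}. SIGMA Z:Pow (S - Y). {P. P \<subseteq># K - N}"
  have f1: "finite (SIGMA Y:Pow X. {N :: nat multiset. N \<subseteq># M})" if "finite X" for X :: "nat set" and M
    using that by (auto intro!: finite_SigmaI finite_submultisets)
  have f2: "finite (SIGMA M:{M. M \<subseteq># K}. SIGMA Y:Pow X. {N :: nat multiset. N \<subseteq># M})"
    if "finite X" for X :: "nat set"
    using that by (auto intro!: finite_SigmaI finite_submultisets)
  have f3: "finite (SIGMA N:{N. N \<subseteq># K}. SIGMA Z:Pow X. {P. P \<subseteq># K - N})"
    if "finite X" for X :: "nat set"
    using that by (auto intro!: finite_SigmaI finite_submultisets)
  have "super_mult (super_mult A B) C S K = (\<Sum>(X, M, Y, N)\<in>?I.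
      shuffle_sign X (S - X) * (shuffle_sign Y (X - Y) * A Y N * B (X - Y) (M - N)) * C (S - X) (K - M))"
    using fin finsub f1 f2
    by (simp add: super_mult_def sum_distrib_left sum_distrib_right sum.Sigma finite_submultisets
        split_def mult.assoc)
  also have "\<dots> = (\<Sum>(Y, N, Z, P)\<in>?J.
      shuffle_sign Y (S - Y) * A Y N * (shuffle_sign Z (S - Y - Z) * B Z P * C (S - Y - Z) (K - N - P)))"
  proof (rule sum.reindex_bij_witness[where i = "\<lambda>(Y, N, Z, P). (Y \<union> Z, N + P, Y, N)"
        and j = "\<lambda>(X, M, Y, N). (Y, N, X - Y, M - N)"])
    fix a assume "a \<in> ?I"
    then obtain X M Y N where a: "a = (X, M, Y, N)" and h: "X \<subseteq> S" "M \<subseteq># K" "Y \<subseteq> X" "N \<subseteq># M"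
      by (cases a) auto
    show "(\<lambda>(Y, N, Z, P). (Y \<union> Z, N + P, Y, N)) ((\<lambda>(X, M, Y, N). (Y, N, X - Y, M - N)) a) = a"
      using a h by auto
    have "M - N \<subseteq># K - N" using h by (simp add: subset_eq_diff_conv)
    thus "(\<lambda>(X, M, Y, N). (Y, N, X - Y, M - N)) a \<in> ?J"
      using a h by (auto intro: subset_mset.order_trans)
    have fY: "finite Y" "finite (X - Y)" "finite (S - X)" using h finsub by auto
    have e1: "X = Y \<union> (X - Y)" and e2: "S - Y = (X - Y) \<union> (S - X)" and e3: "S - Y - (X - Y) = S - X"
      using h by auto
    have s1: "shuffle_sign X (S - X) = shuffle_sign Y (S - X) * shuffle_sign (X - Y) (S - X)"
      by (subst e1, rule shuffle_sign_Un_left) (use fY in auto)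
    have s2: "shuffle_sign Y (S - Y) = shuffle_sign Y (X - Y) * shuffle_sign Y (S - X)"
      by (subst e2, rule shuffle_sign_Un_right) (use fY in auto)
    have e4: "N + (M - N) = M" using h by simp
    show "(\<lambda>(Y, N, Z, P). shuffle_sign Y (S - Y) * A Y N * (shuffle_sign Z (S - Y - Z) * B Z P * C (S - Y - Z) (K - N - P)))
        ((\<lambda>(X, M, Y, N). (Y, N, X - Y, M - N)) a) =
      (case a of (X, M, Y, N) \<Rightarrow> shuffle_sign X (S - X) * (shuffle_sign Y (X - Y) * A Y N * B (X - Y) (M - N)) * C (S - X) (K - M))"
      using a by (simp add: e3 e4 s1 s2)
  next
    fix b assume "b \<in> ?J"
    then obtain Y N Z P where b: "b = (Y, N, Z, P)" and h: "Y \<subseteq> S" "N \<subseteq># K" "Z \<subseteq> S - Y" "P \<subseteq># K - N"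
      by (cases b) auto
    show "(\<lambda>(X, M, Y, N). (Y, N, X - Y, M - N)) ((\<lambda>(Y, N, Z, P). (Y \<union> Z, N + P, Y, N)) b) = b"
      using b h by auto
    have "N + P \<subseteq># K" using h
      by (metis subset_mset.add_diff_inverse subset_mset.add_left_mono)
    thus "(\<lambda>(Y, N, Z, P). (Y \<union> Z, N + P, Y, N)) b \<in> ?I"
      using b h by auto
  qed
  also have "\<dots> = super_mult A (super_mult B C) S K"
    using fin finsub f1 f3
    by (simp add: super_mult_def sum_distrib_left sum_distrib_right sum.Sigma finite_submultisets
        split_def mult.assoc)
  finally show ?thesis .
qed

instantiation spoly :: real_algebra_1
begin

lift_definition zero_spoly :: spoly is "\<lambda>S K. 0" by simp
lift_definition one_spoly :: spoly is super_one
proof -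
  have "{(S :: nat set, K :: nat multiset). super_one S K \<noteq> 0} \<subseteq> {({}, {#})}"
    by (auto simp: super_one_def split: if_splits)
  thus "finite {(S, K). super_one S K \<noteq> 0} \<and> (\<forall>S K. super_one S K \<noteq> 0 \<longrightarrow> finite S)"
    using finite_subset by (auto simp: super_one_def)
qed
lift_definition plus_spoly :: "spoly \<Rightarrow> spoly \<Rightarrow> spoly" is "\<lambda>A B S K. A S K + B S K"
proof -
  fix A B :: superpoly
  assume *: "finite {(S, K). A S K \<noteq> 0} \<and> (\<forall>S K. A S K \<noteq> 0 \<longrightarrow> finite S)"
    "finite {(S, K). B S K \<noteq> 0} \<and> (\<forall>S K. B S K \<noteq> 0 \<longrightarrow> finite S)"
  have "{(S, K). A S K + B S K \<noteq> 0} \<subseteq> {(S, K). A S K \<noteq> 0} \<union> {(S, K). B S K \<noteq> 0}" by auto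
  thus "finite {(S, K). A S K + B S K \<noteq> 0} \<and> (\<forall>S K. A S K + B S K \<noteq> 0 \<longrightarrow> finite S)"
    using * finite_subset by (metis (no_types, lifting) add.right_neutral finite_UnI)
qed
lift_definition minus_spoly :: "spoly \<Rightarrow> spoly \<Rightarrow> spoly" is "\<lambda>A B S K. A S K - B S K"
proof -
  fix A B :: superpoly
  assume *: "finite {(S, K). A S K \<noteq> 0} \<and> (\<forall>S K. A S K \<noteq> 0 \<longrightarrow> finite S)"
    "finite {(S, K). B S K \<noteq> 0} \<and> (\<forall>S K. B S K \<noteq> 0 \<longrightarrow> finite S)"
  have "{(S, K). A S K - B S K \<noteq> 0} \<subseteq> {(S, K). A S K \<noteq> 0} \<union> {(S, K). B S K \<noteq> 0}" by auto
  thus "finite {(S, K). A S K - B S K \<noteq> 0} \<and> (\<forall>S K. A S K - B S K \<noteq> 0 \<longrightarrow> finite S)"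
    using * finite_subset by (metis (no_types, lifting) diff_0_right finite_UnI)
qed
lift_definition uminus_spoly :: "spoly \<Rightarrow> spoly" is "\<lambda>A S K. - A S K" by simp
lift_definition scaleR_spoly :: "real \<Rightarrow> spoly \<Rightarrow> spoly" is "\<lambda>c A S K. c * A S K"
proof -
  fix c and A :: superpoly
  assume *: "finite {(S, K). A S K \<noteq> 0} \<and> (\<forall>S K. A S K \<noteq> 0 \<longrightarrow> finite S)"
  have "{(S, K). c * A S K \<noteq> 0} \<subseteq> {(S, K). A S K \<noteq> 0}" by auto
  thus "finite {(S, K). c * A S K \<noteq> 0} \<and> (\<forall>S K. c * A S K \<noteq> 0 \<longrightarrow> finite S)"
    using * finite_subset by auto
qed
lift_definition times_spoly :: "spoly \<Rightarrow> spoly \<Rightarrow> spoly" is super_mult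
  using finite_super_mult super_mult_nonzeroE by (metis (no_types, lifting))

lemma super_mult_one: "finite S \<Longrightarrow> super_mult super_one A S K = A S K"
proof -
  assume f: "finite S"
  have "super_mult super_one A S K = (\<Sum>S1\<in>Pow S. if S1 = {} then A S K else 0)"
    unfolding super_mult_def
  proof (rule sum.cong[OF refl])
    fix S1 assume "S1 \<in> Pow S"
    have "(\<Sum>K1\<in>{K1. K1 \<subseteq># K}. shuffle_sign S1 (S - S1) * super_one S1 K1 * A (S - S1) (K - K1)) =
      (\<Sum>K1\<in>{K1. K1 \<subseteq># K}. if K1 = {#} then (if S1 = {} then A S K else 0) else 0)"
      by (rule sum.cong) (auto simp: super_one_def shuffle_sign_def)
    thus "(\<Sum>K1\<in>{K1. K1 \<subseteq># K}. shuffle_sign S1 (S - S1) * super_one S1 K1 * A (S - S1) (K - K1)) =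
         (if S1 = {} then A S K else 0)" by (simp add: sum.delta' finite_submultisets)
  qed
  thus ?thesis using f by simp
qed

lemma super_mult_one_right: "finite S \<Longrightarrow> super_mult A super_one S K = A S K"
proof -
  assume f: "finite S"
  have "super_mult A super_one S K = (\<Sum>S1\<in>Pow S. if S1 = S then A S K else 0)"
    unfolding super_mult_def
  proof (rule sum.cong[OF refl])
    fix S1 assume "S1 \<in> Pow S"
    hence S1: "S - S1 = {} \<longleftrightarrow> S1 = S" by auto
    have "(\<Sum>K1\<in>{K1. K1 \<subseteq># K}. shuffle_sign S1 (S - S1) * A S1 K1 * super_one (S - S1) (K - K1)) =
      (\<Sum>K1\<in>{K1. K1 \<subseteq># K}. if K1 = K then (if S1 = S then A S K else 0) else 0)"
      using S1 by (intro sum.cong) (auto simp: super_one_def shuffle_sign_empty Diff_eq_empty_iff_mset)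
    thus "(\<Sum>K1\<in>{K1. K1 \<subseteq># K}. shuffle_sign S1 (S - S1) * A S1 K1 * super_one (S - S1) (K - K1)) =
         (if S1 = S then A S K else 0)" by (simp add: sum.delta' finite_submultisets)
  qed
  thus ?thesis using f by simp
qed

instance
proof
  fix a b c :: spoly and x y :: real
  show "a + b + c = a + (b + c)" by transfer (simp add: algebra_simps)
  show "a + b = b + a" by transfer (simp add: algebra_simps)
  show "0 + a = a" by transfer simp
  show "- a + a = 0" by transfer simp
  show "a - b = a + - b" by transfer simp
  show "x *\<^sub>R (a + b) = x *\<^sub>R a + x *\<^sub>R b" by transfer (simp add: algebra_simps)
  show "(x + y) *\<^sub>R a = x *\<^sub>R a + y *\<^sub>R a" by transfer (simp add: algebra_simps)
  show "x *\<^sub>R y *\<^sub>R a = (x * y) *\<^sub>R a" by transfer (simp add: algebra_simps)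
  show "1 *\<^sub>R a = a" by transfer simp
  show "a * b * c = a * (b * c)" by transfer (simp add: super_mult_assoc fun_eq_iff)
  show "(a + b) * c = a * c + b * c"
    by transfer (simp add: super_mult_def algebra_simps sum.distrib fun_eq_iff)
  show "a * (b + c) = a * b + a * c"
    by transfer (simp add: super_mult_def algebra_simps sum.distrib fun_eq_iff)
  show "x *\<^sub>R a * b = x *\<^sub>R (a * b)"
    by transfer (simp add: super_mult_def sum_distrib_left mult.left_commute mult.assoc)
  show "a * x *\<^sub>R b = x *\<^sub>R (a * b)"
    by transfer (simp add: super_mult_def sum_distrib_left mult.left_commute mult.assoc)
  show "(0::spoly) \<noteq> 1" by transfer (auto simp: super_one_def fun_eq_iff)
  show "1 * a = a"
  proof (transfer, intro ext)
    fix A :: superpoly and S K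
    assume "finite {(S, K). A S K \<noteq> 0} \<and> (\<forall>S K. A S K \<noteq> 0 \<longrightarrow> finite S)"
    thus "super_mult super_one A S K = A S K"
      using super_mult_one super_mult_nonzeroE by (metis (no_types, lifting))
  qed
  show "a * 1 = a"
  proof (transfer, intro ext)
    fix A :: superpoly and S K
    assume "finite {(S, K). A S K \<noteq> 0} \<and> (\<forall>S K. A S K \<noteq> 0 \<longrightarrow> finite S)"
    thus "super_mult A super_one S K = A S K"
      using super_mult_one_right super_mult_nonzeroE by (metis (no_types, lifting))
  qed
qed

end

lemma coef_inject_ext: "(\<And>S K. coef A S K = coef B S K) \<Longrightarrow> A = B"
  by (metis coef_inject ext)

lemma coef_infinite: "infinite S \<Longrightarrow> coef A S K = 0"
  using coef by blast

lemma coef_zero [simp]: "coef 0 S K = 0" by transfer simp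
lemma coef_add [simp]: "coef (A + B) S K = coef A S K + coef B S K" by transfer simp
lemma coef_diff [simp]: "coef (A - B) S K = coef A S K - coef B S K" by transfer simp
lemma coef_minus [simp]: "coef (- A) S K = - coef A S K" by transfer simp
lemma coef_scaleR [simp]: "coef (c *\<^sub>R A) S K = c * coef A S K" by transfer simp
lemma coef_one: "coef 1 = super_one" by transfer simp
lemma coef_mult: "coef (A * B) = super_mult (coef A) (coef B)" by transfer simp
lemma coef_sum [simp]: "coef (sum f X) S K = (\<Sum>x\<in>X. coef (f x) S K)"
  by (induction X rule: infinite_finite_induct) auto

text \<open>
The generators \<open>\<tau>\<^sup>c\<close> and \<open>p\<^sub>i\<close>, and the monomial \<open>\<tau>\<^sup>S p\<^sup>K\<close> (which is 0 for infinite \<open>S\<close>).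
\<close>

lift_definition \<tau> :: "nat \<Rightarrow> spoly" is tau_var
proof -
  fix c
  have "{(S :: nat set, K :: nat multiset). tau_var c S K \<noteq> 0} \<subseteq> {({c}, {#})}"
    by (auto simp: tau_var_def split: if_splits)
  thus "finite {(S, K). tau_var c S K \<noteq> 0} \<and> (\<forall>S K. tau_var c S K \<noteq> 0 \<longrightarrow> finite S)"
    using finite_subset by (auto simp: tau_var_def)
qed

lift_definition p_gen :: "nat \<Rightarrow> spoly" is p_var
proof -
  fix c
  have "{(S :: nat set, K :: nat multiset). p_var c S K \<noteq> 0} \<subseteq> {({}, {#c#})}"
    by (auto simp: p_var_def split: if_splits)
  thus "finite {(S, K). p_var c S K \<noteq> 0} \<and> (\<forall>S K. p_var c S K \<noteq> 0 \<longrightarrow> finite S)"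
    using finite_subset by (auto simp: p_var_def)
qed

lift_definition mono :: "nat set \<Rightarrow> nat multiset \<Rightarrow> spoly" is
  "\<lambda>S K S' K'. if finite S \<and> S' = S \<and> K' = K then 1 else 0"
proof -
  fix S :: "nat set" and K :: "nat multiset"
  have "{(S', K'). (if finite S \<and> S' = S \<and> K' = K then 1 else 0::real) \<noteq> 0} \<subseteq> {(S, K)}"
    by (auto split: if_splits)
  thus "finite {(S', K'). (if finite S \<and> S' = S \<and> K' = K then 1 else 0::real) \<noteq> 0} \<and>
    (\<forall>S' K'. (if finite S \<and> S' = S \<and> K' = K then 1 else 0::real) \<noteq> 0 \<longrightarrow> finite S')"
    using finite_subset by auto
qed

lemma finite_image_support:
  assumes "finite {(S, K). A S K \<noteq> (0::real)}" "\<And>S K. B S K \<noteq> 0 \<Longrightarrow> \<exists>S' K'. A S' K' \<noteq> (0::real) \<and> (S, K) = f (S', K')"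
  shows "finite {(S, K). B S K \<noteq> (0::real)}"
  by (rule finite_subset[of _ "f ` {(S, K). A S K \<noteq> 0}"]) (use assms in \<open>auto dest: assms(2)\<close>)

text \<open>
The partial derivatives: \<open>D\<tau>\<close> from the left and \<open>D\<tau>R\<close> from the right in \<open>\<tau>\<^sup>c\<close>, \<open>Dp\<close> in \<open>p\<^sub>i\<close>.
\<close>

lift_definition D\<tau> :: "nat \<Rightarrow> spoly \<Rightarrow> spoly" is dtau_left
proof -
  fix c and A :: superpoly
  assume *: "finite {(S, K). A S K \<noteq> 0} \<and> (\<forall>S K. A S K \<noteq> 0 \<longrightarrow> finite S)"
  have "finite {(S, K). dtau_left c A S K \<noteq> 0}"
    by (rule finite_image_support[OF conjunct1[OF *], where f = "\<lambda>(S, K). (S - {c}, K)"])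
       (force simp: dtau_left_def split: if_splits)
  thus "finite {(S, K). dtau_left c A S K \<noteq> 0} \<and> (\<forall>S K. dtau_left c A S K \<noteq> 0 \<longrightarrow> finite S)"
    using * by (auto simp: dtau_left_def split: if_splits)
qed

lift_definition D\<tau>R :: "nat \<Rightarrow> spoly \<Rightarrow> spoly" is dtau_right
proof -
  fix c and A :: superpoly
  assume *: "finite {(S, K). A S K \<noteq> 0} \<and> (\<forall>S K. A S K \<noteq> 0 \<longrightarrow> finite S)"
  have "finite {(S, K). dtau_right c A S K \<noteq> 0}"
    by (rule finite_image_support[OF conjunct1[OF *], where f = "\<lambda>(S, K). (S - {c}, K)"])
       (force simp: dtau_right_def split: if_splits)
  thus "finite {(S, K). dtau_right c A S K \<noteq> 0} \<and> (\<forall>S K. dtau_right c A S K \<noteq> 0 \<longrightarrow> finite S)"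
    using * by (auto simp: dtau_right_def split: if_splits)
qed

lift_definition Dp :: "nat \<Rightarrow> spoly \<Rightarrow> spoly" is dp
proof -
  fix i and A :: superpoly
  assume *: "finite {(S, K). A S K \<noteq> 0} \<and> (\<forall>S K. A S K \<noteq> 0 \<longrightarrow> finite S)"
  have "finite {(S, K). dp i A S K \<noteq> 0}"
    by (rule finite_image_support[OF conjunct1[OF *], where f = "\<lambda>(S, K). (S, K - {#i#})"])
       (force simp: dp_def)
  thus "finite {(S, K). dp i A S K \<noteq> 0} \<and> (\<forall>S K. dp i A S K \<noteq> 0 \<longrightarrow> finite S)"
    using * by (auto simp: dp_def)
qed

text \<open>
The parity involution, \<open>\<plusminus>1\<close> on even and odd elements. With it all sign rules can be stated without
reference to degrees: \<open>A\<close> is even iff \<open>eps A = A\<close> and odd iff \<open>eps A = - A\<close>.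
\<close>

lift_definition eps :: "spoly \<Rightarrow> spoly" is "\<lambda>A S K. (-1) ^ card S * A S K"
  by auto

lemma coef_eps [simp]: "coef (eps A) S K = (-1) ^ card S * coef A S K" by transfer simp

lemma coef_mono: "coef (mono S K) S' K' = (if finite S \<and> S' = S \<and> K' = K then 1 else 0)"
  by transfer simp

lemma coef_\<tau>_mult: "coef (\<tau> c * A) S K =
  (if c \<in> S then (-1) ^ card {s\<in>S. s < c} * coef A (S - {c}) K else 0)"
proof (cases "finite S")
  case False
  thus ?thesis by (simp add: coef_infinite)
next
  case True
  have "coef (\<tau> c * A) S K = (\<Sum>S1\<in>Pow S. if S1 = {c} then shuffle_sign {c} (S - {c}) * coef A (S - {c}) K else 0)"
    unfolding coef_mult super_mult_def \<tau>.rep_eq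
  proof (rule sum.cong[OF refl])
    fix S1 assume "S1 \<in> Pow S"
    have "(\<Sum>K1 | K1 \<subseteq># K. shuffle_sign S1 (S - S1) * tau_var c S1 K1 * coef A (S - S1) (K - K1)) =
      (\<Sum>K1 | K1 \<subseteq># K. if K1 = {#} then (if S1 = {c} then shuffle_sign {c} (S - {c}) * coef A (S - {c}) K else 0) else 0)"
      by (rule sum.cong) (auto simp: tau_var_def)
    thus "(\<Sum>K1 | K1 \<subseteq># K. shuffle_sign S1 (S - S1) * tau_var c S1 K1 * coef A (S - S1) (K - K1)) =
         (if S1 = {c} then shuffle_sign {c} (S - {c}) * coef A (S - {c}) K else 0)"
      by (simp add: sum.delta' finite_submultisets)
  qed
  also have "\<dots> = (if c \<in> S then shuffle_sign {c} (S - {c}) * coef A (S - {c}) K else 0)"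
    using True by simp
  also have "shuffle_sign {c} (S - {c}) = (-1) ^ card {s\<in>S. s < c}"
  proof -
    have "{(s, t). s \<in> {c} \<and> t \<in> S - {c} \<and> t < s} = Pair c ` {s\<in>S. s < c}" by auto
    thus ?thesis by (simp add: shuffle_sign_def card_image inj_on_def)
  qed
  finally show ?thesis .
qed

lemma coef_p_gen_mult: "coef (p_gen i * A) S K = (if i \<in># K then coef A S (K - {#i#}) else 0)"
proof (cases "finite S")
  case False
  thus ?thesis by (simp add: coef_infinite)
next
  case True
  have "coef (p_gen i * A) S K = (\<Sum>S1\<in>Pow S. if S1 = {} then (if i \<in># K then coef A S (K - {#i#}) else 0) else 0)"
    unfolding coef_mult super_mult_def p_gen.rep_eq
  proof (rule sum.cong[OF refl])
    fix S1 assume "S1 \<in> Pow S"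
    have "(\<Sum>K1 | K1 \<subseteq># K. shuffle_sign S1 (S - S1) * p_var i S1 K1 * coef A (S - S1) (K - K1)) =
      (\<Sum>K1 | K1 \<subseteq># K. if K1 = {#i#} then (if S1 = {} then coef A S (K - {#i#}) else 0) else 0)"
      by (rule sum.cong) (auto simp: p_var_def shuffle_sign_empty)
    thus "(\<Sum>K1 | K1 \<subseteq># K. shuffle_sign S1 (S - S1) * p_var i S1 K1 * coef A (S - S1) (K - K1)) =
         (if S1 = {} then (if i \<in># K then coef A S (K - {#i#}) else 0) else 0)"
      by (simp add: sum.delta' finite_submultisets)
  qed
  thus ?thesis using True by simp
qed

lemma D\<tau>_add [simp]: "D\<tau> c (A + B) = D\<tau> c A + D\<tau> c B"
  by transfer (simp add: dtau_left_def fun_eq_iff algebra_simps)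
lemma D\<tau>_scaleR [simp]: "D\<tau> c (x *\<^sub>R A) = x *\<^sub>R D\<tau> c A"
  by transfer (simp add: dtau_left_def fun_eq_iff algebra_simps)
lemma Dp_add [simp]: "Dp c (A + B) = Dp c A + Dp c B"
  by transfer (simp add: dp_def fun_eq_iff algebra_simps)
lemma Dp_scaleR [simp]: "Dp c (x *\<^sub>R A) = x *\<^sub>R Dp c A"
  by transfer (simp add: dp_def fun_eq_iff algebra_simps)
lemma eps_add [simp]: "eps (A + B) = eps A + eps B"
  by transfer (simp add: fun_eq_iff algebra_simps)
lemma eps_scaleR [simp]: "eps (x *\<^sub>R A) = x *\<^sub>R eps A"
  by transfer (simp add: fun_eq_iff algebra_simps)

lemma D\<tau>_zero [simp]: "D\<tau> c 0 = 0" using D\<tau>_scaleR[of c 0 0] by simp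
lemma Dp_zero [simp]: "Dp c 0 = 0" using Dp_scaleR[of c 0 0] by simp
lemma eps_zero [simp]: "eps 0 = 0" using eps_scaleR[of 0 0] by simp
lemma D\<tau>_minus [simp]: "D\<tau> c (- A) = - D\<tau> c A" using D\<tau>_scaleR[of c "-1" A] by simp
lemma Dp_minus [simp]: "Dp c (- A) = - Dp c A" using Dp_scaleR[of c "-1" A] by simp
lemma eps_minus [simp]: "eps (- A) = - eps A" using eps_scaleR[of "-1" A] by simp
lemma D\<tau>_diff [simp]: "D\<tau> c (A - B) = D\<tau> c A - D\<tau> c B" using D\<tau>_add[of c A "-B"] by simp
lemma Dp_diff [simp]: "Dp c (A - B) = Dp c A - Dp c B" using Dp_add[of c A "-B"] by simp
lemma eps_diff [simp]: "eps (A - B) = eps A - eps B" using eps_add[of A "-B"] by simp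
lemma D\<tau>_sum [simp]: "D\<tau> c (sum f X) = (\<Sum>x\<in>X. D\<tau> c (f x))"
  by (induction X rule: infinite_finite_induct) auto
lemma Dp_sum [simp]: "Dp c (sum f X) = (\<Sum>x\<in>X. Dp c (f x))"
  by (induction X rule: infinite_finite_induct) auto
lemma eps_sum [simp]: "eps (sum f X) = (\<Sum>x\<in>X. eps (f x))"
  by (induction X rule: infinite_finite_induct) auto

lemma eps_mult [simp]: "eps (A * B) = eps A * eps B"
proof (rule coef_inject_ext)
  fix S K
  show "coef (eps (A * B)) S K = coef (eps A * eps B) S K"
  proof (cases "finite S")
    case True
    show ?thesis unfolding coef_eps coef_mult super_mult_def sum_distrib_left
    proof (intro sum.cong refl)
      fix S1 K1 assume S1: "S1 \<in> Pow S"
      hence "card S = card S1 + card (S - S1)"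
        using True by (metis PowD card_Un_disjoint Diff_disjoint Un_Diff_cancel finite_Diff finite_subset sup.absorb_iff2)
      thus "(- 1) ^ card S * (shuffle_sign S1 (S - S1) * coef A S1 K1 * coef B (S - S1) (K - K1)) =
        shuffle_sign S1 (S - S1) * ((- 1) ^ card S1 * coef A S1 K1) * ((- 1) ^ card (S - S1) * coef B (S - S1) (K - K1))"
        by (simp add: power_add)
    qed
  qed (simp add: coef_infinite)
qed

lemma eps_one [simp]: "eps 1 = 1"
  by (rule coef_inject_ext) (auto simp: coef_one super_one_def)

lemma eps_eps [simp]: "eps (eps A) = A"
  by (rule coef_inject_ext) (simp add: mult.assoc[symmetric] power_mult_distrib[symmetric])

lemma eps_\<tau> [simp]: "eps (\<tau> c) = - \<tau> c"
  by (rule coef_inject_ext) (auto simp: \<tau>.rep_eq tau_var_def)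

lemma eps_p_gen [simp]: "eps (p_gen c) = p_gen c"
  by (rule coef_inject_ext) (auto simp: p_gen.rep_eq p_var_def)

lemma minus_one_power_mult: "odd m \<Longrightarrow> (- 1::real) ^ (m * n) = (- 1) ^ n"
  "even m \<Longrightarrow> (- 1::real) ^ (m * n) = 1"
  by (simp_all add: power_mult)

lemma mset_double_diff: "M \<subseteq># K \<Longrightarrow> K - (K - M) = (M :: 'a multiset)"
  by (rule multiset_eqI) (simp add: subseteq_mset_def)

text \<open>
Graded commutativity, with the sign \<open>(-1)\<^sup>|\<^sup>A\<^sup>|\<^sup>|\<^sup>B\<^sup>|\<close> kept as a function \<open>\<sigma>\<close> of the second factor.
\<close>

lemma mult_commute_gen:
  assumes "\<And>S S' K K'. coef A S K \<noteq> 0 \<Longrightarrow> coef B S' K' \<noteq> 0 \<Longrightarrow> (-1::real) ^ (card S * card S') = \<sigma> S'"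
  shows "coef (A * B) S K = super_mult (\<lambda>S K. \<sigma> S * coef B S K) (coef A) S K"
proof (cases "finite S")
  case False
  hence "infinite (Pow S)" by simp
  thus ?thesis by (simp add: super_mult_def coef_mult)
next
  case True
  have "coef (A * B) S K = (\<Sum>(S1, K1)\<in>Pow S \<times> {K1. K1 \<subseteq># K}. shuffle_sign S1 (S - S1) * coef A S1 K1 * coef B (S - S1) (K - K1))"
    by (simp add: coef_mult super_mult_def sum.cartesian_product)
  also have "\<dots> = (\<Sum>(S1, K1)\<in>Pow S \<times> {K1. K1 \<subseteq># K}. shuffle_sign S1 (S - S1) * (\<sigma> S1 * coef B S1 K1) * coef A (S - S1) (K - K1))"
  proof (rule sum.reindex_bij_witness[where i = "\<lambda>(S1, K1). (S - S1, K - K1)" and j = "\<lambda>(S1, K1). (S - S1, K - K1)"])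
    fix a assume "a \<in> Pow S \<times> {K1. K1 \<subseteq># K}"
    then obtain X M where a: "a = (X, M)" "X \<subseteq> S" "M \<subseteq># K" by auto
    show "(\<lambda>(S1, K1). (S - S1, K - K1)) ((\<lambda>(S1, K1). (S - S1, K - K1)) a) = a"
      using a by (auto simp: double_diff mset_double_diff)
    show "(\<lambda>(S1, K1). (S - S1, K - K1)) a \<in> Pow S \<times> {K1. K1 \<subseteq># K}" using a by auto
    have fX: "finite X" "finite (S - X)" using a True finite_subset by auto
    have \<sigma>: "\<sigma> (S - X) * \<sigma> (S - X) = 1" if "coef A X M \<noteq> 0" "coef B (S - X) (K - M) \<noteq> 0"
      unfolding assms[OF that, symmetric] by (simp flip: power_mult_distrib)
    have "S - (S - X) = X" "K - (K - M) = M" using a by (auto simp: mset_double_diff)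
    thus "(case (\<lambda>(S1, K1). (S - S1, K - K1)) a of (S1, K1) \<Rightarrow> shuffle_sign S1 (S - S1) * (\<sigma> S1 * coef B S1 K1) * coef A (S - S1) (K - K1)) =
        (case a of (S1, K1) \<Rightarrow> shuffle_sign S1 (S - S1) * coef A S1 K1 * coef B (S - S1) (K - K1))"
      using a assms[of X M "S - X" "K - M"] \<sigma>
      by (cases "coef A X M = 0 \<or> coef B (S - X) (K - M) = 0")
         (auto simp: shuffle_sign_swap[OF fX])
  qed (auto simp: double_diff mset_double_diff)
  also have "\<dots> = super_mult (\<lambda>S K. \<sigma> S * coef B S K) (coef A) S K"
    by (simp add: super_mult_def sum.cartesian_product)
  finally show ?thesis .
qed

lemma even_mult_commute:
  assumes "eps A = A" shows "A * B = B * A"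
proof (rule coef_inject_ext)
  fix S K
  have ev: "even (card S)" if "coef A S K \<noteq> 0" for S K
    using that arg_cong[OF assms, of "\<lambda>A. coef A S K"] by (cases "even (card S)") auto
  show "coef (A * B) S K = coef (B * A) S K"
    by (subst mult_commute_gen[where \<sigma> = "\<lambda>_. 1"]) (auto simp: minus_one_power_mult ev coef_mult)
qed

lemma odd_mult_commute:
  assumes "eps A = - A" shows "A * B = eps B * A"
proof (rule coef_inject_ext)
  fix S K
  have ev: "odd (card S)" if "coef A S K \<noteq> 0" for S K
    using that arg_cong[OF assms, of "\<lambda>A. coef A S K"] by (cases "even (card S)") auto
  have "coef (eps B) = (\<lambda>S K. (-1) ^ card S * coef B S K)" by (intro ext) simp
  thus "coef (A * B) S K = coef (eps B * A) S K"
    by (subst mult_commute_gen[where \<sigma> = "\<lambda>S. (-1) ^ card S"]) (auto simp: minus_one_power_mult ev coef_mult)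
qed

lemma D\<tau>_one [simp]: "D\<tau> c 1 = 0"
  by (rule coef_inject_ext) (simp add: D\<tau>.rep_eq dtau_left_def coef_one super_one_def)
lemma Dp_one [simp]: "Dp c 1 = 0"
  by (rule coef_inject_ext) (simp add: Dp.rep_eq dp_def coef_one super_one_def)

lemma D\<tau>_\<tau>_mult: "D\<tau> c (\<tau> d * A) = (if c = d then A else 0) - \<tau> d * D\<tau> c A"
proof (rule coef_inject_ext)
  fix S K
  show "coef (D\<tau> c (\<tau> d * A)) S K = coef ((if c = d then A else 0) - \<tau> d * D\<tau> c A) S K"
  proof (cases "finite S")
    case fin: True
    have sgn: "(-1::real) ^ card X * (-1) ^ card X = 1" for X :: "nat set"
      by (simp flip: power_mult_distrib)
    show ?thesis
    proof (cases "c = d")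
      case True
      show ?thesis
      proof (cases "c \<in> S")
        case cS: True
        have "{s \<in> S - {c}. s < c} = {s \<in> S. s < c}" by auto
        thus ?thesis using True cS sgn[of "{s \<in> S. s < c}"]
          by (simp add: D\<tau>.rep_eq dtau_left_def coef_\<tau>_mult insert_absorb)
      next
        case False
        have "{s. (s = c \<or> s \<in> S) \<and> s < c} = {s \<in> S. s < c}" by auto
        thus ?thesis using True False sgn[of "{s \<in> S. s < c}"]
          by (simp add: D\<tau>.rep_eq dtau_left_def coef_\<tau>_mult)
      qed
    next
      case cd: False
      show ?thesis
      proof (cases "c \<notin> S \<and> d \<in> S")
        case True
        have e: "insert c S - {d} = insert c (S - {d})" using cd by auto
        have "(-1::real) ^ (card {s \<in> S. s < c} + card {s \<in> insert c S. s < d}) =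
          - ((-1) ^ (card {s \<in> S. s < d} + card {s \<in> S - {d}. s < c}))"
        proof (cases "c < d")
          case lt: True
          have 1: "{s \<in> S - {d}. s < c} = {s \<in> S. s < c}" using lt by auto
          have 2: "{s \<in> insert c S. s < d} = insert c {s \<in> S. s < d}" using lt by auto
          show ?thesis unfolding 1 2 using fin True by (simp add: power_add)
        next
          case lt: False
          hence lt: "d < c" using cd by simp
          have 1: "{s \<in> S. s < c} = insert d {s \<in> S - {d}. s < c}" using lt True by auto
          have 2: "{s \<in> insert c S. s < d} = {s \<in> S. s < d}" using lt by auto
          show ?thesis unfolding 1 2 using fin True by (simp add: power_add)
        qed
        thus ?thesis using True cd
          by (simp add: D\<tau>.rep_eq dtau_left_def coef_\<tau>_mult e power_add flip: mult.assoc)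
      next
        case False
        thus ?thesis using cd by (auto simp: D\<tau>.rep_eq dtau_left_def coef_\<tau>_mult)
      qed
    qed
  qed (simp add: coef_infinite)
qed

lemma D\<tau>_p_gen_mult: "D\<tau> c (p_gen i * A) = p_gen i * D\<tau> c A"
  by (rule coef_inject_ext) (simp add: D\<tau>.rep_eq dtau_left_def coef_p_gen_mult)

lemma Dp_\<tau>_mult: "Dp i (\<tau> d * A) = \<tau> d * Dp i A"
  by (rule coef_inject_ext) (simp add: Dp.rep_eq dp_def coef_\<tau>_mult)

lemma Dp_p_gen_mult: "Dp i (p_gen j * A) = (if i = j then A else 0) + p_gen j * Dp i A"
proof (rule coef_inject_ext)
  fix S K
  show "coef (Dp i (p_gen j * A)) S K = coef ((if i = j then A else 0) + p_gen j * Dp i A) S K"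
  proof (cases "j \<in># K")
    case True
    then obtain K' where "K = add_mset j K'" by (metis insert_DiffM)
    thus ?thesis by (simp add: Dp.rep_eq dp_def coef_p_gen_mult algebra_simps)
  next
    case False
    moreover from this have "count K j = 0" by (simp add: not_in_iff)
    ultimately show ?thesis by (auto simp: Dp.rep_eq dp_def coef_p_gen_mult)
  qed
qed

lemma \<tau>_mult_mono:
  assumes "finite S"
  shows "\<tau> c * mono S K = (if c \<in> S then 0 else (-1) ^ card {s\<in>S. s < c} *\<^sub>R mono (insert c S) K)"
proof (rule coef_inject_ext)
  fix S' K'
  have "{s \<in> insert c S. s < c} = {s \<in> S. s < c}" by auto
  thus "coef (\<tau> c * mono S K) S' K' =
     coef (if c \<in> S then 0 else (-1) ^ card {s\<in>S. s < c} *\<^sub>R mono (insert c S) K) S' K'"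
    using assms by (auto simp: coef_\<tau>_mult coef_mono insert_absorb)
qed

lemma p_gen_mult_mono: "p_gen i * mono S K = mono S (add_mset i K)"
  by (rule coef_inject_ext) (auto simp: coef_p_gen_mult coef_mono)

lemma mono_empty: "mono {} {#} = 1"
  by (rule coef_inject_ext) (auto simp: coef_mono coef_one super_one_def)

text \<open>
The set of exponents \<open>(S, K)\<close> whose monomials occur in \<open>A\<close>.
\<close>

definition supp :: "spoly \<Rightarrow> (nat set \<times> nat multiset) set" where
  "supp A = {(S, K). coef A S K \<noteq> 0}"

lemma finite_supp: "finite (supp A)" using coef[of A] by (simp add: supp_def)

lemma spoly_expand:
  assumes "finite Z" "supp A \<subseteq> Z"
  shows "A = (\<Sum>(S, K)\<in>Z. coef A S K *\<^sub>R mono S K)"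
proof (rule coef_inject_ext)
  fix S K
  have "coef (\<Sum>(S, K)\<in>Z. coef A S K *\<^sub>R mono S K) S K =
    (\<Sum>z\<in>Z. if z = (S, K) then coef A S K * (if finite S then 1 else 0) else 0)"
    by (auto simp: coef_mono split_def intro!: sum.cong)
  thus "coef A S K = coef (\<Sum>(S, K)\<in>Z. coef A S K *\<^sub>R mono S K) S K"
    using assms by (auto simp: supp_def coef_infinite)
qed

lemma mono_induct:
  assumes "P 1" "\<And>x A. P A \<Longrightarrow> P (x *\<^sub>R A)"
    "\<And>c A. c \<in> X \<Longrightarrow> P A \<Longrightarrow> P (\<tau> c * A)" "\<And>i A. i \<in> Y \<Longrightarrow> P A \<Longrightarrow> P (p_gen i * A)"
    "finite S" "S \<subseteq> X" "set_mset K \<subseteq> Y"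
  shows "P (mono S K)"
  using assms(5,6)
proof (induction S rule: finite_induct)
  case empty
  show ?case using assms(7)
  proof (induction K)
    case (add i K)
    thus ?case using assms(4)[of i "mono {} K"] by (simp add: p_gen_mult_mono)
  qed (simp add: mono_empty assms)
next
  case (insert c S)
  let ?s = "(-1::real) ^ card {s\<in>S. s < c}"
  have "?s * ?s = 1" by (simp flip: power_mult_distrib)
  hence "mono (insert c S) K = ?s *\<^sub>R (\<tau> c * mono S K)"
    using insert by (simp add: \<tau>_mult_mono)
  thus ?case using insert assms(2,3) by simp
qed

text \<open>
The induction principle behind all identities for derivatives and substitutions below: an element that
involves only \<open>\<tau>\<^sup>c\<close>, \<open>c \<in> X\<close>, and \<open>p\<^sub>i\<close>, \<open>i \<in> Y\<close>, is built from 1 by linear combinations and left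
multiplication by these generators.
\<close>

lemma spoly_induct_supp:
  assumes "supp A \<subseteq> {(S, K). S \<subseteq> X \<and> set_mset K \<subseteq> Y}"
    and "P 1" "\<And>x A. P A \<Longrightarrow> P (x *\<^sub>R A)" "\<And>A B. P A \<Longrightarrow> P B \<Longrightarrow> P (A + B)"
    "\<And>c A. c \<in> X \<Longrightarrow> P A \<Longrightarrow> P (\<tau> c * A)" "\<And>i A. i \<in> Y \<Longrightarrow> P A \<Longrightarrow> P (p_gen i * A)"
  shows "P A"
proof -
  have P0: "P 0" using assms(2) assms(3)[of 1 0] by simp
  have "P (\<Sum>(S, K)\<in>Z. coef A S K *\<^sub>R mono S K)" if "finite Z" "Z \<subseteq> supp A" for Z
    using that
  proof (induction Z rule: finite_induct)
    case (insert z Z)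
    obtain S K where z: "z = (S, K)" by force
    have "coef A S K \<noteq> 0" using insert.prems z by (auto simp: supp_def)
    have "finite S" using \<open>coef A S K \<noteq> 0\<close> coef_infinite by blast
    have "S \<subseteq> X" "set_mset K \<subseteq> Y"
      using assms(1) \<open>coef A S K \<noteq> 0\<close> by (auto simp: supp_def)
    have "P (mono S K)"
      by (rule mono_induct[where X = X and Y = Y]) (fact assms(2,3,5,6) \<open>S \<subseteq> X\<close> \<open>set_mset K \<subseteq> Y\<close> \<open>finite S\<close>)+
    thus ?case using insert z assms(3,4) by simp
  qed (simp add: P0)
  from this[OF finite_supp order_refl] show ?thesis
    using spoly_expand[OF finite_supp order_refl, of A] by simp
qed

lemma spoly_induct [case_names one scaleR add \<tau> p_gen]:
  assumes "P 1" "\<And>x A. P A \<Longrightarrow> P (x *\<^sub>R A)" "\<And>A B. P A \<Longrightarrow> P B \<Longrightarrow> P (A + B)"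
    "\<And>c A. P A \<Longrightarrow> P (\<tau> c * A)" "\<And>i A. P A \<Longrightarrow> P (p_gen i * A)"
  shows "P A"
  by (rule spoly_induct_supp[where X = UNIV and Y = UNIV]) (use assms in auto)

lemma D\<tau>_mult: "D\<tau> c (A * B) = D\<tau> c A * B + eps A * D\<tau> c B"
  by (induction A rule: spoly_induct)
     (auto simp: algebra_simps D\<tau>_\<tau>_mult D\<tau>_p_gen_mult mult.assoc)

lemma Dp_mult: "Dp i (A * B) = Dp i A * B + A * Dp i B"
  by (induction A rule: spoly_induct)
     (auto simp: algebra_simps Dp_\<tau>_mult Dp_p_gen_mult mult.assoc)

lemma eps_D\<tau>: "eps (D\<tau> c A) = - D\<tau> c (eps A)"
  by (induction A rule: spoly_induct)
     (auto simp: algebra_simps D\<tau>_\<tau>_mult D\<tau>_p_gen_mult mult.assoc)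

lemma eps_Dp: "eps (Dp c A) = Dp c (eps A)"
  by (induction A rule: spoly_induct)
     (auto simp: algebra_simps Dp_\<tau>_mult Dp_p_gen_mult mult.assoc)

lemma D\<tau>_D\<tau>: "D\<tau> c (D\<tau> d A) = - D\<tau> d (D\<tau> c A)"
proof (induction A rule: spoly_induct)
  case (\<tau> e A)
  have *: "D\<tau> a (D\<tau> b (\<tau> e * A)) =
     (if b = e then D\<tau> a A else 0) - (if a = e then D\<tau> b A else 0) + \<tau> e * D\<tau> a (D\<tau> b A)" for a b
    by (simp add: D\<tau>_\<tau>_mult)
  show ?case unfolding * by (subst \<tau>) simp
next
  case (p_gen i A)
  show ?case unfolding D\<tau>_p_gen_mult by (subst p_gen) simp
next
  case (add A B)
  show ?case unfolding D\<tau>_add by (subst add(1), subst add(2)) simp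
next
  case (scaleR c A)
  show ?case unfolding D\<tau>_scaleR by (subst scaleR) simp
qed simp

lemma D\<tau>_Dp: "D\<tau> c (Dp i A) = Dp i (D\<tau> c A)"
  by (induction A rule: spoly_induct)
     (auto simp: algebra_simps D\<tau>_\<tau>_mult D\<tau>_p_gen_mult Dp_\<tau>_mult Dp_p_gen_mult mult.assoc)

lemma Dp_Dp: "Dp c (Dp i A) = Dp i (Dp c A)"
  by (induction A rule: spoly_induct)
     (auto simp: algebra_simps Dp_\<tau>_mult Dp_p_gen_mult mult.assoc)

lemma D\<tau>R_eq: "D\<tau>R c A = eps (D\<tau> c A)"
proof (rule coef_inject_ext)
  fix S K
  show "coef (D\<tau>R c A) S K = coef (eps (D\<tau> c A)) S K"
  proof (cases "finite S \<and> c \<notin> S")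
    case True
    have "s < c \<or> c < s" if "s \<in> S" for s using that True by (metis linorder_neqE_nat)
    hence "S = {s\<in>S. s < c} \<union> {s\<in>S. c < s}" by blast
    from arg_cong[OF this, of card] have "card S = card {s\<in>S. s < c} + card {s\<in>S. c < s}"
      using True card_Un_disjoint[of "{s\<in>S. s < c}" "{s\<in>S. c < s}"] by force
    moreover have "(-1::real) ^ x = (-1) ^ (y + x) * (-1) ^ y" for x y :: nat
      by (cases "even x"; cases "even y") auto
    ultimately have "(-1::real) ^ card {s\<in>S. c < s} = (-1) ^ card S * (-1) ^ card {s\<in>S. s < c}"
      by presburger
    thus ?thesis using True by (simp add: D\<tau>R.rep_eq D\<tau>.rep_eq dtau_right_def dtau_left_def)
  qed (auto simp: coef_infinite D\<tau>R.rep_eq D\<tau>.rep_eq dtau_right_def dtau_left_def)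
qed

section \<open>Substitution homomorphisms and their chain rule\<close>

text \<open>
The algebra homomorphism \<open>\<tau>\<^sup>a \<mapsto> T a\<close>, \<open>p\<^sub>i \<mapsto> P i\<close>, that is, \<^const>\<open>super_subst\<close> on the type \<open>spoly\<close>.
\<close>

definition hom :: "(nat \<Rightarrow> spoly) \<Rightarrow> (nat \<Rightarrow> spoly) \<Rightarrow> spoly \<Rightarrow> spoly" where
  "hom T P A = (\<Sum>(S, K)\<in>supp A. coef A S K *\<^sub>R
     (prod_list (map T (sorted_list_of_set S)) * prod_list (map P (sorted_list_of_multiset K))))"

lemma coef_prod_list: "coef (prod_list As) = super_prod (map coef As)"
  by (induction As) (simp_all add: super_prod_def coef_one coef_mult)

lemma coef_hom: "coef (hom T P A) = super_subst (\<lambda>a. coef (T a)) (\<lambda>i. coef (P i)) (coef A)"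
proof (intro ext)
  fix S K
  have "coef (prod_list (map T xs) * prod_list (map P ys)) =
      super_prod (map (\<lambda>a. coef (T a)) xs @ map (\<lambda>i. coef (P i)) ys)" for xs ys
    using coef_prod_list[of "map T xs @ map P ys"] by (simp add: comp_def)
  thus "coef (hom T P A) S K = super_subst (\<lambda>a. coef (T a)) (\<lambda>i. coef (P i)) (coef A) S K"
    unfolding hom_def super_subst_def by (simp add: split_def supp_def)
qed

lemma hom_superset:
  assumes "finite Z" "supp A \<subseteq> Z"
  shows "hom T P A = (\<Sum>(S, K)\<in>Z. coef A S K *\<^sub>R
     (prod_list (map T (sorted_list_of_set S)) * prod_list (map P (sorted_list_of_multiset K))))"
  unfolding hom_def by (rule sum.mono_neutral_left) (use assms in \<open>auto simp: supp_def\<close>)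

lemma hom_add [simp]: "hom T P (A + B) = hom T P A + hom T P B"
proof -
  have f: "finite (supp A \<union> supp B)" by (simp add: finite_supp)
  have "supp (A + B) \<subseteq> supp A \<union> supp B" by (auto simp: supp_def)
  from hom_superset[OF f this] hom_superset[OF f, of A] hom_superset[OF f, of B] show ?thesis
    by (simp add: split_def scaleR_add_left sum.distrib)
qed

lemma hom_scaleR [simp]: "hom T P (x *\<^sub>R A) = x *\<^sub>R hom T P A"
proof -
  have "supp (x *\<^sub>R A) \<subseteq> supp A" by (auto simp: supp_def)
  from hom_superset[OF finite_supp this] show ?thesis
    by (simp add: hom_def split_def scaleR_sum_right)
qed

lemma hom_zero [simp]: "hom T P 0 = 0" using hom_scaleR[of T P 0 0] by simp
lemma hom_minus [simp]: "hom T P (- A) = - hom T P A" using hom_scaleR[of T P "-1" A] by simp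
lemma hom_diff [simp]: "hom T P (A - B) = hom T P A - hom T P B" using hom_add[of T P A "- B"] by simp
lemma hom_sum [simp]: "hom T P (sum f X) = (\<Sum>x\<in>X. hom T P (f x))"
  by (induction X rule: infinite_finite_induct) auto

lemma hom_mono:
  assumes "finite S"
  shows "hom T P (mono S K) = prod_list (map T (sorted_list_of_set S)) * prod_list (map P (sorted_list_of_multiset K))"
proof -
  have "supp (mono S K) \<subseteq> {(S, K)}" by (auto simp: supp_def coef_mono split: if_splits)
  from hom_superset[OF _ this] show ?thesis using assms by (simp add: coef_mono)
qed

lemma hom_one [simp]: "hom T P 1 = 1"
  unfolding mono_empty[symmetric] by (subst hom_mono) (simp_all add: mono_empty)

lemma linear_eq_on_mono:
  assumes "\<And>A B. f (A + B) = f A + (f B :: spoly)" "\<And>x A. f (x *\<^sub>R A) = x *\<^sub>R f A"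
    "\<And>A B. g (A + B) = g A + (g B :: spoly)" "\<And>x A. g (x *\<^sub>R A) = x *\<^sub>R g A"
    "\<And>S K. finite S \<Longrightarrow> f (mono S K) = g (mono S K)"
  shows "f A = g A"
proof -
  have z: "f 0 = 0" "g 0 = 0" using assms(2)[of 0 0] assms(4)[of 0 0] by auto
  have "f (\<Sum>(S, K)\<in>Z. coef A S K *\<^sub>R mono S K) = g (\<Sum>(S, K)\<in>Z. coef A S K *\<^sub>R mono S K)"
    if "finite Z" for Z
    using that
  proof (induction Z rule: finite_induct)
    case (insert z Z)
    show ?case
    proof (cases "finite (fst z)")
      case False
      hence "coef A (fst z) (snd z) = 0" by (rule coef_infinite)
      thus ?thesis using insert by (simp add: split_def)
    qed (use insert assms in \<open>simp add: split_def\<close>)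
  qed (simp add: z)
  from this[OF finite_supp[of A]] show ?thesis
    using spoly_expand[OF finite_supp order_refl, of A] by simp
qed

text \<open>
Parity is all that is needed for \<open>hom T P\<close> to be multiplicative: odd elements anticommute and square to 0.
\<close>

locale super_substitution =
  fixes T P :: "nat \<Rightarrow> spoly"
  assumes T_odd: "eps (T c) = - T c" and P_even: "eps (P i) = P i"
begin

abbreviation "\<Phi> \<equiv> hom T P"

lemma T_anticommute: "T c * T d = - (T d * T c)"
  using odd_mult_commute[OF T_odd, of c "T d"] by (simp add: T_odd)

lemma T_square: "T c * T c = 0"
proof -
  have "2 *\<^sub>R (T c * T c) = 0"
    using T_anticommute[of c c] by (simp add: scaleR_2 eq_neg_iff_add_eq_0)
  thus ?thesis by (simp only: scaleR_eq_0_iff) simp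
qed

lemma P_commute: "P i * A = A * P i" by (rule even_mult_commute) (rule P_even)

lemma T_mult_prod_list:
  assumes "sorted xs" "distinct xs"
  shows "T c * prod_list (map T xs) = (if c \<in> set xs then 0 else
    (-1) ^ card {s\<in>set xs. s < c} *\<^sub>R prod_list (map T (insort c xs)))"
  using assms
proof (induction xs)
  case (Cons x xs)
  hence IH: "T c * prod_list (map T xs) = (if c \<in> set xs then 0 else
    (-1) ^ card {s\<in>set xs. s < c} *\<^sub>R prod_list (map T (insort c xs)))" by simp
  consider "c = x" | "c < x" | "x < c" by linarith
  thus ?case
  proof cases
    case 1
    thus ?thesis by (simp add: T_square mult.assoc[symmetric])
  next
    case 2
    have "{s \<in> set (x # xs). s < c} = {}" using 2 Cons.prems by force
    moreover have "c \<notin> set (x # xs)" using 2 Cons.prems by force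
    ultimately show ?thesis using 2 by (simp del: set_simps only: card.empty) simp
  next
    case 3
    have *: "{s \<in> set (x # xs). s < c} = insert x {s \<in> set xs. s < c}" using 3 by auto
    have **: "card {s \<in> set (x # xs). s < c} = Suc (card {s \<in> set xs. s < c})"
      unfolding * using Cons.prems by simp
    have "T c * prod_list (map T (x # xs)) = - (T x * (T c * prod_list (map T xs)))"
      using T_anticommute[of c x] by (simp add: mult.assoc[symmetric])
    thus ?thesis unfolding IH ** using 3 by auto
  qed
qed simp

lemma P_mult_prod_list: "P i * prod_list (map P xs) = prod_list (map P (insort i xs))"
proof (induction xs)
  case (Cons x xs)
  show ?case using Cons.IH P_commute[of i "P x"]
    by (auto simp: mult.assoc[symmetric]) (simp add: mult.assoc)
qed simp

lemma hom_\<tau>_mult [simp]: "\<Phi> (\<tau> c * A) = T c * \<Phi> A"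
proof (rule linear_eq_on_mono[where f = "\<lambda>A. \<Phi> (\<tau> c * A)"])
  fix S :: "nat set" and K assume S: "finite S"
  have "T c * prod_list (map T (sorted_list_of_set S)) = (if c \<in> S then 0 else
    (-1) ^ card {s\<in>S. s < c} *\<^sub>R prod_list (map T (sorted_list_of_set (insert c S))))"
    using T_mult_prod_list[of "sorted_list_of_set S" c] S
    by (auto simp: sorted_list_of_set.sorted_key_list_of_set_insert)
  thus "\<Phi> (\<tau> c * mono S K) = T c * \<Phi> (mono S K)"
    using S by (simp add: \<tau>_mult_mono hom_mono flip: mult.assoc)
qed (simp_all add: algebra_simps)

lemma hom_p_gen_mult [simp]: "\<Phi> (p_gen i * A) = P i * \<Phi> A"
proof (rule linear_eq_on_mono[where f = "\<lambda>A. \<Phi> (p_gen i * A)"])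
  fix S :: "nat set" and K assume S: "finite S"
  thus "\<Phi> (p_gen i * mono S K) = P i * \<Phi> (mono S K)"
    using P_mult_prod_list[of i "sorted_list_of_multiset K"]
    by (simp add: p_gen_mult_mono hom_mono mult.assoc P_commute)
qed (simp_all add: algebra_simps)

lemma hom_mult: "\<Phi> (A * B) = \<Phi> A * \<Phi> B"
  by (induction A rule: spoly_induct) (auto simp: algebra_simps)

lemma eps_hom: "eps (\<Phi> A) = \<Phi> (eps A)"
  by (induction A rule: spoly_induct) (auto simp: T_odd P_even)

text \<open>
The chain rule. Let \<open>R A D\<close> say that \<open>D\<close> is some derivative of \<open>\<Phi> A\<close>, where \<open>s = \<plusminus>1\<close> is its parity and
\<open>X c\<close>, \<open>Y i\<close> are the derivatives of \<open>T c\<close>, \<open>P i\<close>. It is a relation because it also covers the derivative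
along a curve, which exists only under hypotheses.
\<close>

lemma hom_chain_rel:
  fixes R :: "spoly \<Rightarrow> spoly \<Rightarrow> bool" and r n :: nat and s :: real
  assumes supp: "supp A \<subseteq> {(S, K). S \<subseteq> {..<r} \<and> set_mset K \<subseteq> {..<n}}"
    and one: "R 1 0"
    and scale: "\<And>x A D. R A D \<Longrightarrow> R (x *\<^sub>R A) (x *\<^sub>R D)"
    and add: "\<And>A B D E. R A D \<Longrightarrow> R B E \<Longrightarrow> R (A + B) (D + E)"
    and \<tau>: "\<And>c A D. c < r \<Longrightarrow> R A D \<Longrightarrow> R (\<tau> c * A) (X c * \<Phi> A + s *\<^sub>R (T c * D))"
    and p_gen: "\<And>i A D. i < n \<Longrightarrow> R A D \<Longrightarrow> R (p_gen i * A) (Y i * \<Phi> A + P i * D)"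
    and TX: "\<And>a c. s *\<^sub>R (T c * X a) = - (X a * T c)"
    and TY: "\<And>i c. s *\<^sub>R (T c * Y i) = Y i * T c"
  shows "R A ((\<Sum>a<r. X a * \<Phi> (D\<tau> a A)) + (\<Sum>i<n. Y i * \<Phi> (Dp i A)))"
proof (rule spoly_induct_supp[OF supp])
  let ?D = "\<lambda>A. (\<Sum>a<r. X a * \<Phi> (D\<tau> a A)) + (\<Sum>i<n. Y i * \<Phi> (Dp i A))"
  show "R 1 (?D 1)" using one by simp
  show "R (x *\<^sub>R A) (?D (x *\<^sub>R A))" if "R A (?D A)" for x A
    using scale[OF that, of x] by (simp add: scaleR_add_right scaleR_sum_right)
  show "R (A + B) (?D (A + B))" if "R A (?D A)" "R B (?D B)" for A B
    using add[OF that] by (simp add: distrib_left sum.distrib add_ac)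
  show "R (\<tau> c * A) (?D (\<tau> c * A))" if c: "c \<in> {..<r}" and "R A (?D A)" for c A
  proof -
    have 1: "s *\<^sub>R (T c * (X a * B)) = - (X a * (T c * B))" for a B
      using TX[of c a] by (metis mult.assoc mult_minus_left mult_scaleR_left)
    have 2: "s *\<^sub>R (T c * (Y i * B)) = Y i * (T c * B)" for i B
      using TY[of c i] by (metis mult.assoc mult_scaleR_left)
    have "(\<Sum>a<r. X a * \<Phi> (if a = c then A else 0)) = (\<Sum>a<r. if a = c then X c * \<Phi> A else 0)"
      by (rule sum.cong) auto
    hence "(\<Sum>a<r. X a * \<Phi> (if a = c then A else 0)) = X c * \<Phi> A" using c by simp
    hence "?D (\<tau> c * A) = X c * \<Phi> A + s *\<^sub>R (T c * ?D A)"
      by (simp add: D\<tau>_\<tau>_mult Dp_\<tau>_mult right_diff_distrib sum_subtractf distrib_left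
        scaleR_add_right sum_distrib_left scaleR_sum_right 1 2 sum_negf)
    thus ?thesis using \<tau>[OF _ that(2), of c] c by simp
  qed
  show "R (p_gen j * A) (?D (p_gen j * A))" if j: "j \<in> {..<n}" and "R A (?D A)" for j A
  proof -
    have 1: "P j * (B * C) = B * (P j * C)" for B C
      using P_commute[of j B] by (metis mult.assoc)
    have "(\<Sum>i<n. Y i * \<Phi> (if i = j then A else 0)) = (\<Sum>i<n. if i = j then Y j * \<Phi> A else 0)"
      by (rule sum.cong) auto
    hence "(\<Sum>i<n. Y i * \<Phi> (if i = j then A else 0)) = Y j * \<Phi> A" using j by simp
    hence "?D (p_gen j * A) = Y j * \<Phi> A + P j * ?D A"
      by (simp add: D\<tau>_p_gen_mult Dp_p_gen_mult sum.distrib distrib_left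
         sum_distrib_left 1)
    thus ?thesis using p_gen[OF _ that(2), of j] j by simp
  qed
qed

end

section \<open>Degrees\<close>

text \<open>
\<open>A\<close> has degree \<open>d\<close>, and involves only \<open>\<tau>\<^sup>a\<close> with \<open>a < r\<close> and \<open>p\<^sub>i\<close> with \<open>i < n\<close>.
\<close>

definition homog :: "nat \<Rightarrow> nat \<Rightarrow> nat \<Rightarrow> spoly \<Rightarrow> bool" where
  "homog r n d A \<longleftrightarrow> (\<forall>S K. coef A S K \<noteq> 0 \<longrightarrow>
     S \<subseteq> {..<r} \<and> set_mset K \<subseteq> {..<n} \<and> card S + 2 * size K = d)"

lemma homogD: "homog r n d A \<Longrightarrow> coef A S K \<noteq> 0 \<Longrightarrow>
     S \<subseteq> {..<r} \<and> set_mset K \<subseteq> {..<n} \<and> card S + 2 * size K = d"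
  unfolding homog_def by blast

lemma homog_zero [simp]: "homog r n d 0" by (simp add: homog_def)

lemma homog_supp:
  "homog r n d A \<longleftrightarrow> supp A \<subseteq> {(S, K). S \<subseteq> {..<r} \<and> set_mset K \<subseteq> {..<n} \<and> card S + 2 * size K = d}"
  unfolding homog_def supp_def by (simp add: Collect_mono_iff split_def)

lemma homog_add:
  assumes "homog r n d A" "homog r n d B" shows "homog r n d (A + B)"
proof -
  have "supp (A + B) \<subseteq> supp A \<union> supp B" by (auto simp: supp_def)
  also have "\<dots> \<subseteq> {(S, K). S \<subseteq> {..<r} \<and> set_mset K \<subseteq> {..<n} \<and> card S + 2 * size K = d}"
    using assms by (simp only: homog_supp Un_least)
  finally show ?thesis unfolding homog_supp .
qed

lemma homog_scaleR:
  assumes "homog r n d A" shows "homog r n d (x *\<^sub>R A)"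
proof -
  have "supp (x *\<^sub>R A) \<subseteq> supp A" by (auto simp: supp_def)
  also note assms[unfolded homog_supp]
  finally show ?thesis unfolding homog_supp .
qed

lemma homog_sum: "(\<And>x. x \<in> X \<Longrightarrow> homog r n d (f x)) \<Longrightarrow> homog r n d (sum f X)"
  by (induction X rule: infinite_finite_induct) (auto intro: homog_add)

lemma homog_mult:
  assumes "homog r n d A" "homog r n e B"
  shows "homog r n (d + e) (A * B)"
  unfolding homog_def
proof (intro allI impI)
  fix S K assume "coef (A * B) S K \<noteq> 0"
  then obtain S1 K1 where *: "finite S" "S1 \<subseteq> S" "K1 \<subseteq># K" "coef A S1 K1 \<noteq> 0" "coef B (S - S1) (K - K1) \<noteq> 0"
    unfolding coef_mult by (rule super_mult_nonzeroE)
  have A: "S1 \<subseteq> {..<r}" "set_mset K1 \<subseteq> {..<n}" "card S1 + 2 * size K1 = d"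
    and B: "S - S1 \<subseteq> {..<r}" "set_mset (K - K1) \<subseteq> {..<n}" "card (S - S1) + 2 * size (K - K1) = e"
    using homogD[OF assms(1) *(4)] homogD[OF assms(2) *(5)] by blast+
  have "card S = card S1 + card (S - S1)"
    using * by (metis card_Un_disjoint Diff_disjoint Un_Diff_cancel finite_Diff finite_subset sup.absorb_iff2)
  moreover have "size K = size K1 + size (K - K1)"
    using * by (metis size_union subset_mset.add_diff_inverse)
  moreover have "set_mset K = set_mset K1 \<union> set_mset (K - K1)"
    using * by (metis set_mset_union subset_mset.add_diff_inverse)
  ultimately show "S \<subseteq> {..<r} \<and> set_mset K \<subseteq> {..<n} \<and> card S + 2 * size K = d + e"
    using A B by auto
qed

lemma homog_D\<tau>:
  assumes "homog r n (Suc d) A" shows "homog r n d (D\<tau> c A)"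
  unfolding homog_def
proof (intro allI impI)
  fix S K assume "coef (D\<tau> c A) S K \<noteq> 0"
  hence *: "c \<notin> S" "coef A (insert c S) K \<noteq> 0" by (auto simp: D\<tau>.rep_eq dtau_left_def split: if_splits)
  hence "finite S" using coef_infinite[of "insert c S" A K] by auto
  with * homogD[OF assms *(2)]
  show "S \<subseteq> {..<r} \<and> set_mset K \<subseteq> {..<n} \<and> card S + 2 * size K = d" by simp
qed

lemma homog_Dp:
  assumes "homog r n (d + 2) A" shows "homog r n d (Dp c A)"
  unfolding homog_def
proof (intro allI impI)
  fix S K assume "coef (Dp c A) S K \<noteq> 0"
  hence *: "coef A S (add_mset c K) \<noteq> 0" by (auto simp: Dp.rep_eq dp_def)
  from homogD[OF assms *]
  show "S \<subseteq> {..<r} \<and> set_mset K \<subseteq> {..<n} \<and> card S + 2 * size K = d" by auto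
qed

lemma homog_eps:
  assumes "homog r n d A" shows "eps A = (-1) ^ d *\<^sub>R A"
proof (rule coef_inject_ext)
  fix S K
  show "coef (eps A) S K = coef ((-1) ^ d *\<^sub>R A) S K"
  proof (cases "coef A S K = 0")
    case False
    hence "d = card S + 2 * size K" using homogD[OF assms] by simp
    thus ?thesis by (simp add: power_add)
  qed simp
qed

section \<open>The Jacobi identity\<close>

lemma sum4_swap:
  "(\<Sum>I\<in>X. \<Sum>J\<in>X. \<Sum>K\<in>X. \<Sum>L\<in>X. f I J K L) = (\<Sum>I\<in>X. \<Sum>J\<in>X. \<Sum>K\<in>X. \<Sum>L\<in>X. f K L I J)"
proof -
  have "(\<Sum>I\<in>X. \<Sum>J\<in>X. \<Sum>K\<in>X. \<Sum>L\<in>X. f I J K L) = (\<Sum>(I,J)\<in>X\<times>X. \<Sum>(K,L)\<in>X\<times>X. f I J K L)"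
    by (simp flip: sum.cartesian_product)
  also have "\<dots> = (\<Sum>(K,L)\<in>X\<times>X. \<Sum>(I,J)\<in>X\<times>X. f I J K L)"
    by (simp only: split_def) (rule sum.swap)
  also have "\<dots> = (\<Sum>K\<in>X. \<Sum>L\<in>X. \<Sum>I\<in>X. \<Sum>J\<in>X. f I J K L)"
    by (simp flip: sum.cartesian_product)
  finally show ?thesis .
qed

text \<open>
  The Jacobi identity \<open>{A, {B, C}} = {{A, B}, C} - {B, {A, C}}\<close> at a point, for odd \<open>A\<close>, \<open>B\<close> and even \<open>C\<close>.
  Here \<open>a I\<close>, \<open>b I\<close>, \<open>c I\<close> stand for the left derivatives of \<open>A\<close>, \<open>B\<close>, \<open>C\<close> with respect to the
  coordinate \<open>I\<close>, and \<open>a2 I J\<close> etc. for the second derivatives. The sign \<open>s I\<close> is 1 for even and -1 for odd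
  coordinates, and \<open>\<omega>\<close> is the matrix of brackets of coordinates.
\<close>

lemma jacobi_pointwise:
  fixes a b c :: "'i \<Rightarrow> spoly" and a2 b2 c2 :: "'i \<Rightarrow> 'i \<Rightarrow> spoly" and s :: "'i \<Rightarrow> real"
  defines "sg \<equiv> \<lambda>I J. if s I = -1 \<and> s J = -1 then -1 else (1::real)"
    and "e \<equiv> \<lambda>I A. if s I = -1 then eps A else A"
  assumes s: "\<And>I. s I = 1 \<or> s I = -1"
    and \<omega>_par: "\<And>I J. \<omega> I J \<noteq> 0 \<Longrightarrow> s I = s J"
    and \<omega>_sym: "\<And>I J. \<omega> J I = - s I * \<omega> I J"
    and a: "\<And>I. eps (a I) = - s I *\<^sub>R a I" and b: "\<And>I. eps (b I) = - s I *\<^sub>R b I"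
    and c: "\<And>I. eps (c I) = s I *\<^sub>R c I"
    and a2: "\<And>I J. a2 I J = sg I J *\<^sub>R a2 J I" and b2: "\<And>I J. b2 I J = sg I J *\<^sub>R b2 J I"
    and c2: "\<And>I J. c2 I J = sg I J *\<^sub>R c2 J I"
    and a2e: "\<And>I J. eps (a2 I J) = (- s I * s J) *\<^sub>R a2 I J"
  shows "(\<Sum>I\<in>X. \<Sum>J\<in>X. \<omega> I J *\<^sub>R (a I * (\<Sum>K\<in>X. \<Sum>L\<in>X. \<omega> K L *\<^sub>R (b2 J K * c L + e J (b K) * c2 J L)))) =
    (\<Sum>K\<in>X. \<Sum>L\<in>X. (\<omega> K L * s K) *\<^sub>R ((\<Sum>I\<in>X. \<Sum>J\<in>X. \<omega> I J *\<^sub>R (a2 K I * b J + e K (a I) * b2 K J)) * c L))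
    - (\<Sum>I\<in>X. \<Sum>J\<in>X. \<omega> I J *\<^sub>R (b I * (\<Sum>K\<in>X. \<Sum>L\<in>X. \<omega> K L *\<^sub>R (a2 J K * c L + e J (a K) * c2 J L))))"
proof -
  define q where "q f = (\<Sum>I\<in>X. \<Sum>J\<in>X. \<Sum>K\<in>X. \<Sum>L\<in>X. (\<omega> I J * \<omega> K L) *\<^sub>R (f I J K L :: spoly))" for f
  have q_cong: "q f = q g" if "\<And>I J K L. \<omega> I J \<noteq> 0 \<Longrightarrow> \<omega> K L \<noteq> 0 \<Longrightarrow> f I J K L = g I J K L" for f g
    unfolding q_def
  proof (intro sum.cong refl)
    fix I J K L show "(\<omega> I J * \<omega> K L) *\<^sub>R f I J K L = (\<omega> I J * \<omega> K L) *\<^sub>R g I J K L"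
      using that[of I J K L] by (cases "\<omega> I J = 0 \<or> \<omega> K L = 0") auto
  qed
  have q_add: "q (\<lambda>I J K L. f I J K L + g I J K L) = q f + q g" for f g
    by (simp add: q_def scaleR_add_right sum.distrib)
  have q_minus: "q (\<lambda>I J K L. - f I J K L) = - q f" for f
    by (simp add: q_def sum_negf)
  have q_swap: "q f = q (\<lambda>I J K L. f K L I J)" for f
    unfolding q_def by (subst sum4_swap) (simp add: mult.commute)
  have q_swap1: "q f = q (\<lambda>I J K L. - s I *\<^sub>R f J I K L)" for f
    unfolding q_def by (subst sum.swap, subst \<omega>_sym) (simp add: mult_ac)
  have L: "(\<Sum>I\<in>X. \<Sum>J\<in>X. \<omega> I J *\<^sub>R (a I * (\<Sum>K\<in>X. \<Sum>L\<in>X. \<omega> K L *\<^sub>R (b2 J K * c L + e J (b K) * c2 J L)))) =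
     q (\<lambda>I J K L. a I * b2 J K * c L) + q (\<lambda>I J K L. a I * e J (b K) * c2 J L)"
    unfolding q_add[symmetric] unfolding q_def
    by (simp add: sum_distrib_left scaleR_sum_right distrib_left mult.assoc)
  have R2: "(\<Sum>I\<in>X. \<Sum>J\<in>X. \<omega> I J *\<^sub>R (b I * (\<Sum>K\<in>X. \<Sum>L\<in>X. \<omega> K L *\<^sub>R (a2 J K * c L + e J (a K) * c2 J L)))) =
     q (\<lambda>I J K L. b I * a2 J K * c L) + q (\<lambda>I J K L. b I * e J (a K) * c2 J L)"
    unfolding q_add[symmetric] unfolding q_def
    by (simp add: sum_distrib_left scaleR_sum_right distrib_left mult.assoc)
  have R1: "(\<Sum>K\<in>X. \<Sum>L\<in>X. (\<omega> K L * s K) *\<^sub>R ((\<Sum>I\<in>X. \<Sum>J\<in>X. \<omega> I J *\<^sub>R (a2 K I * b J + e K (a I) * b2 K J)) * c L)) =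
     q (\<lambda>I J K L. s K *\<^sub>R (a2 K I * b J * c L)) + q (\<lambda>I J K L. s K *\<^sub>R (e K (a I) * b2 K J * c L))"
    unfolding q_add[symmetric] by (subst q_swap, unfold q_def)
     (simp add: sum_distrib_right scaleR_sum_right distrib_right scaleR_add_right mult_ac)
  \<comment> \<open>the second derivatives of \<open>B\<close> agree term by term\<close>
  have 1: "q (\<lambda>I J K L. a I * b2 J K * c L) = q (\<lambda>I J K L. s K *\<^sub>R (e K (a I) * b2 K J * c L))"
  proof (rule q_cong)
    fix I J K L assume "\<omega> I J \<noteq> 0" "\<omega> K L \<noteq> 0"
    hence "s I = s J" using \<omega>_par by blast
    thus "a I * b2 J K * c L = s K *\<^sub>R (e K (a I) * b2 K J * c L)"
      using s[of J] s[of K] by (subst b2) (auto simp: e_def sg_def a)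
  qed
  \<comment> \<open>those of \<open>A\<close> agree after exchanging \<open>I\<close> and \<open>J\<close>\<close>
  have 2: "q (\<lambda>I J K L. s K *\<^sub>R (a2 K I * b J * c L)) = q (\<lambda>I J K L. b I * a2 J K * c L)"
    unfolding q_swap1[of "\<lambda>I J K L. b I * a2 J K * c L"]
  proof (rule q_cong)
    fix I J K L assume "\<omega> I J \<noteq> 0" "\<omega> K L \<noteq> 0"
    hence eq: "s I = s J" using \<omega>_par by blast
    have "b J * a2 I K = - (s I * s K) *\<^sub>R (a2 K I * b J)"
    proof (cases "s J = 1")
      case True
      hence "eps (b J) = - b J" by (simp add: b)
      from odd_mult_commute[OF this, of "a2 I K"]
      have "b J * a2 I K = (- s I * s K) *\<^sub>R (a2 I K * b J)" by (simp add: a2e)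
      moreover have "a2 I K = a2 K I" using a2[of I K] True eq by (simp add: sg_def)
      ultimately show ?thesis by simp
    next
      case False
      hence J: "s J = -1" using s by blast
      hence "eps (b J) = b J" by (simp add: b)
      from even_mult_commute[OF this, of "a2 I K"] have *: "b J * a2 I K = a2 I K * b J" .
      have "a2 I K = - (s I * s K) *\<^sub>R a2 K I" using a2[of I K] J eq s[of K] by (auto simp: sg_def)
      thus ?thesis unfolding * by (metis mult_scaleR_left)
    qed
    thus "s K *\<^sub>R (a2 K I * b J * c L) = - s I *\<^sub>R (b J * a2 I K * c L)"
      using s[of I] s[of K] by auto
  qed
  \<comment> \<open>those of \<open>C\<close> cancel after exchanging \<open>(I, J)\<close> and \<open>(K, L)\<close>\<close>
  have 3: "q (\<lambda>I J K L. a I * e J (b K) * c2 J L) + q (\<lambda>I J K L. b I * e J (a K) * c2 J L) = 0"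
  proof -
    have "q (\<lambda>I J K L. b I * e J (a K) * c2 J L) = q (\<lambda>I J K L. b K * e L (a I) * c2 L J)"
      by (rule q_swap)
    also have "\<dots> = q (\<lambda>I J K L. - (a I * e J (b K) * c2 J L))"
    proof (rule q_cong)
      fix I J K L assume "\<omega> I J \<noteq> 0" "\<omega> K L \<noteq> 0"
      hence eq: "s I = s J" "s K = s L" using \<omega>_par by blast+
      have *: "e L (a I) = (if s L = -1 then - s J else 1) *\<^sub>R a I"
        "e J (b K) = (if s J = -1 then - s L else 1) *\<^sub>R b K" using eq by (auto simp: e_def a b)
      have "b K * a I = (if s L = 1 \<and> s J = 1 then -1 else 1) *\<^sub>R (a I * b K)"
      proof (cases "s K = 1")
        case True
        hence "eps (b K) = - b K" by (simp add: b)
        from odd_mult_commute[OF this, of "a I"] True eq s[of J] show ?thesis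
          by (auto simp: a)
      next
        case False
        hence J: "s K = -1" using s by blast
        hence "eps (b K) = b K" by (simp add: b)
        from even_mult_commute[OF this, of "a I"] J eq s[of K] show ?thesis by auto
      qed
      thus "b K * e L (a I) * c2 L J = - (a I * e J (b K) * c2 J L)"
        unfolding * by (subst c2) (use s[of J] s[of L] in \<open>auto simp: sg_def\<close>)
    qed
    finally show ?thesis by (simp add: q_minus)
  qed
  have alg: "p1 + p2 = (r1 + r2) - (r3 + r4)" if "p1 = r2" "r1 = r3" "p2 + r4 = 0"
    for p1 p2 r1 r2 r3 r4 :: spoly
    using that by (simp add: eq_neg_iff_add_eq_0[symmetric])
  show ?thesis unfolding L R1 R2 by (rule alg[OF 1 2 3])
qed

section \<open>Calculus on open subsets of Euclidean space\<close>

text \<open>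
Openness in \<open>\<real>\<^sup>n\<close>, the sequences that vanish from index \<open>n\<close> on.
\<close>

abbreviation eopen :: "nat \<Rightarrow> (nat \<Rightarrow> real) set \<Rightarrow> bool" where
  "eopen n W \<equiv> openin (Euclidean_space n) W"

lemma eopen_iff: "eopen n W \<longleftrightarrow> (\<exists>T. open T \<and> W = T \<inter> {x. \<forall>i\<ge>n. x i = 0})"
  by (simp add: Euclidean_space_def openin_subtopology euclidean_product_topology)

lemma eopen_zero: "eopen n W \<Longrightarrow> x \<in> W \<Longrightarrow> i \<ge> n \<Longrightarrow> x i = 0"
  by (auto simp: eopen_iff)

lemma eopen_box:
  assumes "eopen n W" "x \<in> W"
  obtains d where "d > 0" "\<And>y. (\<And>i. i \<ge> n \<Longrightarrow> y i = 0) \<Longrightarrow> (\<And>i. i < n \<Longrightarrow> \<bar>y i - x i\<bar> < d) \<Longrightarrow> y \<in> W"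
proof -
  obtain T where T: "open T" "W = T \<inter> {x. \<forall>i\<ge>n. x i = 0}" using assms(1) unfolding eopen_iff by blast
  hence "openin (product_topology (\<lambda>i. euclidean) UNIV) T" "x \<in> T"
    using assms by (auto simp: euclidean_product_topology)
  from product_topology_open_contains_basis[OF this]
  obtain X where X: "x \<in> Pi\<^sub>E UNIV X" "\<And>i. open (X i)" "Pi\<^sub>E UNIV X \<subseteq> T"
    by auto
  have "\<exists>d. \<forall>i. d i > 0 \<and> (\<forall>s. \<bar>s - x i\<bar> < d i \<longrightarrow> s \<in> X i)"
  proof (rule choice, rule allI)
    fix i
    have "x i \<in> X i" using X(1) by auto
    then obtain e where "e > 0" "\<forall>s. dist s (x i) < e \<longrightarrow> s \<in> X i"
      using X(2)[of i] open_dist by blast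
    thus "\<exists>d. d > 0 \<and> (\<forall>s. \<bar>s - x i\<bar> < d \<longrightarrow> s \<in> X i)" by (auto simp: dist_real_def)
  qed
  then obtain d where d: "\<And>i. d i > 0" "\<And>i s. \<bar>s - x i\<bar> < d i \<Longrightarrow> s \<in> X i" by blast
  \<comment> \<open>the 1 keeps the set nonempty if \<open>n = 0\<close>\<close>
  define d0 where "d0 = Min (insert 1 (d ` {..<n}))"
  show thesis
  proof
    show "d0 > 0" unfolding d0_def using d(1) by (subst Min_gr_iff) auto
    fix y assume y: "\<And>i. i \<ge> n \<Longrightarrow> y i = 0" "\<And>i. i < n \<Longrightarrow> \<bar>y i - x i\<bar> < d0"
    have "y i \<in> X i" for i
    proof (cases "i < n")
      case True
      hence "d0 \<le> d i" unfolding d0_def by (intro Min_le) auto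
      thus ?thesis using y(2)[OF True] d(2) by force
    next
      case False
      hence "x i = 0" "y i = 0" using y(1)[of i] eopen_zero[OF assms] by auto
      thus ?thesis using d(2)[of "y i" i] d(1)[of i] by simp
    qed
    thus "y \<in> W" using X(3) T y(1) by auto
  qed
qed

lemma eopen_preimage:
  assumes "eopen n W" "continuous_on W f" "open B"
  shows "eopen n (W \<inter> f -` B)"
proof -
  obtain T where T: "open T" "W = T \<inter> {x. \<forall>i\<ge>n. x i = 0}" using assms(1) unfolding eopen_iff by blast
  have "openin (top_of_set W) (W \<inter> f -` B)"
    using assms(2,3) by (rule continuous_openin_preimage_gen)
  then obtain T' where "open T'" "W \<inter> f -` B = W \<inter> T'" by (auto simp: openin_open)
  thus ?thesis unfolding eopen_iff using T by (intro exI[of _ "T \<inter> T'"]) auto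
qed

lemma continuous_box:
  fixes f :: "(nat \<Rightarrow> real) \<Rightarrow> real"
  assumes "eopen n W" "x \<in> W" "continuous_on W f" "e > 0"
  obtains d where "d > 0" "\<And>y. (\<And>i. i \<ge> n \<Longrightarrow> y i = 0) \<Longrightarrow> (\<And>i. i < n \<Longrightarrow> \<bar>y i - x i\<bar> < d) \<Longrightarrow>
    y \<in> W \<and> \<bar>f y - f x\<bar> < e"
proof -
  have "eopen n (W \<inter> f -` ball (f x) e)" by (rule eopen_preimage[OF assms(1,3)]) simp
  from eopen_box[OF this, of x] obtain d where "d > 0"
    "\<And>y. (\<And>i. i \<ge> n \<Longrightarrow> y i = 0) \<Longrightarrow> (\<And>i. i < n \<Longrightarrow> \<bar>y i - x i\<bar> < d) \<Longrightarrow> y \<in> W \<inter> f -` ball (f x) e"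
    using assms by auto
  thus thesis by (intro that[of d]) (auto simp: dist_real_def abs_minus_commute)
qed

lemma eopen_line:
  assumes "eopen n W" "x \<in> W" "i < n"
  shows "\<forall>\<^sub>F t in nhds (x i). x(i := t) \<in> W"
proof -
  obtain d where d: "d > 0" "\<And>y. (\<And>i. i \<ge> n \<Longrightarrow> y i = 0) \<Longrightarrow> (\<And>i. i < n \<Longrightarrow> \<bar>y i - x i\<bar> < d) \<Longrightarrow> y \<in> W"
    using eopen_box[OF assms(1,2)] by metis
  have "x(i := t) \<in> W" if "dist t (x i) < d" for t
    using that eopen_zero[OF assms(1,2)] assms(3) d(1) by (intro d(2)) (auto simp: dist_real_def)
  thus ?thesis using d(1) eventually_nhds_metric by blast
qed

lemma partial_deriv_cong:
  assumes "eopen n W" "x \<in> W" "i < n" "\<And>y. y \<in> W \<Longrightarrow> f y = g y"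
  shows "partial_deriv i f x = partial_deriv i g x"
  unfolding partial_deriv_def
  by (rule deriv_cong_ev[OF eventually_mono[OF eopen_line[OF assms(1-3)]]]) (simp_all add: assms(4))

lemma Ck_on_continuous: "Ck_on n k W f \<Longrightarrow> continuous_on W f"
  by (cases k) auto

lemma Ck_on_subset: "Ck_on n k W f \<Longrightarrow> V \<subseteq> W \<Longrightarrow> Ck_on n k V f"
proof (induction k arbitrary: f)
  case (Suc k)
  thus ?case using continuous_on_subset[of W f V] by auto
qed (auto intro: continuous_on_subset)

lemma Ck_on_cong:
  assumes "eopen n W" "\<And>y. y \<in> W \<Longrightarrow> f y = g y" "Ck_on n k W f"
  shows "Ck_on n k W g"
  using assms(2,3)
proof (induction k arbitrary: f g)
  case 0
  thus ?case using continuous_on_cong[OF refl, of W f g] by simp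
next
  case (Suc k)
  have "(\<lambda>t. g (x(i := t))) differentiable (at (x i))" if "x \<in> W" "i < n" for x i
  proof -
    have *: "(\<lambda>t. f (x(i := t))) differentiable (at (x i))" using Suc.prems that by simp
    have ev: "\<forall>\<^sub>F t in nhds (x i). f (x(i := t)) = g (x(i := t))"
      by (rule eventually_mono[OF eopen_line[OF assms(1) that]]) (rule Suc.prems(1))
    have "(\<lambda>t. f (x(i := t))) field_differentiable (at (x i)) \<longleftrightarrow> (\<lambda>t. g (x(i := t))) field_differentiable (at (x i))"
      unfolding field_differentiable_def
      using DERIV_cong_ev[OF refl ev refl] by simp
    thus ?thesis using * by (simp add: real_differentiable_def field_differentiable_def)
  qed
  moreover have "Ck_on n k W (partial_deriv i g)" if "i < n" for i
    by (rule Suc.IH[of "partial_deriv i f"])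
       (use Suc.prems that partial_deriv_cong[OF assms(1) _ that, of _ f g] in auto)
  moreover have "continuous_on W g"
    using Suc.prems continuous_on_cong[OF refl, of W f g] by simp
  ultimately show ?case by simp
qed

lemma Ck_on_Suc_D: "Ck_on n (Suc k) W f \<Longrightarrow> Ck_on n k W f"
  by (induction k arbitrary: f) auto

lemma Ck_on_partial: "Ck_on n (Suc k) W f \<Longrightarrow> i < n \<Longrightarrow> Ck_on n k W (partial_deriv i f)"
  by simp

lemma has_partial_deriv:
  assumes "Ck_on n (Suc k) W f" "x \<in> W" "i < n"
  shows "((\<lambda>t. f (x(i := t))) has_real_derivative partial_deriv i f x) (at (x i))"
  using assms unfolding partial_deriv_def
  by (simp add: DERIV_deriv_iff_real_differentiable)

lemma partial_deriv_eqI: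
  "((\<lambda>t. f (x(i := t))) has_real_derivative D) (at (x i)) \<Longrightarrow> partial_deriv i f x = D"
  unfolding partial_deriv_def by (rule DERIV_imp_deriv)

lemma partial_deriv_add:
  assumes "Ck_on n (Suc k) W f" "Ck_on n (Suc l) W g" "x \<in> W" "i < n"
  shows "partial_deriv i (\<lambda>x. f x + g x) x = partial_deriv i f x + partial_deriv i g x"
  by (rule partial_deriv_eqI) (rule DERIV_add; rule has_partial_deriv; use assms in auto)

lemma partial_deriv_mult:
  assumes "Ck_on n (Suc k) W f" "Ck_on n (Suc l) W g" "x \<in> W" "i < n"
  shows "partial_deriv i (\<lambda>x. f x * g x) x = partial_deriv i f x * g x + f x * partial_deriv i g x"
  using DERIV_mult[OF has_partial_deriv[OF assms(1,3,4)] has_partial_deriv[OF assms(2,3,4)]]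
  by (intro partial_deriv_eqI) (simp add: mult.commute)

lemma Ck_on_const: "Ck_on n k W (\<lambda>x. c)"
proof (induction k arbitrary: c)
  case (Suc k)
  have "partial_deriv i (\<lambda>x. c) = (\<lambda>x. 0)" for i by (auto simp: partial_deriv_def)
  thus ?case using Suc by simp
qed simp

lemma Ck_on_add:
  assumes "eopen n W" "Ck_on n k W f" "Ck_on n k W g"
  shows "Ck_on n k W (\<lambda>x. f x + g x)"
  using assms(2,3)
proof (induction k arbitrary: f g)
  case (Suc k)
  have "Ck_on n k W (partial_deriv i (\<lambda>x. f x + g x))" if "i < n" for i
    by (rule Ck_on_cong[OF assms(1) _ Suc.IH[of "partial_deriv i f" "partial_deriv i g"]])
       (use Suc.prems that partial_deriv_add[OF Suc.prems _ that] in auto)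
  thus ?case using Suc.prems by (auto intro!: continuous_on_add differentiable_add)
qed (auto intro: continuous_on_add)

lemma Ck_on_mult:
  assumes "eopen n W" "Ck_on n k W f" "Ck_on n k W g"
  shows "Ck_on n k W (\<lambda>x. f x * g x)"
  using assms(2,3)
proof (induction k arbitrary: f g)
  case (Suc k)
  have "Ck_on n k W (partial_deriv i (\<lambda>x. f x * g x))" if "i < n" for i
  proof (rule Ck_on_cong[OF assms(1), where f = "\<lambda>x. partial_deriv i f x * g x + f x * partial_deriv i g x"])
    show "Ck_on n k W (\<lambda>x. partial_deriv i f x * g x + f x * partial_deriv i g x)"
      by (intro Ck_on_add[OF assms(1)] Suc.IH Ck_on_partial[OF Suc.prems(1) that]
          Ck_on_partial[OF Suc.prems(2) that] Ck_on_Suc_D[OF Suc.prems(1)] Ck_on_Suc_D[OF Suc.prems(2)])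
  qed (use partial_deriv_mult[OF Suc.prems _ that] in auto)
  thus ?case using Suc.prems by (auto intro!: continuous_on_mult differentiable_mult)
qed (auto intro: continuous_on_mult)

lemma smooth_on_Ck: "smooth_on n W f \<Longrightarrow> Ck_on n k W f" by (simp add: smooth_on_def)

lemma smooth_on_continuous: "smooth_on n W f \<Longrightarrow> continuous_on W f"
  using Ck_on_continuous smooth_on_Ck by blast

lemma smooth_on_subset: "smooth_on n W f \<Longrightarrow> V \<subseteq> W \<Longrightarrow> smooth_on n V f"
  unfolding smooth_on_def using Ck_on_subset by blast

lemma smooth_on_cong:
  "eopen n W \<Longrightarrow> (\<And>y. y \<in> W \<Longrightarrow> f y = g y) \<Longrightarrow> smooth_on n W f \<Longrightarrow> smooth_on n W g"
  unfolding smooth_on_def using Ck_on_cong[of n W f g] by blast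

lemma smooth_on_const: "smooth_on n W (\<lambda>x. c)" by (simp add: smooth_on_def Ck_on_const)

lemma smooth_on_add: "eopen n W \<Longrightarrow> smooth_on n W f \<Longrightarrow> smooth_on n W g \<Longrightarrow> smooth_on n W (\<lambda>x. f x + g x)"
  by (simp add: smooth_on_def Ck_on_add)

lemma smooth_on_mult: "eopen n W \<Longrightarrow> smooth_on n W f \<Longrightarrow> smooth_on n W g \<Longrightarrow> smooth_on n W (\<lambda>x. f x * g x)"
  by (simp add: smooth_on_def Ck_on_mult)

lemma smooth_on_partial: "smooth_on n W f \<Longrightarrow> i < n \<Longrightarrow> smooth_on n W (partial_deriv i f)"
  unfolding smooth_on_def using Ck_on_partial by blast

lemma smooth_on_has_partial:
  "smooth_on n W f \<Longrightarrow> x \<in> W \<Longrightarrow> i < n \<Longrightarrow>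
     ((\<lambda>t. f (x(i := t))) has_real_derivative partial_deriv i f x) (at (x i))"
  using has_partial_deriv[of n 0] smooth_on_Ck by blast

lemma MVT_between:
  fixes g :: "real \<Rightarrow> real"
  assumes "\<And>s. \<bar>s - a\<bar> \<le> \<bar>b - a\<bar> \<Longrightarrow> (g has_real_derivative g' s) (at s)"
  obtains z where "\<bar>z - a\<bar> \<le> \<bar>b - a\<bar>" "g b - g a = (b - a) * g' z"
proof -
  consider "a < b" | "b < a" | "a = b" by linarith
  thus thesis
  proof cases
    case 1
    obtain z where "a < z" "z < b" "g b - g a = (b - a) * g' z"
      using MVT2[OF 1, of g g'] assms 1 by auto
    thus thesis using 1 by (intro that[of z]) auto
  next
    case 2
    obtain z where "b < z" "z < a" "g a - g b = (a - b) * g' z"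
      using MVT2[OF 2, of g g'] assms 2 by auto
    thus thesis using 2 by (intro that[of z]) (auto simp: algebra_simps)
  qed (use that[of a] in auto)
qed

text \<open>
The mean value theorem applied twice. The left-hand side is symmetric in \<open>i\<close> and \<open>j\<close>, which yields the symmetry of mixed derivatives.
\<close>

lemma second_difference:
  assumes "Ck_on n (Suc (Suc 0)) W f" "i < n" "j < n" "i \<noteq> j" "h > 0"
    and box: "\<And>s t. \<bar>s - x i\<bar> \<le> h \<Longrightarrow> \<bar>t - x j\<bar> \<le> h \<Longrightarrow> x(i := s, j := t) \<in> W"
  obtains s t where "\<bar>s - x i\<bar> \<le> h" "\<bar>t - x j\<bar> \<le> h"
    "f (x(i := x i + h, j := x j + h)) - f (x(i := x i + h)) - f (x(j := x j + h)) + f x =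
     h * h * partial_deriv j (partial_deriv i f) (x(i := s, j := t))"
proof -
  have C1: "Ck_on n (Suc 0) W (partial_deriv i f)" using assms(1,2) Ck_on_partial by blast
  define g where "g s = f (x(i := s, j := x j + h)) - f (x(i := s, j := x j))" for s
  have "(g has_real_derivative
      partial_deriv i f (x(i := s, j := x j + h)) - partial_deriv i f (x(i := s, j := x j))) (at s)"
    if "\<bar>s - x i\<bar> \<le> \<bar>x i + h - x i\<bar>" for s
  proof -
    have *: "((\<lambda>s. f (x(i := s, j := t))) has_real_derivative partial_deriv i f (x(i := s, j := t))) (at s)"
      if "\<bar>t - x j\<bar> \<le> h" for t
      using has_partial_deriv[OF assms(1) box[of s t] assms(2)] that \<open>\<bar>s - x i\<bar> \<le> \<bar>x i + h - x i\<bar>\<close> assms(4,5)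
      by (simp add: fun_upd_twist[of i j])
    show ?thesis unfolding g_def by (intro DERIV_diff *) (use assms(5) in auto)
  qed
  then obtain s where s0: "\<bar>s - x i\<bar> \<le> \<bar>x i + h - x i\<bar>"
    "g (x i + h) - g (x i) = (x i + h - x i) * (partial_deriv i f (x(i := s, j := x j + h)) - partial_deriv i f (x(i := s, j := x j)))"
    by (rule MVT_between)
  have s: "\<bar>s - x i\<bar> \<le> h" using s0(1) assms(5) by simp
  have "((\<lambda>t. partial_deriv i f (x(i := s, j := t))) has_real_derivative
     partial_deriv j (partial_deriv i f) (x(i := s, j := t))) (at t)" if "\<bar>t - x j\<bar> \<le> \<bar>x j + h - x j\<bar>" for t
    using has_partial_deriv[OF C1 box[of s t] assms(3)] that s assms(5) by simp
  then obtain t where t0: "\<bar>t - x j\<bar> \<le> \<bar>x j + h - x j\<bar>"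
    "partial_deriv i f (x(i := s, j := x j + h)) - partial_deriv i f (x(i := s, j := x j)) =
     (x j + h - x j) * partial_deriv j (partial_deriv i f) (x(i := s, j := t))"
    by (rule MVT_between)
  have t: "\<bar>t - x j\<bar> \<le> h" using t0(1) assms(5) by simp
  have "f (x(i := x i + h, j := x j + h)) - f (x(i := x i + h)) - f (x(j := x j + h)) + f x = g (x i + h) - g (x i)"
    using assms(4) by (simp add: g_def fun_upd_idem)
  also have "\<dots> = h * h * partial_deriv j (partial_deriv i f) (x(i := s, j := t))"
    unfolding s0(2) t0(2) by simp
  finally show thesis by (rule that[OF s t])
qed

lemma partial_deriv_commute:
  assumes "eopen n W" "smooth_on n W f" "x \<in> W" "i < n" "j < n"
  shows "partial_deriv i (partial_deriv j f) x = partial_deriv j (partial_deriv i f) x"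
proof (cases "i = j")
  case False
  let ?a = "partial_deriv i (partial_deriv j f)" and ?b = "partial_deriv j (partial_deriv i f)"
  have C: "Ck_on n (Suc (Suc 0)) W f" using assms smooth_on_Ck by blast
  have cont: "continuous_on W ?a" "continuous_on W ?b"
    using assms by (auto intro!: smooth_on_continuous smooth_on_partial)
  have "\<bar>?a x - ?b x\<bar> \<le> e + e" if e: "e > 0" for e
  proof -
    obtain d1 where d1: "d1 > 0" "\<And>y. (\<And>i. i \<ge> n \<Longrightarrow> y i = 0) \<Longrightarrow> (\<And>i. i < n \<Longrightarrow> \<bar>y i - x i\<bar> < d1) \<Longrightarrow>
        y \<in> W \<and> \<bar>?a y - ?a x\<bar> < e"
      by (rule continuous_box[OF assms(1,3) cont(1) e]) blast
    obtain d2 where d2: "d2 > 0" "\<And>y. (\<And>i. i \<ge> n \<Longrightarrow> y i = 0) \<Longrightarrow> (\<And>i. i < n \<Longrightarrow> \<bar>y i - x i\<bar> < d2) \<Longrightarrow>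
        y \<in> W \<and> \<bar>?b y - ?b x\<bar> < e"
      by (rule continuous_box[OF assms(1,3) cont(2) e]) blast
    define h where "h = min d1 d2 / 2"
    have h: "h > 0" "h < d1" "h < d2" using d1(1) d2(1) by (auto simp: h_def min_def)
    have z: "x k = 0" if "k \<ge> n" for k using eopen_zero[OF assms(1,3)] that by auto
    have A: "x(i := s, j := t) \<in> W \<and> \<bar>?a (x(i := s, j := t)) - ?a x\<bar> < e"
      if "\<bar>s - x i\<bar> \<le> h" "\<bar>t - x j\<bar> \<le> h" for s t
    proof (rule d1(2))
      show "(x(i := s, j := t)) k = 0" if "n \<le> k" for k using that assms(4,5) z[of k] by simp
      show "\<bar>(x(i := s, j := t)) k - x k\<bar> < d1" for k
        using \<open>\<bar>s - x i\<bar> \<le> h\<close> \<open>\<bar>t - x j\<bar> \<le> h\<close> h(2) d1(1) by simp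
    qed
    have B: "\<bar>?b (x(i := s, j := t)) - ?b x\<bar> < e"
      if "\<bar>s - x i\<bar> \<le> h" "\<bar>t - x j\<bar> \<le> h" for s t
    proof (rule d2(2)[THEN conjunct2])
      show "(x(i := s, j := t)) k = 0" if "n \<le> k" for k using that assms(4,5) z[of k] by simp
      show "\<bar>(x(i := s, j := t)) k - x k\<bar> < d2" for k
        using \<open>\<bar>s - x i\<bar> \<le> h\<close> \<open>\<bar>t - x j\<bar> \<le> h\<close> h(3) d2(1) by simp
    qed
    obtain s t where st: "\<bar>s - x i\<bar> \<le> h" "\<bar>t - x j\<bar> \<le> h"
      "f (x(i := x i + h, j := x j + h)) - f (x(i := x i + h)) - f (x(j := x j + h)) + f x = h * h * ?b (x(i := s, j := t))"
      by (rule second_difference[OF C assms(4,5) False h(1), where x = x]) (use A in blast)+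
    have A': "x(j := t, i := s) \<in> W" if "\<bar>t - x j\<bar> \<le> h" "\<bar>s - x i\<bar> \<le> h" for s t
      using A[OF that(2,1)] False by (simp add: fun_upd_twist[of i j])
    obtain t' s' where st': "\<bar>t' - x j\<bar> \<le> h" "\<bar>s' - x i\<bar> \<le> h"
      "f (x(j := x j + h, i := x i + h)) - f (x(j := x j + h)) - f (x(i := x i + h)) + f x = h * h * ?a (x(j := t', i := s'))"
      by (rule second_difference[OF C assms(5,4) False[symmetric] h(1), where x = x]) (use A' in blast)+
    have tw: "x(j := b, i := a) = x(i := a, j := b)" for a b using False by (simp add: fun_upd_twist)
    have "h * h * ?b (x(i := s, j := t)) = h * h * ?a (x(i := s', j := t'))"
      using st(3) st'(3) unfolding tw by linarith
    hence "?b (x(i := s, j := t)) = ?a (x(i := s', j := t'))" using h(1) by simp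
    thus ?thesis using A[OF st'(2,1)] B[OF st(1,2)] by linarith
  qed
  from this[of "e / 2" for e] have "\<bar>?a x - ?b x\<bar> \<le> 0 + e" if "e > 0" for e using that by simp
  hence "\<bar>?a x - ?b x\<bar> \<le> 0" by (rule field_le_epsilon)
  thus ?thesis by simp
qed simp

text \<open>
The chain rule for a function with continuous partial derivatives along a curve that is differentiable
at one point: change one coordinate at a time and apply the mean value theorem in each.
\<close>

lemma chain_rule_path:
  assumes W: "eopen n W" and f: "smooth_on n W f" and x: "\<gamma> t0 \<in> W"
    and E: "\<forall>\<^sub>F t in at t0. \<forall>i\<ge>n. \<gamma> t i = 0"
    and \<gamma>: "\<And>i. i < n \<Longrightarrow> ((\<lambda>t. \<gamma> t i) has_real_derivative \<gamma>' i) (at t0)"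
  shows "((\<lambda>t. f (\<gamma> t)) has_real_derivative (\<Sum>i<n. \<gamma>' i * partial_deriv i f (\<gamma> t0))) (at t0)"
proof -
  define x where "x = \<gamma> t0"
  define z where "z k t = (\<lambda>i. if i < k then \<gamma> t i else x i)" for k t
  \<comment> \<open>difference quotient in coordinate \<open>k\<close>, extended so that \<open>diff\<close> below holds without exception\<close>
  define h where "h k t = (if \<gamma> t k = x k then partial_deriv k f x else
     (f (z (Suc k) t) - f (z k t)) / (\<gamma> t k - x k))" for k t
  have z: "x k = 0" if "k \<ge> n" for k using eopen_zero[OF W, of x] that assms(3) by (auto simp: x_def)
  have diff: "f (z (Suc k) t) - f (z k t) = h k t * (\<gamma> t k - x k)" for k t
  proof (cases "\<gamma> t k = x k")
    case True
    hence "z (Suc k) t = z k t" by (auto simp: z_def less_Suc_eq)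
    thus ?thesis using True by (simp add: h_def)
  qed (simp add: h_def)
  have tele: "f (z n t) - f x = (\<Sum>k<n. h k t * (\<gamma> t k - x k))" for t
    using sum_lessThan_telescope[of "\<lambda>k. f (z k t)" n] unfolding diff by (simp add: z_def)
  have cl: "\<forall>\<^sub>F t in at t0. \<forall>k<n. \<bar>\<gamma> t k - x k\<bar> < d" if "d > 0" for d
  proof -
    have "\<forall>\<^sub>F t in at t0. \<bar>\<gamma> t k - x k\<bar> < d" if k: "k < n" for k
    proof -
      have "((\<lambda>t. \<gamma> t k) \<longlongrightarrow> x k) (at t0)"
        using DERIV_isCont[OF \<gamma>[OF k]] by (simp add: isCont_def x_def)
      from tendstoD[OF this \<open>d > 0\<close>] show ?thesis by (simp add: dist_real_def)
    qed
    hence "\<forall>\<^sub>F t in at t0. \<forall>k\<in>{..<n}. \<bar>\<gamma> t k - x k\<bar> < d"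
      by (intro eventually_ball_finite) auto
    thus ?thesis by (rule eventually_mono) simp
  qed
  have hlim: "(h k \<longlongrightarrow> partial_deriv k f x) (at t0)" if k: "k < n" for k
  proof (rule tendstoI)
    fix e :: real assume e: "e > 0"
    have "continuous_on W (partial_deriv k f)"
      using f k by (auto intro!: smooth_on_continuous smooth_on_partial)
    from continuous_box[OF W _ this e, of x] assms(3)
    obtain d where d: "d > 0" "\<And>y. (\<And>i. i \<ge> n \<Longrightarrow> y i = 0) \<Longrightarrow> (\<And>i. i < n \<Longrightarrow> \<bar>y i - x i\<bar> < d) \<Longrightarrow>
        y \<in> W \<and> \<bar>partial_deriv k f y - partial_deriv k f x\<bar> < e"
      by (auto simp: x_def)
    have "dist (h k t) (partial_deriv k f x) < e" if t: "\<forall>k<n. \<bar>\<gamma> t k - x k\<bar> < d" for t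
    proof (cases "\<gamma> t k = x k")
      case True
      thus ?thesis using e by (simp add: h_def)
    next
      case False
      have in_W: "(z k t)(k := s) \<in> W \<and> \<bar>partial_deriv k f ((z k t)(k := s)) - partial_deriv k f x\<bar> < e"
        if "\<bar>s - x k\<bar> \<le> \<bar>\<gamma> t k - x k\<bar>" for s
      proof (rule d(2))
        fix i assume "i \<ge> n"
        thus "((z k t)(k := s)) i = 0" using k z by (auto simp: z_def)
      next
        fix i assume i: "i < n"
        show "\<bar>((z k t)(k := s)) i - x i\<bar> < d"
          using t[rule_format, OF i] t[rule_format, OF k] that d(1) by (auto simp: z_def)
      qed
      have "((\<lambda>s. f ((z k t)(k := s))) has_real_derivative partial_deriv k f ((z k t)(k := s))) (at s)"
        if "\<bar>s - x k\<bar> \<le> \<bar>\<gamma> t k - x k\<bar>" for s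
        using smooth_on_has_partial[OF f in_W[OF that, THEN conjunct1] k] by simp
      from MVT_between[of "x k" "\<gamma> t k" "\<lambda>s. f ((z k t)(k := s))", OF this]
      obtain s where s: "\<bar>s - x k\<bar> \<le> \<bar>\<gamma> t k - x k\<bar>"
        "f ((z k t)(k := \<gamma> t k)) - f ((z k t)(k := x k)) = (\<gamma> t k - x k) * partial_deriv k f ((z k t)(k := s))"
        by blast
      have "(z k t)(k := \<gamma> t k) = z (Suc k) t" "(z k t)(k := x k) = z k t"
        by (auto simp: z_def less_Suc_eq)
      hence "h k t = partial_deriv k f ((z k t)(k := s))" using s(2) False by (simp add: h_def field_simps)
      thus ?thesis using in_W[OF s(1)] by (simp add: dist_real_def)
    qed
    thus "\<forall>\<^sub>F t in at t0. dist (h k t) (partial_deriv k f x) < e"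
      using cl[OF d(1)] by (auto elim: eventually_mono)
  qed
  have "((\<lambda>t. \<Sum>k<n. h k t * ((\<gamma> t k - x k) / (t - t0))) \<longlongrightarrow> (\<Sum>k<n. partial_deriv k f x * \<gamma>' k)) (at t0)"
    by (intro tendsto_sum tendsto_mult hlim) (use \<gamma> in \<open>auto simp: has_field_derivative_iff x_def\<close>)
  moreover have "\<forall>\<^sub>F t in at t0. (\<Sum>k<n. h k t * ((\<gamma> t k - x k) / (t - t0))) = (f (\<gamma> t) - f (\<gamma> t0)) / (t - t0)"
    using E
  proof eventually_elim
    case (elim t)
    have "z n t = \<gamma> t" using elim z by (auto simp: z_def)
    thus ?case using tele[of t] by (simp add: sum_divide_distrib x_def)
  qed
  ultimately have "((\<lambda>t. (f (\<gamma> t) - f (\<gamma> t0)) / (t - t0)) \<longlongrightarrow> (\<Sum>k<n. partial_deriv k f x * \<gamma>' k)) (at t0)"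
    by (rule Lim_transform_eventually)
  thus ?thesis by (simp add: has_field_derivative_iff x_def mult.commute)
qed

section \<open>Curves of superpolynomials\<close>

text \<open>
The coefficientwise derivative of a curve of superpolynomials.
\<close>

definition has_sderiv :: "real \<Rightarrow> (real \<Rightarrow> spoly) \<Rightarrow> spoly \<Rightarrow> bool" where
  "has_sderiv t0 F D \<longleftrightarrow> (\<forall>S K. ((\<lambda>t. coef (F t) S K) has_real_derivative coef D S K) (at t0))"

lemma has_sderiv_const: "has_sderiv t0 (\<lambda>t. A) 0" by (simp add: has_sderiv_def)

lemma has_sderiv_add: "has_sderiv t0 F D \<Longrightarrow> has_sderiv t0 G D' \<Longrightarrow> has_sderiv t0 (\<lambda>t. F t + G t) (D + D')"
  by (auto simp: has_sderiv_def intro: DERIV_add)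

lemma has_sderiv_sum: "(\<And>x. x \<in> X \<Longrightarrow> has_sderiv t0 (F x) (D x)) \<Longrightarrow> has_sderiv t0 (\<lambda>t. \<Sum>x\<in>X. F x t) (\<Sum>x\<in>X. D x)"
  by (induction X rule: infinite_finite_induct) (auto intro: has_sderiv_const has_sderiv_add)

lemma has_sderiv_scaleR:
  assumes "(f has_real_derivative f') (at t0)" "has_sderiv t0 F D"
  shows "has_sderiv t0 (\<lambda>t. f t *\<^sub>R F t) (f' *\<^sub>R F t0 + f t0 *\<^sub>R D)"
  unfolding has_sderiv_def
proof (intro allI)
  fix S K
  from DERIV_mult[OF assms(1) assms(2)[unfolded has_sderiv_def, rule_format, of S K]]
  show "((\<lambda>t. coef (f t *\<^sub>R F t) S K) has_real_derivative coef (f' *\<^sub>R F t0 + f t0 *\<^sub>R D) S K) (at t0)"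
    by (simp add: algebra_simps)
qed

lemma has_sderiv_scaleR_const: "has_sderiv t0 F D \<Longrightarrow> has_sderiv t0 (\<lambda>t. x *\<^sub>R F t) (x *\<^sub>R D)"
  using has_sderiv_scaleR[OF DERIV_const, of t0 F D x] by simp

lemma has_sderiv_scaleR_fun: "(f has_real_derivative f') (at t0) \<Longrightarrow> has_sderiv t0 (\<lambda>t. f t *\<^sub>R A) (f' *\<^sub>R A)"
  using has_sderiv_scaleR[OF _ has_sderiv_const, of f f' t0 A] by simp

lemma has_sderiv_mult:
  assumes "has_sderiv t0 F D" "has_sderiv t0 G D'"
  shows "has_sderiv t0 (\<lambda>t. F t * G t) (D * G t0 + F t0 * D')"
  unfolding has_sderiv_def
proof (intro allI)
  fix S K
  have "((\<lambda>t. \<Sum>S1\<in>Pow S. \<Sum>K1\<in>{K1. K1 \<subseteq># K}.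
      shuffle_sign S1 (S - S1) * coef (F t) S1 K1 * coef (G t) (S - S1) (K - K1)) has_real_derivative
     (\<Sum>S1\<in>Pow S. \<Sum>K1\<in>{K1. K1 \<subseteq># K}. shuffle_sign S1 (S - S1) * coef D S1 K1 * coef (G t0) (S - S1) (K - K1) +
      shuffle_sign S1 (S - S1) * coef (F t0) S1 K1 * coef D' (S - S1) (K - K1))) (at t0)"
  proof (intro DERIV_sum)
    fix S1 K1
    have F: "((\<lambda>t. coef (F t) S1 K1) has_real_derivative coef D S1 K1) (at t0)"
      and G: "((\<lambda>t. coef (G t) (S - S1) (K - K1)) has_real_derivative coef D' (S - S1) (K - K1)) (at t0)"
      using assms by (auto simp: has_sderiv_def)
    from DERIV_cmult[OF DERIV_mult[OF F G], of "shuffle_sign S1 (S - S1)"]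
    show "((\<lambda>t. shuffle_sign S1 (S - S1) * coef (F t) S1 K1 * coef (G t) (S - S1) (K - K1)) has_real_derivative
       shuffle_sign S1 (S - S1) * coef D S1 K1 * coef (G t0) (S - S1) (K - K1) +
       shuffle_sign S1 (S - S1) * coef (F t0) S1 K1 * coef D' (S - S1) (K - K1)) (at t0)"
      by (simp add: algebra_simps)
  qed
  thus "((\<lambda>t. coef (F t * G t) S K) has_real_derivative coef (D * G t0 + F t0 * D') S K) (at t0)"
    by (simp add: coef_mult super_mult_def sum.distrib)
qed

lemma has_sderiv_mult_const: "has_sderiv t0 F D \<Longrightarrow> has_sderiv t0 (\<lambda>t. A * F t) (A * D)"
  using has_sderiv_mult[OF has_sderiv_const, of t0 F D A] by simp

lemma has_sderiv_Dp: "has_sderiv t0 F D \<Longrightarrow> has_sderiv t0 (\<lambda>t. Dp i (F t)) (Dp i D)"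
  by (auto simp: has_sderiv_def Dp.rep_eq dp_def intro: DERIV_cmult)

lemma has_sderiv_D\<tau>: "has_sderiv t0 F D \<Longrightarrow> has_sderiv t0 (\<lambda>t. D\<tau> c (F t)) (D\<tau> c D)"
  by (auto simp: has_sderiv_def D\<tau>.rep_eq dtau_left_def intro: DERIV_cmult)

lemma has_sderiv_cong:
  assumes "\<forall>\<^sub>F t in nhds t0. F t = G t" "has_sderiv t0 F D"
  shows "has_sderiv t0 G D"
  unfolding has_sderiv_def
proof (intro allI)
  fix S K
  have "\<forall>\<^sub>F t in nhds t0. coef (F t) S K = coef (G t) S K"
    using assms(1) by (rule eventually_mono) simp
  from DERIV_cong_ev[OF refl this refl, THEN iffD1] assms(2)[unfolded has_sderiv_def, rule_format, of S K]
  show "((\<lambda>t. coef (G t) S K) has_real_derivative coef D S K) (at t0)" .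
qed

text \<open>
The finite set of exponents that can occur in an element of degree \<open>d\<close>.
\<close>

definition homset :: "nat \<Rightarrow> nat \<Rightarrow> nat \<Rightarrow> (nat set \<times> nat multiset) set" where
  "homset r n d = {(S, K). S \<subseteq> {..<r} \<and> set_mset K \<subseteq> {..<n} \<and> card S + 2 * size K = d}"

lemma finite_homset: "finite (homset r n d)"
proof (rule finite_subset)
  show "homset r n d \<subseteq> Pow {..<r} \<times> (\<Union>j\<le>d. multisets_of_size {..<n} j)"
    by (auto simp: homset_def multisets_of_size_def)
  show "finite (Pow {..<r} \<times> (\<Union>j\<le>d. multisets_of_size {..<n} j))"
    by (intro finite_cartesian_product finite_UN_I finite_multisets_of_size) auto
qed

lemma homog_homset: "homog r n d A \<longleftrightarrow> supp A \<subseteq> homset r n d"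
  unfolding homset_def by (rule homog_supp)

lemma homset_finite_fst: "(S, K) \<in> homset r n d \<Longrightarrow> finite S"
  by (auto simp: homset_def intro: finite_subset)

lemma has_sderiv_homog:
  assumes "has_sderiv t0 F D" "\<forall>\<^sub>F t in nhds t0. homog r n d (F t)"
  shows "homog r n d D"
  unfolding homog_homset
proof
  fix z assume "z \<in> supp D"
  obtain S K where z: "z = (S, K)" by force
  show "z \<in> homset r n d"
  proof (rule ccontr)
    assume "z \<notin> homset r n d"
    hence "\<forall>\<^sub>F t in nhds t0. coef (F t) S K = 0"
      by (intro eventually_mono[OF assms(2)]) (auto simp: homog_homset z supp_def)
    hence "((\<lambda>t. coef (F t) S K) has_real_derivative 0) (at t0)"
      using DERIV_cong_ev[of t0 t0 "\<lambda>t. coef (F t) S K" "\<lambda>t. 0"] by simp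
    moreover have "((\<lambda>t. coef (F t) S K) has_real_derivative coef D S K) (at t0)"
      using assms(1) by (simp add: has_sderiv_def)
    ultimately have "coef D S K = 0" by (rule DERIV_unique[symmetric])
    thus False using \<open>z \<in> supp D\<close> z by (simp add: supp_def)
  qed
qed

text \<open>
The chain rule along a curve, where both the substituted elements and the coefficients vary.
\<close>

lemma has_sderiv_hom:
  fixes T P :: "real \<Rightarrow> nat \<Rightarrow> spoly"
  assumes T_odd: "\<And>t c. eps (T t c) = - T t c" and P_even: "\<And>t i. eps (P t i) = P t i"
    and X_odd: "\<And>c. eps (X c) = - X c" and Y_even: "\<And>i. eps (Y i) = Y i"
    and T: "\<And>c. c < r \<Longrightarrow> has_sderiv t0 (\<lambda>t. T t c) (X c)" and P: "\<And>i. i < n \<Longrightarrow> has_sderiv t0 (\<lambda>t. P t i) (Y i)"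
    and F: "has_sderiv t0 F D" and hF: "\<forall>\<^sub>F t in nhds t0. homog r n d (F t)"
  shows "has_sderiv t0 (\<lambda>t. hom (T t) (P t) (F t)) (hom (T t0) (P t0) D +
    ((\<Sum>a<r. X a * hom (T t0) (P t0) (D\<tau> a (F t0))) + (\<Sum>i<n. Y i * hom (T t0) (P t0) (Dp i (F t0)))))"
proof -
  interpret super_substitution "T t" "P t" for t
    by unfold_locales (rule T_odd P_even)+
  let ?\<Phi> = "hom (T t0) (P t0)"
  let ?X = "\<lambda>A. (\<Sum>a<r. X a * ?\<Phi> (D\<tau> a A)) + (\<Sum>i<n. Y i * ?\<Phi> (Dp i A))"
  have const: "has_sderiv t0 (\<lambda>t. hom (T t) (P t) A) (?X A)"
    if "supp A \<subseteq> {(S, K). S \<subseteq> {..<r} \<and> set_mset K \<subseteq> {..<n}}" for A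
  proof (rule hom_chain_rel[OF that, where R = "\<lambda>A D. has_sderiv t0 (\<lambda>t. hom (T t) (P t) A) D" and s = 1])
    fix c A D assume "c < r" "has_sderiv t0 (\<lambda>t. hom (T t) (P t) A) D"
    thus "has_sderiv t0 (\<lambda>t. hom (T t) (P t) (\<tau> c * A)) (X c * ?\<Phi> A + 1 *\<^sub>R (T t0 c * D))"
      using has_sderiv_mult[OF T, of c "\<lambda>t. hom (T t) (P t) A" D] by simp
  next
    fix i A D assume "i < n" "has_sderiv t0 (\<lambda>t. hom (T t) (P t) A) D"
    thus "has_sderiv t0 (\<lambda>t. hom (T t) (P t) (p_gen i * A)) (Y i * ?\<Phi> A + P t0 i * D)"
      using has_sderiv_mult[OF P, of i "\<lambda>t. hom (T t) (P t) A" D] by simp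
  next
    show "1 *\<^sub>R (T t0 c * X a) = - (X a * T t0 c)" for a c
      using odd_mult_commute[OF T_odd, of t0 c "X a"] by (simp add: X_odd)
    show "1 *\<^sub>R (T t0 c * Y i) = Y i * T t0 c" for i c
      using even_mult_commute[OF Y_even, of i "T t0 c"] by simp
  qed (auto intro: has_sderiv_const has_sderiv_add has_sderiv_scaleR_const)
  let ?Z = "homset r n d"
  have exp: "A = (\<Sum>z\<in>?Z. coef A (fst z) (snd z) *\<^sub>R mono (fst z) (snd z))" if "homog r n d A" for A
    using spoly_expand[OF finite_homset, of A r n d] that by (simp add: homog_homset split_def)
  have "has_sderiv t0 (\<lambda>t. \<Sum>z\<in>?Z. coef (F t) (fst z) (snd z) *\<^sub>R hom (T t) (P t) (mono (fst z) (snd z)))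
    (\<Sum>z\<in>?Z. coef D (fst z) (snd z) *\<^sub>R ?\<Phi> (mono (fst z) (snd z)) +
        coef (F t0) (fst z) (snd z) *\<^sub>R ?X (mono (fst z) (snd z)))"
  proof (intro has_sderiv_sum has_sderiv_scaleR const)
    fix z assume z: "z \<in> ?Z"
    show "((\<lambda>t. coef (F t) (fst z) (snd z)) has_real_derivative coef D (fst z) (snd z)) (at t0)"
      using F by (simp add: has_sderiv_def)
    show "supp (mono (fst z) (snd z)) \<subseteq> {(S, K). S \<subseteq> {..<r} \<and> set_mset K \<subseteq> {..<n}}"
      using z by (auto simp: supp_def coef_mono homset_def split: if_splits)
  qed
  moreover have "hom (T t) (P t) A = (\<Sum>z\<in>?Z. coef A (fst z) (snd z) *\<^sub>R hom (T t) (P t) (mono (fst z) (snd z)))"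
    if "homog r n d A" for t A by (subst exp[OF that]) simp
  note hexp = this
  have "?X A = (\<Sum>z\<in>?Z. coef A (fst z) (snd z) *\<^sub>R ?X (mono (fst z) (snd z)))" if "homog r n d A" for A
  proof -
    have "?X A = ?X (\<Sum>z\<in>?Z. coef A (fst z) (snd z) *\<^sub>R mono (fst z) (snd z))" using exp[OF that] by simp
    also have "\<dots> = (\<Sum>z\<in>?Z. coef A (fst z) (snd z) *\<^sub>R ?X (mono (fst z) (snd z)))"
      unfolding D\<tau>_sum Dp_sum hom_sum D\<tau>_scaleR Dp_scaleR hom_scaleR sum_distrib_left
      by (simp add: sum.distrib scaleR_add_right scaleR_sum_right sum.swap[of _ ?Z])
    finally show ?thesis .
  qed
  note Xexp = this
  have F0: "homog r n d (F t0)" using hF by (rule eventually_nhds_x_imp_x)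
  have "has_sderiv t0 (\<lambda>t. \<Sum>z\<in>?Z. coef (F t) (fst z) (snd z) *\<^sub>R hom (T t) (P t) (mono (fst z) (snd z)))
     (?\<Phi> D + ?X (F t0))"
    using calculation unfolding hexp[OF has_sderiv_homog[OF F hF]] Xexp[OF F0] by (simp only: sum.distrib)
  thus ?thesis
    by (rule has_sderiv_cong[rotated]) (rule eventually_mono[OF hF], simp only: hexp)
qed

section \<open>Invariance of the bracket under a change of coordinates, at a point\<close>

text \<open>
The bracket of two transformed functions at a point. The derivatives of \<open>F\<close> in the old coordinates are
\<open>Fq\<close>, \<open>Fp\<close>, \<open>Ft\<close>, and likewise for \<open>G\<close>; the sign \<open>\<sigma>\<close> is the parity of \<open>F\<close>. The old coordinates as functions of
the new ones have derivatives \<open>V\<close> and \<open>Y\<close> (of \<open>\<tau>\<close> and \<open>p\<close> in base directions), \<open>B\<close> and \<open>W\<close> (of \<open>\<tau>\<close>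
and \<open>p\<close> in the new odd directions); in \<open>p\<close>-directions only \<open>p\<close> varies, and after contraction with the
Jacobian of the base its derivative is 1. The hypotheses \<open>gram_inv_change\<close>, \<open>W_contraction\<close>, \<open>W_contraction'\<close> and \<open>dP_antisym\<close> say that the old
coordinates have the expected brackets \<open>{\<tau>, \<tau>} = h\<close>, \<open>{\<tau>, p} = 0\<close> and \<open>{p, p} = 0\<close>.
\<close>

lemma (in super_substitution) bracket_invariance_pointwise:
  fixes n r :: nat and h h' B :: "nat \<Rightarrow> nat \<Rightarrow> real" and Fq Gq Fp Gp Ft Gt :: "nat \<Rightarrow> spoly"
    and V W Y :: "nat \<Rightarrow> nat \<Rightarrow> spoly"
  assumes F_par: "\<And>a. eps (Ft a) = - \<sigma> *\<^sub>R Ft a" "\<And>i. eps (Fp i) = \<sigma> *\<^sub>R Fp i" and \<sigma>: "\<sigma> * \<sigma> = 1"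
    and V_odd: "\<And>s a. eps (V s a) = - V s a" and W_odd: "\<And>s a. eps (W s a) = - W s a"
    and Y_even: "\<And>s i. eps (Y s i) = Y s i"
    and gram_inv_change: "\<And>a d. a < r \<Longrightarrow> d < r \<Longrightarrow> (\<Sum>b<r. \<Sum>c<r. h' b c * (B a b * B d c)) = h a d"
    and W_contraction: "\<And>s a. s < n \<Longrightarrow> a < r \<Longrightarrow> (\<Sum>b<r. \<Sum>c<r. (h' b c * B a b) *\<^sub>R W s c) = - V s a"
    and W_contraction': "\<And>s a. s < n \<Longrightarrow> a < r \<Longrightarrow> (\<Sum>b<r. \<Sum>c<r. (h' b c * B a c) *\<^sub>R W s b) = - V s a"
    and dP_antisym: "\<And>i j. i < n \<Longrightarrow> j < n \<Longrightarrow> Y j i - Y i j = (\<Sum>b<r. \<Sum>c<r. h' b c *\<^sub>R (W i b * W j c))"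
  defines "dF \<equiv> \<lambda>s. \<Phi> (Fq s) + ((\<Sum>a<r. V s a * \<Phi> (Ft a)) + (\<Sum>i<n. Y s i * \<Phi> (Fp i)))"
    and "dG \<equiv> \<lambda>s. \<Phi> (Gq s) + ((\<Sum>a<r. V s a * \<Phi> (Gt a)) + (\<Sum>i<n. Y s i * \<Phi> (Gp i)))"
    and "tF \<equiv> \<lambda>b. (\<Sum>a<r. B a b *\<^sub>R \<Phi> (Ft a)) + (\<Sum>i<n. W i b * \<Phi> (Fp i))"
    and "tG \<equiv> \<lambda>b. (\<Sum>a<r. B a b *\<^sub>R \<Phi> (Gt a)) + (\<Sum>i<n. W i b * \<Phi> (Gp i))"
  shows "(\<Sum>s<n. dF s * \<Phi> (Gp s) - \<Phi> (Fp s) * dG s) + (\<Sum>b<r. \<Sum>c<r. h' b c *\<^sub>R (eps (tF b) * tG c)) =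
    \<Phi> ((\<Sum>s<n. Fq s * Gp s - Fp s * Gq s) + (\<Sum>a<r. \<Sum>d<r. h a d *\<^sub>R (eps (Ft a) * Gt d)))"
proof -
  have eFt: "eps (\<Phi> (Ft a)) = - \<sigma> *\<^sub>R \<Phi> (Ft a)" and eFp: "eps (\<Phi> (Fp i)) = \<sigma> *\<^sub>R \<Phi> (Fp i)" for a i
    by (simp_all add: eps_hom F_par)
  have VFt: "V s a * \<Phi> (Ft b) = (- \<sigma>) *\<^sub>R (\<Phi> (Ft b) * V s a)" for s a b
    using odd_mult_commute[OF V_odd, of s a "\<Phi> (Ft b)"] by (simp add: eFt)
  have WFp: "W s a * \<Phi> (Fp b) = \<sigma> *\<^sub>R (\<Phi> (Fp b) * W s a)" for s a b
    using odd_mult_commute[OF W_odd, of s a "\<Phi> (Fp b)"] by (simp add: eFp)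
  have YFp: "Y s i * \<Phi> (Fp j) = \<Phi> (Fp j) * Y s i" for s i j
    by (rule even_mult_commute) (rule Y_even)
  define TT where "TT = (\<Sum>a<r. \<Sum>d<r. (- \<sigma> * h a d) *\<^sub>R (\<Phi> (Ft a) * \<Phi> (Gt d)))"
  define TP where "TP = (\<Sum>a<r. \<Sum>j<n. \<sigma> *\<^sub>R (\<Phi> (Ft a) * V j a * \<Phi> (Gp j)))"
  define PT where "PT = (\<Sum>i<n. \<Sum>d<r. \<Phi> (Fp i) * V i d * \<Phi> (Gt d))"
  define PP where "PP = (\<Sum>i<n. \<Sum>j<n. \<Phi> (Fp i) * (Y j i - Y i j) * \<Phi> (Gp j))"
  define QP where "QP = (\<Sum>s<n. \<Phi> (Fq s) * \<Phi> (Gp s) - \<Phi> (Fp s) * \<Phi> (Gq s))"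
  have 1: "(\<Sum>s<n. dF s * \<Phi> (Gp s) - \<Phi> (Fp s) * dG s) = QP - TP - PT + PP"
  proof -
    have "(\<Sum>s<n. \<Sum>a<r. V s a * \<Phi> (Ft a) * \<Phi> (Gp s)) = - TP"
      unfolding TP_def sum_negf[symmetric] by (subst sum.swap) (simp add: VFt sum_negf)
    moreover have "(\<Sum>s<n. \<Sum>i<n. Y s i * \<Phi> (Fp i) * \<Phi> (Gp s)) = (\<Sum>i<n. \<Sum>j<n. \<Phi> (Fp i) * Y j i * \<Phi> (Gp j))"
      by (subst sum.swap) (simp add: YFp)
    moreover have "(\<Sum>s<n. \<Sum>a<r. \<Phi> (Fp s) * (V s a * \<Phi> (Gt a))) = PT"
      unfolding PT_def by (simp add: mult.assoc)
    moreover have "PP = (\<Sum>i<n. \<Sum>j<n. \<Phi> (Fp i) * Y j i * \<Phi> (Gp j)) - (\<Sum>i<n. \<Sum>j<n. \<Phi> (Fp i) * (Y i j * \<Phi> (Gp j)))"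
      unfolding PP_def sum_subtractf[symmetric] by (simp add: algebra_simps)
    ultimately show ?thesis
      unfolding dF_def dG_def QP_def
      by (simp add: distrib_left distrib_right sum.distrib sum_subtractf sum_distrib_left sum_distrib_right)
  qed
  have etF: "eps (tF b) = - \<sigma> *\<^sub>R ((\<Sum>a<r. B a b *\<^sub>R \<Phi> (Ft a)) + (\<Sum>i<n. W i b * \<Phi> (Fp i)))" for b
    unfolding tF_def
    by (simp add: eFt eFp W_odd scaleR_add_right scaleR_sum_right sum_negf mult.commute[of \<sigma>])
  have 2: "(\<Sum>b<r. \<Sum>c<r. h' b c *\<^sub>R (eps (tF b) * tG c)) = TT + TP + PT - PP"
  proof -
    define q where "q f = (\<Sum>b<r. \<Sum>c<r. (- \<sigma> * h' b c) *\<^sub>R f b c)" for f :: "nat \<Rightarrow> nat \<Rightarrow> spoly"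
    have q_add: "q (\<lambda>b c. f b c + g b c) = q f + q g" for f g
      by (simp add: q_def scaleR_add_right sum.distrib sum_negf sum_subtractf)
    have q_sum: "q (\<lambda>b c. \<Sum>x\<in>X. f x b c) = (\<Sum>x\<in>X. q (f x))" for f :: "nat \<Rightarrow> nat \<Rightarrow> nat \<Rightarrow> spoly" and X
      by (induction X rule: infinite_finite_induct) (simp_all add: q_add, simp_all add: q_def)
    have q_prod: "q (\<lambda>b c. (\<Sum>x\<in>X. f x b) * (\<Sum>y\<in>Y. g y c)) = (\<Sum>x\<in>X. \<Sum>y\<in>Y. q (\<lambda>b c. f x b * g y c))"
      for X Y :: "nat set" and f g :: "nat \<Rightarrow> nat \<Rightarrow> spoly"
      by (simp only: sum_product q_sum)
    have "(\<Sum>b<r. \<Sum>c<r. h' b c *\<^sub>R (eps (tF b) * tG c)) =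
      q (\<lambda>b c. ((\<Sum>a<r. B a b *\<^sub>R \<Phi> (Ft a)) + (\<Sum>i<n. W i b * \<Phi> (Fp i))) * tG c)"
      unfolding q_def etF by (simp add: mult_ac)
    also have "\<dots> = (\<Sum>a<r. \<Sum>d<r. q (\<lambda>b c. (B a b *\<^sub>R \<Phi> (Ft a)) * (B d c *\<^sub>R \<Phi> (Gt d)))) +
        (\<Sum>a<r. \<Sum>j<n. q (\<lambda>b c. (B a b *\<^sub>R \<Phi> (Ft a)) * (W j c * \<Phi> (Gp j)))) +
        ((\<Sum>i<n. \<Sum>d<r. q (\<lambda>b c. (W i b * \<Phi> (Fp i)) * (B d c *\<^sub>R \<Phi> (Gt d)))) +
        (\<Sum>i<n. \<Sum>j<n. q (\<lambda>b c. (W i b * \<Phi> (Fp i)) * (W j c * \<Phi> (Gp j)))))"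
      unfolding tG_def by (simp only: distrib_left distrib_right q_add q_prod add_ac)
    also have "(\<Sum>a<r. \<Sum>d<r. q (\<lambda>b c. (B a b *\<^sub>R \<Phi> (Ft a)) * (B d c *\<^sub>R \<Phi> (Gt d)))) = TT"
      unfolding TT_def
    proof (intro sum.cong refl)
      fix a d assume "a \<in> {..<r}" "d \<in> {..<r}"
      hence "h a d = (\<Sum>b<r. \<Sum>c<r. h' b c * (B a b * B d c))" using gram_inv_change by simp
      thus "q (\<lambda>b c. (B a b *\<^sub>R \<Phi> (Ft a)) * (B d c *\<^sub>R \<Phi> (Gt d))) = (- \<sigma> * h a d) *\<^sub>R (\<Phi> (Ft a) * \<Phi> (Gt d))"
        by (simp add: q_def sum_distrib_left scaleR_sum_left mult_ac sum_negf)
    qed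
    also have "(\<Sum>a<r. \<Sum>j<n. q (\<lambda>b c. (B a b *\<^sub>R \<Phi> (Ft a)) * (W j c * \<Phi> (Gp j)))) = TP"
      unfolding TP_def
    proof (intro sum.cong refl)
      fix a j assume aj: "a \<in> {..<r}" "j \<in> {..<n}"
      have "q (\<lambda>b c. (B a b *\<^sub>R \<Phi> (Ft a)) * (W j c * \<Phi> (Gp j))) =
        (- \<sigma>) *\<^sub>R (\<Phi> (Ft a) * (\<Sum>b<r. \<Sum>c<r. (h' b c * B a b) *\<^sub>R W j c) * \<Phi> (Gp j))"
        by (simp add: q_def sum_distrib_left sum_distrib_right scaleR_sum_right mult_ac sum_negf)
      thus "q (\<lambda>b c. (B a b *\<^sub>R \<Phi> (Ft a)) * (W j c * \<Phi> (Gp j))) = \<sigma> *\<^sub>R (\<Phi> (Ft a) * V j a * \<Phi> (Gp j))"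
        using W_contraction[of j a] aj by simp
    qed
    also have "(\<Sum>i<n. \<Sum>d<r. q (\<lambda>b c. (W i b * \<Phi> (Fp i)) * (B d c *\<^sub>R \<Phi> (Gt d)))) = PT"
      unfolding PT_def
    proof (intro sum.cong refl)
      fix i d assume aj: "i \<in> {..<n}" "d \<in> {..<r}"
      have "q (\<lambda>b c. (W i b * \<Phi> (Fp i)) * (B d c *\<^sub>R \<Phi> (Gt d))) =
        (- \<sigma> * \<sigma>) *\<^sub>R (\<Phi> (Fp i) * (\<Sum>b<r. \<Sum>c<r. (h' b c * B d c) *\<^sub>R W i b) * \<Phi> (Gt d))"
        by (simp add: q_def WFp sum_distrib_left sum_distrib_right scaleR_sum_right mult_ac sum_negf)
      thus "q (\<lambda>b c. (W i b * \<Phi> (Fp i)) * (B d c *\<^sub>R \<Phi> (Gt d))) = \<Phi> (Fp i) * V i d * \<Phi> (Gt d)"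
        using W_contraction'[of i d] aj \<sigma> by simp
    qed
    also have "(\<Sum>i<n. \<Sum>j<n. q (\<lambda>b c. (W i b * \<Phi> (Fp i)) * (W j c * \<Phi> (Gp j)))) = - PP"
      unfolding PP_def sum_negf[symmetric]
    proof (intro sum.cong refl)
      fix i j assume aj: "i \<in> {..<n}" "j \<in> {..<n}"
      have "q (\<lambda>b c. (W i b * \<Phi> (Fp i)) * (W j c * \<Phi> (Gp j))) =
        (- \<sigma> * \<sigma>) *\<^sub>R (\<Phi> (Fp i) * (\<Sum>b<r. \<Sum>c<r. h' b c *\<^sub>R (W i b * W j c)) * \<Phi> (Gp j))"
        by (simp add: q_def WFp sum_distrib_left sum_distrib_right scaleR_sum_right mult_ac sum_negf)
      thus "q (\<lambda>b c. (W i b * \<Phi> (Fp i)) * (W j c * \<Phi> (Gp j))) = - (\<Phi> (Fp i) * (Y j i - Y i j) * \<Phi> (Gp j))"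
        using dP_antisym[of i j] aj \<sigma> by simp
    qed
    finally show ?thesis by simp
  qed
  have 3: "\<Phi> ((\<Sum>s<n. Fq s * Gp s - Fp s * Gq s) + (\<Sum>a<r. \<Sum>d<r. h a d *\<^sub>R (eps (Ft a) * Gt d))) = QP + TT"
    unfolding QP_def TT_def by (simp add: hom_mult F_par mult.commute[of \<sigma>])
  show ?thesis unfolding 1 2 3 by simp
qed

section \<open>Matrices\<close>

text \<open>
Matrices of size \<open>r\<close> as functions on indices. Results of operations vanish outside the range, so that
identities hold as equalities of functions; \<open>mat_trunc\<close> cuts off an arbitrary function accordingly, and
\<open>mat_tp\<close> is the transpose.
\<close>

definition mat_mult :: "nat \<Rightarrow> (nat \<Rightarrow> nat \<Rightarrow> real) \<Rightarrow> (nat \<Rightarrow> nat \<Rightarrow> real) \<Rightarrow> nat \<Rightarrow> nat \<Rightarrow> real" where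
  "mat_mult r A B = (\<lambda>a c. if a < r \<and> c < r then \<Sum>b<r. A a b * B b c else 0)"

definition mat_one :: "nat \<Rightarrow> nat \<Rightarrow> nat \<Rightarrow> real" where
  "mat_one r = (\<lambda>a b. if a < r \<and> a = b then 1 else 0)"

definition mat_trunc :: "nat \<Rightarrow> (nat \<Rightarrow> nat \<Rightarrow> real) \<Rightarrow> nat \<Rightarrow> nat \<Rightarrow> real" where
  "mat_trunc r A = (\<lambda>a b. if a < r \<and> b < r then A a b else 0)"

definition mat_tp :: "(nat \<Rightarrow> nat \<Rightarrow> real) \<Rightarrow> nat \<Rightarrow> nat \<Rightarrow> real" where
  "mat_tp A = (\<lambda>a b. A b a)"

lemma mat_mult_assoc: "mat_mult r (mat_mult r A B) C = mat_mult r A (mat_mult r B C)"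
proof (intro ext)
  fix a d
  have "(\<Sum>c<r. (\<Sum>b<r. A a b * B b c) * C c d) = (\<Sum>b<r. A a b * (\<Sum>c<r. B b c * C c d))"
    by (simp add: sum_distrib_left sum_distrib_right mult.assoc) (rule sum.swap)
  thus "mat_mult r (mat_mult r A B) C a d = mat_mult r A (mat_mult r B C) a d" by (simp add: mat_mult_def)
qed

lemma mat_mult_one_left [simp]: "mat_mult r (mat_one r) A = mat_trunc r A"
  by (auto simp: mat_mult_def mat_one_def mat_trunc_def fun_eq_iff if_distrib[of "\<lambda>x. x * _"] cong: if_cong)

lemma mat_mult_one_right [simp]: "mat_mult r A (mat_one r) = mat_trunc r A"
  by (auto simp: mat_mult_def mat_one_def mat_trunc_def fun_eq_iff if_distrib[of "\<lambda>x. _ * x"] cong: if_cong)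

lemma mat_mult_trunc [simp]: "mat_mult r (mat_trunc r A) B = mat_mult r A B" "mat_mult r A (mat_trunc r B) = mat_mult r A B"
  "mat_trunc r (mat_mult r A B) = mat_mult r A B" "mat_trunc r (mat_one r) = mat_one r" "mat_trunc r (mat_trunc r A) = mat_trunc r A"
  by (auto simp: mat_mult_def mat_trunc_def mat_one_def fun_eq_iff)

lemma mat_tp_mat_mult: "mat_tp (mat_mult r A B) = mat_mult r (mat_tp B) (mat_tp A)"
  by (auto simp: mat_tp_def mat_mult_def fun_eq_iff mult.commute)

lemma mat_tp_one [simp]: "mat_tp (mat_one r) = mat_one r" by (auto simp: mat_tp_def mat_one_def fun_eq_iff)
lemma mat_tp_tp [simp]: "mat_tp (mat_tp A) = A" by (simp add: mat_tp_def)
lemma mat_tp_trunc: "mat_tp (mat_trunc r A) = mat_trunc r (mat_tp A)" by (auto simp: mat_tp_def mat_trunc_def fun_eq_iff)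

lemma mat_mult_minus: "mat_mult r (\<lambda>a b. - A a b) C = (\<lambda>a b. - mat_mult r A C a b)"
  "mat_mult r C (\<lambda>a b. - A a b) = (\<lambda>a b. - mat_mult r C A a b)"
  by (auto simp: mat_mult_def fun_eq_iff sum_negf)

lemma mat_mult_cong: "(\<And>a b. a < r \<Longrightarrow> b < r \<Longrightarrow> A a b = A' a b) \<Longrightarrow> (\<And>a b. a < r \<Longrightarrow> b < r \<Longrightarrow> B a b = B' a b) \<Longrightarrow>
   mat_mult r A B = mat_mult r A' B'"
  by (auto simp: mat_mult_def fun_eq_iff)

section \<open>Calculus in the charts of a manifold\<close>

text \<open>
The coordinate line through \<open>m\<close> in the direction of the \<open>l\<close>-th base coordinate of \<open>k\<close>, parametrized by that coordinate.
\<close>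

definition coord_curve :: "('m, 'v) coords \<Rightarrow> 'm \<Rightarrow> nat \<Rightarrow> real \<Rightarrow> 'm" where
  "coord_curve k m l t = inv_into (patch k) (q_coord k) ((q_coord k m)(l := t))"

text \<open>
\<open>f\<close> is smooth on the set \<open>O'\<close> (meant to lie in the domain of \<open>k\<close>) as a function of the base coordinates of \<open>k\<close>.
\<close>

definition chart_smooth :: "('m, 'v, 'z) metric_bundle_scheme \<Rightarrow> ('m, 'v) coords \<Rightarrow> 'm set \<Rightarrow> ('m \<Rightarrow> real) \<Rightarrow> bool" where
  "chart_smooth E k O' f \<longleftrightarrow> smooth_on (base_dim E) (q_coord k ` O') (\<lambda>x. f (inv_into (patch k) (q_coord k) x))"

lemma dq_eqI:
  assumes "((\<lambda>t. f (coord_curve k m l t)) has_real_derivative D) (at (q_coord k m l))"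
  shows "dq k l f m = D"
  using assms unfolding dq_def coord_curve_def by (rule partial_deriv_eqI)

context metric_bundle
begin

abbreviation "n \<equiv> base_dim E"
abbreviation "r \<equiv> rank E"
abbreviation "\<K> \<equiv> coord_systems E"

lemma coord_systemsD:
  assumes "k \<in> \<K>"
  shows "(patch k, q_coord k) \<in> charts E" "(patch k, e_frame k) \<in> frames E"
    "a < r \<Longrightarrow> b < r \<Longrightarrow> x \<in> patch k \<Longrightarrow> y \<in> patch k \<Longrightarrow> gram E k x a b = gram E k y a b"
proof -
  show "(patch k, q_coord k) \<in> charts E" "(patch k, e_frame k) \<in> frames E"
    using assms by (auto simp: coord_systems_def)
  assume "a < r" "b < r" "x \<in> patch k" "y \<in> patch k"
  moreover from this obtain c where "\<forall>m\<in>patch k. form E m (e_frame k a m) (e_frame k b m) = c"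
    using assms unfolding coord_systems_def by blast
  ultimately show "gram E k x a b = gram E k y a b" by (simp add: gram_def)
qed

lemma chart_props:
  assumes "k \<in> \<K>"
  shows "open (patch k)" "eopen n (q_coord k ` patch k)"
    "homeomorphism (patch k) (q_coord k ` patch k) (q_coord k) (inv_into (patch k) (q_coord k))"
  using chart[OF coord_systemsD(1)[OF assms]] by (auto simp: chart_on_def)

lemma inv_q: "k \<in> \<K> \<Longrightarrow> x \<in> patch k \<Longrightarrow> inv_into (patch k) (q_coord k) (q_coord k x) = x"
  by (rule homeomorphism_apply1[OF chart_props(3)])

lemma coord_curve_self: "k \<in> \<K> \<Longrightarrow> m \<in> patch k \<Longrightarrow> coord_curve k m l (q_coord k m l) = m"
  by (simp add: coord_curve_def inv_q)

lemma eopen_image: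
  assumes "k \<in> \<K>" "open U" "U \<subseteq> patch k"
  shows "eopen n (q_coord k ` U)"
proof -
  have "openin (top_of_set (patch k)) U" using assms by (auto simp: openin_open)
  hence "openin (top_of_set (q_coord k ` patch k)) (q_coord k ` U)"
    by (rule homeomorphism_imp_open_map[OF chart_props(3)[OF assms(1)]])
  then obtain T where T: "open T" "q_coord k ` U = q_coord k ` patch k \<inter> T" by (auto simp: openin_open)
  obtain T' where "open T'" "q_coord k ` patch k = T' \<inter> {x. \<forall>i\<ge>n. x i = 0}"
    using chart_props(2)[OF assms(1)] unfolding eopen_iff by blast
  thus ?thesis unfolding eopen_iff using T by (intro exI[of _ "T \<inter> T'"]) auto
qed

lemma coord_curve_eventually:
  assumes "k \<in> \<K>" "open U" "U \<subseteq> patch k" "m \<in> U" "l < n"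
  shows "\<forall>\<^sub>F t in nhds (q_coord k m l). coord_curve k m l t \<in> U"
proof (rule eventually_mono[OF eopen_line[OF eopen_image[OF assms(1-3)] _ assms(5)]])
  show "q_coord k m \<in> q_coord k ` U" using assms(4) by simp
  fix t assume "(q_coord k m)(l := t) \<in> q_coord k ` U"
  then obtain x where "x \<in> U" "(q_coord k m)(l := t) = q_coord k x" by auto
  thus "coord_curve k m l t \<in> U" using inv_q[OF assms(1)] assms(3) by (auto simp: coord_curve_def)
qed

lemma chart_smooth_deriv:
  assumes "k \<in> \<K>" "U \<subseteq> patch k" "m \<in> U" "l < n" "chart_smooth E k U f"
  shows "((\<lambda>t. f (coord_curve k m l t)) has_real_derivative dq k l f m) (at (q_coord k m l))"
  using smooth_on_has_partial[OF assms(5)[unfolded chart_smooth_def], of "q_coord k m" l] assms(3,4)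
  by (simp add: coord_curve_def dq_def)

lemma chart_smooth_cong:
  assumes "k \<in> \<K>" "open U" "U \<subseteq> patch k" "\<And>x. x \<in> U \<Longrightarrow> f x = g x" "chart_smooth E k U f"
  shows "chart_smooth E k U g"
  unfolding chart_smooth_def
proof (rule smooth_on_cong[OF eopen_image[OF assms(1-3)] _ assms(5)[unfolded chart_smooth_def]])
  fix y assume "y \<in> q_coord k ` U"
  thus "f (inv_into (patch k) (q_coord k) y) = g (inv_into (patch k) (q_coord k) y)"
    using inv_q[OF assms(1)] assms(3,4) by auto
qed

lemma chart_smooth_subset: "chart_smooth E k U f \<Longrightarrow> V \<subseteq> U \<Longrightarrow> chart_smooth E k V f"
  unfolding chart_smooth_def by (erule smooth_on_subset) auto

lemma chart_smooth_const: "chart_smooth E k U (\<lambda>x. c)" by (simp add: chart_smooth_def smooth_on_const)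

lemma chart_smooth_add: "k \<in> \<K> \<Longrightarrow> open U \<Longrightarrow> U \<subseteq> patch k \<Longrightarrow> chart_smooth E k U f \<Longrightarrow> chart_smooth E k U g \<Longrightarrow> chart_smooth E k U (\<lambda>x. f x + g x)"
  unfolding chart_smooth_def by (rule smooth_on_add[OF eopen_image])

lemma chart_smooth_mult: "k \<in> \<K> \<Longrightarrow> open U \<Longrightarrow> U \<subseteq> patch k \<Longrightarrow> chart_smooth E k U f \<Longrightarrow> chart_smooth E k U g \<Longrightarrow> chart_smooth E k U (\<lambda>x. f x * g x)"
  unfolding chart_smooth_def by (rule smooth_on_mult[OF eopen_image])

lemma chart_smooth_sum: "k \<in> \<K> \<Longrightarrow> open U \<Longrightarrow> U \<subseteq> patch k \<Longrightarrow> (\<And>i. i \<in> I \<Longrightarrow> chart_smooth E k U (f i)) \<Longrightarrow>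
   chart_smooth E k U (\<lambda>x. \<Sum>i\<in>I. f i x)"
  by (induction I rule: infinite_finite_induct) (auto intro: chart_smooth_const chart_smooth_add)

lemma dq_cong:
  assumes "k \<in> \<K>" "open U" "U \<subseteq> patch k" "m \<in> U" "l < n" "\<And>x. x \<in> U \<Longrightarrow> f x = g x"
  shows "dq k l f m = dq k l g m"
proof -
  have "\<forall>\<^sub>F t in nhds (q_coord k m l). f (coord_curve k m l t) = g (coord_curve k m l t)"
    using coord_curve_eventually[OF assms(1-5)] by (rule eventually_mono) (rule assms(6))
  thus ?thesis unfolding dq_def partial_deriv_def coord_curve_def by (intro deriv_cong_ev) auto
qed

lemma dq_on_chart:
  assumes "k \<in> \<K>" "U \<subseteq> patch k" "x \<in> q_coord k ` U"
  shows "dq k l f (inv_into (patch k) (q_coord k) x) =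
    partial_deriv l (\<lambda>x. f (inv_into (patch k) (q_coord k) x)) x"
  using assms inv_q by (auto simp: dq_def)

lemma chart_smooth_dq:
  assumes "k \<in> \<K>" "open U" "U \<subseteq> patch k" "l < n" "chart_smooth E k U f"
  shows "chart_smooth E k U (dq k l f)"
  unfolding chart_smooth_def
  by (rule smooth_on_cong[OF eopen_image[OF assms(1-3)] _ smooth_on_partial[OF assms(5)[unfolded chart_smooth_def] assms(4)]])
     (simp add: dq_on_chart[OF assms(1,3)])

lemma dq_commute:
  assumes "k \<in> \<K>" "open U" "U \<subseteq> patch k" "m \<in> U" "i < n" "j < n" "chart_smooth E k U f"
  shows "dq k i (dq k j f) m = dq k j (dq k i f) m"
proof -
  let ?f = "\<lambda>x. f (inv_into (patch k) (q_coord k) x)"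
  have *: "dq k a (dq k b f) m = partial_deriv a (partial_deriv b ?f) (q_coord k m)" if "a < n" for a b
    unfolding dq_def[of k a]
    by (rule partial_deriv_cong[OF eopen_image[OF assms(1-3)]])
       (use assms(4) that dq_on_chart[OF assms(1,3)] in auto)
  show ?thesis unfolding *[OF assms(5)] *[OF assms(6)]
    by (rule partial_deriv_commute[OF eopen_image[OF assms(1-3)] assms(7)[unfolded chart_smooth_def]])
       (use assms in auto)
qed

lemma chart_smooth_smooth_fun:
  assumes "k \<in> \<K>" "smooth_fun E U f"
  shows "chart_smooth E k (U \<inter> patch k) f"
  using assms(2) coord_systemsD(1)[OF assms(1)] unfolding smooth_fun_def chart_smooth_def by blast

lemma chart_smooth_transition:
  assumes "k \<in> \<K>" "k' \<in> \<K>" "j < n"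
  shows "chart_smooth E k (patch k \<inter> patch k') (\<lambda>x. q_coord k' x j)"
  using charts_compatible[OF coord_systemsD(1)[OF assms(1)] coord_systemsD(1)[OF assms(2)]] assms(3)
  by (simp add: smooth_transition_def chart_smooth_def)

lemma q_self_deriv:
  assumes "k \<in> \<K>" "m \<in> patch k" "l < n"
  shows "dq k l (\<lambda>x. q_coord k x s) m = (if s = l then 1 else 0)"
proof (rule dq_eqI)
  have h: "\<forall>\<^sub>F t in nhds (q_coord k m l). (if s = l then t else q_coord k m s) = q_coord k (coord_curve k m l t) s"
  proof (rule eventually_mono[OF eopen_line[OF chart_props(2)[OF assms(1)] _ assms(3)]])
    fix t assume "(q_coord k m)(l := t) \<in> q_coord k ` patch k"
    hence "q_coord k (coord_curve k m l t) = (q_coord k m)(l := t)"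
      unfolding coord_curve_def by (rule f_inv_into_f)
    thus "(if s = l then t else q_coord k m s) = q_coord k (coord_curve k m l t) s" by simp
  qed (use assms in auto)
  have "((\<lambda>t. if s = l then t else q_coord k m s) has_real_derivative (if s = l then 1 else 0)) (at (q_coord k m l))"
    by (cases "s = l") auto
  thus "((\<lambda>t. q_coord k (coord_curve k m l t) s) has_real_derivative (if s = l then 1 else 0)) (at (q_coord k m l))"
    by (rule DERIV_cong_ev[OF refl h refl, THEN iffD1])
qed

text \<open>
The chain rule for the change of base coordinates. It also asserts differentiability along the
coordinate lines of \<open>k'\<close>, so that smoothness has to be known in the single chart \<open>k\<close> only.
\<close>

lemma chart_chain:
  assumes k: "k \<in> \<K>" "k' \<in> \<K>" and U: "open U" "U \<subseteq> patch k \<inter> patch k'" and m: "m \<in> U" and l: "l < n"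
    and f: "chart_smooth E k U f"
  shows "((\<lambda>t. f (coord_curve k' m l t)) has_real_derivative
     (\<Sum>s<n. dq k' l (\<lambda>x. q_coord k x s) m * dq k s f m)) (at (q_coord k' m l))"
proof -
  let ?g = "\<lambda>t. q_coord k (coord_curve k' m l t)" and ?t = "q_coord k' m l"
  have Uk: "U \<subseteq> patch k" "U \<subseteq> patch k'" "m \<in> patch k" "m \<in> patch k'" using U m by auto
  have g0: "?g ?t = q_coord k m" by (simp add: coord_curve_self k Uk)
  have ev: "\<forall>\<^sub>F t in nhds ?t. coord_curve k' m l t \<in> U" by (rule coord_curve_eventually[OF k(2) U(1) Uk(2) m l])
  have "((\<lambda>t. f (inv_into (patch k) (q_coord k) (?g t))) has_real_derivative
    (\<Sum>i<n. dq k' l (\<lambda>x. q_coord k x i) m *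
       partial_deriv i (\<lambda>x. f (inv_into (patch k) (q_coord k) x)) (?g ?t))) (at ?t)"
  proof (rule chain_rule_path[OF eopen_image[OF k(1) U(1) Uk(1)] f[unfolded chart_smooth_def]])
    show "?g ?t \<in> q_coord k ` U" unfolding g0 using m by simp
    show "\<forall>\<^sub>F t in at ?t. \<forall>i\<ge>n. ?g t i = 0"
      unfolding eventually_at_filter using ev
    proof (rule eventually_mono, intro impI)
      fix t assume "coord_curve k' m l t \<in> U"
      hence "?g t \<in> q_coord k ` U" by simp
      thus "\<forall>i\<ge>n. ?g t i = 0" using eopen_zero[OF eopen_image[OF k(1) U(1) Uk(1)]] by blast
    qed
    fix i assume i: "i < n"
    show "((\<lambda>t. ?g t i) has_real_derivative dq k' l (\<lambda>x. q_coord k x i) m) (at ?t)"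
      by (rule chart_smooth_deriv[OF k(2) _ _ l chart_smooth_transition[OF k(2,1) i]]) (use Uk in auto)
  qed
  hence "((\<lambda>t. f (inv_into (patch k) (q_coord k) (?g t))) has_real_derivative
    (\<Sum>i<n. dq k' l (\<lambda>x. q_coord k x i) m * dq k i f m)) (at ?t)"
    unfolding g0 dq_def[of k] by simp
  moreover have "\<forall>\<^sub>F t in nhds ?t. f (inv_into (patch k) (q_coord k) (?g t)) = f (coord_curve k' m l t)"
    using ev by (rule eventually_mono) (use inv_q[OF k(1)] Uk in auto)
  ultimately show ?thesis by (rule DERIV_cong_ev[OF refl _ refl, THEN iffD1, rotated])
qed

lemma jacobian_inverse:
  assumes k: "k \<in> \<K>" "k' \<in> \<K>" and m: "m \<in> patch k" "m \<in> patch k'" and i: "i < n" "s < n"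
  shows "(\<Sum>l<n. dq k i (\<lambda>x. q_coord k' x l) m * dq k' l (\<lambda>x. q_coord k x s) m) = (if s = i then 1 else 0)"
proof -
  have "chart_smooth E k' (patch k \<inter> patch k') (\<lambda>x. q_coord k x s)"
    using chart_smooth_transition[OF k(2,1) i(2)] by (simp add: Int_commute)
  from chart_chain[OF k(2,1) _ _ _ i(1) this, of m, THEN dq_eqI] m k
  have "dq k i (\<lambda>x. q_coord k x s) m = (\<Sum>l<n. dq k i (\<lambda>x. q_coord k' x l) m * dq k' l (\<lambda>x. q_coord k x s) m)"
    using chart_props(1) by (auto intro: open_Int)
  thus ?thesis using q_self_deriv[OF k(1) m(1) i(1)] by simp
qed

end

section \<open>Frames and Gram matrices\<close>

context metric_bundle
begin

text \<open>
The basis of the fibre over \<open>m\<close> given by the frame \<open>e\<close>.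
\<close>

definition frame_set :: "(nat \<Rightarrow> 'a \<Rightarrow> 'b) \<Rightarrow> 'a \<Rightarrow> 'b set" where "frame_set e m = (\<lambda>a. e a m) ` {..<r}"

lemma frame_props:
  assumes "(U, e) \<in> frames E" "m \<in> U"
  shows "inj_on (\<lambda>a. e a m) {..<r}" "independent (frame_set e m)" "span (frame_set e m) = fibre E m" "finite (frame_set e m)"
  using frame[OF assms(1)] assms(2) unfolding frame_on_def frame_set_def by auto

lemma frame_in_fibre: "(U, e) \<in> frames E \<Longrightarrow> m \<in> U \<Longrightarrow> a < r \<Longrightarrow> e a m \<in> fibre E m"
  using frame_props(3)[of U e m] by (auto simp: frame_set_def intro: span_base)

lemma fibre_subspace: "subspace (fibre E m)"
proof -
  obtain U e where "(U, e) \<in> frames E" "m \<in> U" using frames_cover[of m] by auto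
  thus ?thesis using frame_props(3) by (metis subspace_span)
qed

lemma comp_expand:
  assumes "(U, e) \<in> frames E" "m \<in> U" "v \<in> fibre E m"
  shows "(\<Sum>a<r. component E e m v a *\<^sub>R e a m) = v"
proof -
  have "(\<Sum>b\<in>frame_set e m. representation (frame_set e m) v b *\<^sub>R b) = v"
    using frame_props[OF assms(1,2)] assms(3) by (intro sum_representation_eq) auto
  thus ?thesis unfolding component_def
    by (simp add: frame_set_def sum.reindex[OF frame_props(1)[OF assms(1,2)]])
qed

lemma comp_sum:
  assumes "(U, e) \<in> frames E" "m \<in> U" "b < r"
  shows "component E e m (\<Sum>a<r. c a *\<^sub>R e a m) b = c b"
proof -
  note fp = frame_props[OF assms(1,2)]
  have sp: "e a m \<in> span (frame_set e m)" if "a < r" for a using that by (auto simp: frame_set_def intro: span_base)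
  have "component E e m (\<Sum>a<r. c a *\<^sub>R e a m) b = (\<Sum>a<r. c a * representation (frame_set e m) (e a m) (e b m))"
    unfolding component_def frame_set_def[symmetric]
    by (subst representation_sum[OF fp(2)]) (auto simp: representation_scale[OF fp(2) sp] intro: span_scale sp)
  also have "\<dots> = (\<Sum>a<r. if a = b then c a else 0)"
  proof (rule sum.cong[OF refl])
    fix a assume "a \<in> {..<r}"
    hence "e a m \<in> frame_set e m" "e a m = e b m \<longleftrightarrow> a = b" using fp(1) assms(3) by (auto simp: frame_set_def inj_on_def)
    thus "c a * representation (frame_set e m) (e a m) (e b m) = (if a = b then c a else 0)"
      using representation_basis[OF fp(2), of "e a m"] by auto
  qed
  finally show ?thesis using assms(3) by simp
qed

lemma form_sum_left:
  assumes "\<And>x. x \<in> X \<Longrightarrow> v x \<in> fibre E m" "w \<in> fibre E m"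
  shows "form E m (\<Sum>x\<in>X. c x *\<^sub>R v x) w = (\<Sum>x\<in>X. c x * form E m (v x) w)"
  using assms(1)
proof (induction X rule: infinite_finite_induct)
  case (insert x X)
  have "(\<Sum>x\<in>X. c x *\<^sub>R v x) \<in> fibre E m" using insert.prems
    by (intro subspace_sum subspace_scale fibre_subspace) auto
  moreover have "c x *\<^sub>R v x \<in> fibre E m" using insert.prems by (intro subspace_scale fibre_subspace) auto
  ultimately show ?case using insert assms(2) by (simp add: form_add form_scale)
next
  case (infinite A)
  have "form E m (0 *\<^sub>R 0) w = 0"
    by (subst form_scale) (use assms(2) subspace_0[OF fibre_subspace] in auto)
  thus ?case using infinite by simp
next
  case empty
  have "form E m (0 *\<^sub>R 0) w = 0"
    by (subst form_scale) (use assms(2) subspace_0[OF fibre_subspace] in auto)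
  thus ?case by simp
qed

lemma form_sum_right:
  assumes "\<And>x. x \<in> X \<Longrightarrow> v x \<in> fibre E m" "w \<in> fibre E m"
  shows "form E m w (\<Sum>x\<in>X. c x *\<^sub>R v x) = (\<Sum>x\<in>X. c x * form E m w (v x))"
proof -
  have "(\<Sum>x\<in>X. c x *\<^sub>R v x) \<in> fibre E m" using assms
    by (intro subspace_sum subspace_scale fibre_subspace) auto
  thus ?thesis using form_sum_left[of X v m w c] assms by (simp add: form_sym cong: sum.cong)
qed

lemma gram_sym: "k \<in> \<K> \<Longrightarrow> m \<in> patch k \<Longrightarrow> a < r \<Longrightarrow> b < r \<Longrightarrow> gram E k m a b = gram E k m b a"
  unfolding gram_def by (rule form_sym) (auto intro: frame_in_fibre[OF coord_systemsD(2)])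

lemma gram_tp: "k \<in> \<K> \<Longrightarrow> m \<in> patch k \<Longrightarrow> mat_tp (mat_trunc r (gram E k m)) = mat_trunc r (gram E k m)"
  by (auto simp: mat_tp_def mat_trunc_def fun_eq_iff gram_sym)

text \<open>
The vectors \<open>\<psi> a = \<Sum> g\<^sub>a\<^sub>b e\<^sub>b\<close> are linearly independent because the form is non-degenerate. Being \<open>r\<close> in number
they span the fibre, and the coefficients of the \<open>e\<^sub>a\<close> in terms of them form a left inverse of \<open>g\<close>.
\<close>

lemma gram_left_inverse_ex:
  assumes k: "k \<in> \<K>" "m \<in> patch k"
  shows "\<exists>h. mat_mult r h (gram E k m) = mat_one r"
proof -
  let ?e = "e_frame k" and ?g = "gram E k m"
  note fr = coord_systemsD(2)[OF k(1)]
  note fp = frame_props[OF fr k(2)]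
  note ef = frame_in_fibre[OF fr k(2)]
  define \<psi> where "\<psi> a = (\<Sum>b<r. ?g a b *\<^sub>R ?e b m)" for a
  have zero: "c a = 0" if "(\<Sum>a<r. c a *\<^sub>R \<psi> a) = 0" "a < r" for c a
  proof -
    have "(\<Sum>a<r. c a *\<^sub>R \<psi> a) = (\<Sum>b<r. (\<Sum>a<r. c a * ?g a b) *\<^sub>R ?e b m)"
      unfolding \<psi>_def scaleR_sum_right scaleR_sum_left scaleR_scaleR by (rule sum.swap)
    hence z: "(\<Sum>b<r. (\<Sum>a<r. c a * ?g a b) *\<^sub>R ?e b m) = 0" using that by simp
    have gz: "(\<Sum>a<r. c a * ?g a b) = 0" if "b < r" for b
      using comp_sum[OF fr k(2) that, of "\<lambda>b. \<Sum>a<r. c a * ?g a b"] comp_sum[OF fr k(2) that, of "\<lambda>b. 0"] z by simp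
    let ?u = "\<Sum>a<r. c a *\<^sub>R ?e a m"
    have u: "?u \<in> fibre E m" using ef by (intro subspace_sum subspace_scale fibre_subspace) auto
    have "?u = 0"
    proof (rule form_nondegenerate[OF u])
      fix v assume v: "v \<in> fibre E m"
      have "form E m ?u v = form E m ?u (\<Sum>b<r. component E ?e m v b *\<^sub>R ?e b m)"
        using comp_expand[OF fr k(2) v] by simp
      also have "\<dots> = (\<Sum>b<r. component E ?e m v b * form E m ?u (?e b m))"
        using u ef by (intro form_sum_right) auto
      also have "\<dots> = (\<Sum>b<r. component E ?e m v b * (\<Sum>a<r. c a * ?g a b))"
      proof (intro sum.cong refl)
        fix b assume "b \<in> {..<r}"
        hence "form E m ?u (?e b m) = (\<Sum>a<r. c a * ?g a b)"
          unfolding gram_def by (intro form_sum_left ef) auto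
        thus "component E ?e m v b * form E m ?u (?e b m) = component E ?e m v b * (\<Sum>a<r. c a * ?g a b)" by simp
      qed
      finally show "form E m ?u v = 0" using gz by simp
    qed
    thus "c a = 0" using comp_sum[OF fr k(2) that(2), of c] comp_sum[OF fr k(2) that(2), of "\<lambda>b. 0"] by simp
  qed
  have inj: "inj_on \<psi> {..<r}"
  proof (rule inj_onI, rule ccontr)
    fix a b assume ab: "a \<in> {..<r}" "b \<in> {..<r}" "\<psi> a = \<psi> b" "a \<noteq> b"
    let ?c = "\<lambda>i. (if i = a then 1 else 0) - (if i = b then 1 else (0::real))"
    have "(\<Sum>i<r. ?c i *\<^sub>R \<psi> i) = (\<Sum>i<r. if i = a then \<psi> i else 0) - (\<Sum>i<r. if i = b then \<psi> i else 0)"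
      unfolding sum_subtractf[symmetric] by (rule sum.cong) auto
    also have "\<dots> = 0" using ab by simp
    finally have "?c a = 0" using zero[of ?c a] ab by blast
    thus False using ab by simp
  qed
  have indep: "independent (\<psi> ` {..<r})"
  proof (rule independent_if_scalars_zero)
    fix f x assume s: "(\<Sum>x\<in>\<psi> ` {..<r}. f x *\<^sub>R x) = 0" and x: "x \<in> \<psi> ` {..<r}"
    have "(\<Sum>a<r. f (\<psi> a) *\<^sub>R \<psi> a) = 0" using s by (simp add: sum.reindex[OF inj])
    from zero[of "\<lambda>a. f (\<psi> a)", OF this] x show "f x = 0" by auto
  qed simp
  have sub: "\<psi> ` {..<r} \<subseteq> span (frame_set ?e m)" unfolding fp(3) \<psi>_def
    using ef by (auto intro!: subspace_sum subspace_scale fibre_subspace)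
  have span: "?e a m \<in> span (\<psi> ` {..<r})" if a: "a < r" for a
  proof (rule ccontr)
    assume n: "?e a m \<notin> span (\<psi> ` {..<r})"
    hence "independent (insert (?e a m) (\<psi> ` {..<r}))" using indep by (rule independent_insertI)
    moreover have "insert (?e a m) (\<psi> ` {..<r}) \<subseteq> span (frame_set ?e m)" using sub ef[OF a] fp(3) by simp
    ultimately have "card (insert (?e a m) (\<psi> ` {..<r})) \<le> card (frame_set ?e m)"
      using independent_span_bound[OF fp(4)] by blast
    moreover have "?e a m \<notin> \<psi> ` {..<r}" using n span_base[of "?e a m" "\<psi> ` {..<r}"] by blast
    ultimately show False using inj fp(1) by (simp add: frame_set_def card_image)
  qed
  have "\<exists>c. ?e a m = (\<Sum>b<r. c b *\<^sub>R \<psi> b)" if "a < r" for a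
  proof -
    have "?e a m \<in> span (\<psi> ` {..<r})" using span[OF that] .
    then obtain u where "(\<Sum>v\<in>\<psi> ` {..<r}. u v *\<^sub>R v) = ?e a m"
      using span_finite[of "\<psi> ` {..<r}"] by (auto simp: image_def)
    thus ?thesis by (intro exI[of _ "\<lambda>b. u (\<psi> b)"]) (simp add: sum.reindex[OF inj])
  qed
  hence "\<forall>a. \<exists>c. a < r \<longrightarrow> ?e a m = (\<Sum>b<r. c b *\<^sub>R \<psi> b)" by blast
  then obtain h where h: "\<And>a. a < r \<Longrightarrow> ?e a m = (\<Sum>b<r. h a b *\<^sub>R \<psi> b)" by metis
  have "mat_mult r h ?g a c = mat_one r a c" for a c
  proof (cases "a < r \<and> c < r")
    case True
    have "(\<Sum>b<r. h a b *\<^sub>R \<psi> b) = (\<Sum>c<r. (\<Sum>b<r. h a b * ?g b c) *\<^sub>R ?e c m)"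
      unfolding \<psi>_def scaleR_sum_right scaleR_sum_left scaleR_scaleR by (rule sum.swap)
    hence "(\<Sum>b<r. h a b * ?g b c) = component E ?e m (?e a m) c"
      using comp_sum[OF fr k(2), of c "\<lambda>c. \<Sum>b<r. h a b * ?g b c"] h[of a] True by simp
    also have "?e a m = (\<Sum>b<r. mat_one r a b *\<^sub>R ?e b m)"
      using True by (simp add: mat_one_def if_distrib[of "\<lambda>x. x *\<^sub>R _"] cong: if_cong)
    also have "component E ?e m \<dots> c = mat_one r a c" using comp_sum[OF fr k(2)] True by blast
    finally show ?thesis using True by (simp add: mat_mult_def)
  qed (auto simp: mat_mult_def mat_one_def)
  thus ?thesis by blast
qed

lemma inverse_gram:
  assumes k: "k \<in> \<K>" "m \<in> patch k"
  defines "h \<equiv> inverse_matrix r (gram E k m)"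
  shows "mat_mult r h (gram E k m) = mat_one r" "mat_mult r (gram E k m) h = mat_one r" "mat_tp h = h" "mat_trunc r h = h"
    "\<And>X. mat_mult r X (gram E k m) = mat_one r \<Longrightarrow> mat_trunc r X = h"
proof -
  let ?g = "gram E k m"
  obtain h0 where h0: "mat_mult r h0 ?g = mat_one r" using gram_left_inverse_ex[OF k] by blast
  have gt: "mat_mult r ?g (mat_tp h0) = mat_one r"
    using arg_cong[OF h0, of mat_tp] gram_tp[OF k] by (simp add: mat_tp_mat_mult) (metis mat_mult_trunc(1) mat_tp_trunc)
  have uniq: "mat_trunc r X = mat_trunc r (mat_tp h0)" if "mat_mult r X ?g = mat_one r" for X
  proof -
    have "mat_trunc r X = mat_mult r X (mat_mult r ?g (mat_tp h0))" by (simp add: gt)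
    also have "\<dots> = mat_trunc r (mat_tp h0)" unfolding mat_mult_assoc[symmetric] that by simp
    finally show ?thesis .
  qed
  have P: "((\<forall>a b. a \<ge> r \<or> b \<ge> r \<longrightarrow> h' a b = 0) \<and>
     (\<forall>a<r. \<forall>c<r. (\<Sum>b<r. h' a b * ?g b c) = (if a = c then 1 else 0))) \<longleftrightarrow>
    mat_trunc r h' = h' \<and> mat_mult r h' ?g = mat_one r" for h'
  proof -
    have "(\<forall>a b. a \<ge> r \<or> b \<ge> r \<longrightarrow> h' a b = 0) \<longleftrightarrow> mat_trunc r h' = h'"
      by (auto simp: mat_trunc_def fun_eq_iff)
    moreover have "(\<forall>a<r. \<forall>c<r. (\<Sum>b<r. h' a b * ?g b c) = (if a = c then 1 else 0)) \<longleftrightarrow> mat_mult r h' ?g = mat_one r"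
      by (auto simp: mat_mult_def mat_one_def fun_eq_iff)
    ultimately show ?thesis by simp
  qed
  have "h = mat_trunc r h0" unfolding h_def inverse_matrix_def P
  proof (rule the_equality)
    show "mat_trunc r (mat_trunc r h0) = mat_trunc r h0 \<and> mat_mult r (mat_trunc r h0) ?g = mat_one r" using h0 by simp
    fix h' assume "mat_trunc r h' = h' \<and> mat_mult r h' ?g = mat_one r"
    thus "h' = mat_trunc r h0" using uniq[of h'] uniq[OF h0] by simp
  qed
  note hh = this
  show "mat_mult r h ?g = mat_one r" "mat_trunc r h = h" unfolding hh using h0 by simp_all
  show "mat_mult r ?g h = mat_one r" unfolding hh uniq[OF h0] using gt by simp
  show "mat_tp h = h" unfolding hh mat_tp_trunc by (rule uniq[OF h0, symmetric])
  show "mat_trunc r X = h" if "mat_mult r X ?g = mat_one r" for X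
    unfolding hh using uniq[OF that] uniq[OF h0] by simp
qed

lemma inverse_gram_const:
  assumes "k \<in> \<K>" "x \<in> patch k" "y \<in> patch k"
  shows "inverse_matrix r (gram E k x) = inverse_matrix r (gram E k y)"
proof -
  have "mat_mult r X (gram E k x) = mat_mult r X (gram E k y)" for X
    using coord_systemsD(3)[OF assms(1) _ _ assms(2,3)] by (intro mat_mult_cong) auto
  hence "mat_trunc r (inverse_matrix r (gram E k x)) = inverse_matrix r (gram E k y)"
    using inverse_gram(1)[OF assms(1,2)] inverse_gram(5)[OF assms(1,3)] by metis
  thus ?thesis using inverse_gram(4)[OF assms(1,2)] by simp
qed

end

section \<open>The Poisson algebra in one coordinate system\<close>

text \<open>
The coefficientwise derivative in the \<open>l\<close>-th base coordinate of \<open>k\<close>.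
\<close>

definition Dq :: "('m, 'v) coords \<Rightarrow> nat \<Rightarrow> ('m \<Rightarrow> spoly) \<Rightarrow> 'm \<Rightarrow> spoly" where
  "Dq k l F m = Spoly (\<lambda>S K. dq k l (\<lambda>x. coef (F x) S K) m)"

lemma Dq_eqI:
  assumes "has_sderiv (q_coord k m l) (\<lambda>t. F (coord_curve k m l t)) D"
  shows "Dq k l F m = D"
proof -
  have "dq k l (\<lambda>x. coef (F x) S K) m = coef D S K" for S K
    by (rule dq_eqI) (use assms in \<open>simp add: has_sderiv_def\<close>)
  thus ?thesis by (simp add: Dq_def coef_inverse)
qed

text \<open>
One index type for the coordinates \<open>q\<^sup>i\<close>, \<open>p\<^sub>i\<close> and \<open>\<tau>\<^sup>a\<close>; \<open>idx_sign\<close> is -1 for the odd ones, \<open>omega h\<close> is the matrix of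
their brackets when \<open>{\<tau>\<^sup>a, \<tau>\<^sup>b} = h a b\<close>, and \<open>Lderiv\<close> is the left derivative.
\<close>

datatype idx = IQ nat | IP nat | IT nat

primrec idx_sign :: "idx \<Rightarrow> real" where
  "idx_sign (IQ i) = 1" | "idx_sign (IP i) = 1" | "idx_sign (IT a) = - 1"

fun omega :: "(nat \<Rightarrow> nat \<Rightarrow> real) \<Rightarrow> idx \<Rightarrow> idx \<Rightarrow> real" where
  "omega h (IQ i) (IP j) = (if i = j then 1 else 0)"
| "omega h (IP i) (IQ j) = (if i = j then - 1 else 0)"
| "omega h (IT a) (IT b) = h a b"
| "omega h _ _ = 0"

definition Lderiv :: "('m, 'v) coords \<Rightarrow> idx \<Rightarrow> ('m \<Rightarrow> spoly) \<Rightarrow> 'm \<Rightarrow> spoly" where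
  "Lderiv k I F x = (case I of IQ i \<Rightarrow> Dq k i F x | IP i \<Rightarrow> Dp i (F x) | IT a \<Rightarrow> D\<tau> a (F x))"

lemma Lderiv_simps [simp]: "Lderiv k (IQ i) F x = Dq k i F x" "Lderiv k (IP i) F x = Dp i (F x)" "Lderiv k (IT a) F x = D\<tau> a (F x)"
  by (simp_all add: Lderiv_def)

lemma omega_sym: "mat_tp h = h \<Longrightarrow> omega h J I = - idx_sign I * omega h I J"
  by (cases I; cases J) (auto simp: mat_tp_def fun_eq_iff)

lemma omega_par: "omega h I J \<noteq> 0 \<Longrightarrow> idx_sign I = idx_sign J"
  by (cases I; cases J) auto

lemma idx_sign_cases: "idx_sign I = 1 \<or> idx_sign I = - 1" by (cases I) auto

context metric_bundle
begin

text \<open>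
The coordinates that are actually present.
\<close>

definition indices :: "idx set" where "indices = IQ ` {..<n} \<union> IP ` {..<n} \<union> IT ` {..<r}"

text \<open>
The local formula for the bracket, where the matrix \<open>h\<close> of the \<open>{\<tau>\<^sup>a, \<tau>\<^sup>b}\<close> is an explicit constant; \<open>eps \<circ> D\<tau>\<close> is the right derivative.
\<close>

definition pbracket :: "('m, 'v) coords \<Rightarrow> (nat \<Rightarrow> nat \<Rightarrow> real) \<Rightarrow> ('m \<Rightarrow> spoly) \<Rightarrow> ('m \<Rightarrow> spoly) \<Rightarrow> 'm \<Rightarrow> spoly" where
  "pbracket k h F G x = (\<Sum>s<n. Dq k s F x * Dp s (G x) - Dp s (F x) * Dq k s G x) +
     (\<Sum>a<r. \<Sum>b<r. h a b *\<^sub>R (eps (D\<tau> a (F x)) * D\<tau> b (G x)))"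

lemma sum_indices:
  fixes f :: "idx \<Rightarrow> 'c::comm_monoid_add"
  shows "sum f indices = (\<Sum>i<n. f (IQ i)) + (\<Sum>i<n. f (IP i)) + (\<Sum>a<r. f (IT a))"
proof -
  have "sum f indices = sum f (IQ ` {..<n}) + sum f (IP ` {..<n}) + sum f (IT ` {..<r})"
    unfolding indices_def by (subst sum.union_disjoint, (auto)[3])+ auto
  thus ?thesis by (simp add: sum.reindex inj_on_def)
qed

lemma sum_omega:
  "(\<Sum>I\<in>indices. \<Sum>J\<in>indices. (omega h I J * c I) *\<^sub>R (f I * g J :: spoly)) =
   (\<Sum>s<n. c (IQ s) *\<^sub>R (f (IQ s) * g (IP s)) - c (IP s) *\<^sub>R (f (IP s) * g (IQ s))) + (\<Sum>a<r. \<Sum>b<r. (h a b * c (IT a)) *\<^sub>R (f (IT a) * g (IT b)))"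
proof -
  have 1: "(\<Sum>J\<in>indices. (omega h (IQ s) J * c (IQ s)) *\<^sub>R (f (IQ s) * g J)) = c (IQ s) *\<^sub>R (f (IQ s) * g (IP s))" if "s < n" for s
  proof -
    have "(\<Sum>i<n. (omega h (IQ s) (IP i) * c (IQ s)) *\<^sub>R (f (IQ s) * g (IP i))) =
       (\<Sum>i<n. if i = s then c (IQ s) *\<^sub>R (f (IQ s) * g (IP s)) else 0)" by (rule sum.cong) auto
    thus ?thesis using that by (simp add: sum_indices)
  qed
  have 2: "(\<Sum>J\<in>indices. (omega h (IP s) J * c (IP s)) *\<^sub>R (f (IP s) * g J)) = - (c (IP s) *\<^sub>R (f (IP s) * g (IQ s)))" if "s < n" for s
  proof -
    have "(\<Sum>i<n. (omega h (IP s) (IQ i) * c (IP s)) *\<^sub>R (f (IP s) * g (IQ i))) =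
       (\<Sum>i<n. if i = s then - (c (IP s) *\<^sub>R (f (IP s) * g (IQ s))) else 0)" by (rule sum.cong) auto
    thus ?thesis using that by (simp add: sum_indices)
  qed
  have 3: "(\<Sum>J\<in>indices. (omega h (IT a) J * c (IT a)) *\<^sub>R (f (IT a) * g J)) = (\<Sum>b<r. (h a b * c (IT a)) *\<^sub>R (f (IT a) * g (IT b)))" for a
    by (simp add: sum_indices)
  show ?thesis unfolding sum_indices[of "\<lambda>I. \<Sum>J\<in>indices. (omega h I J * c I) *\<^sub>R (f I * g J)"] 3
    by (simp add: 1 2 sum_subtractf sum_negf)
qed

lemma pbracket_odd:
  assumes "eps (F x) = - F x"
  shows "pbracket k h F G x = (\<Sum>I\<in>indices. \<Sum>J\<in>indices. omega h I J *\<^sub>R (Lderiv k I F x * Lderiv k J G x))"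
  using sum_omega[of h "\<lambda>_. 1" "\<lambda>I. Lderiv k I F x" "\<lambda>J. Lderiv k J G x"]
  by (simp add: pbracket_def eps_D\<tau> assms)

lemma pbracket_even:
  assumes "eps (F x) = F x"
  shows "pbracket k h F G x = (\<Sum>I\<in>indices. \<Sum>J\<in>indices. (omega h I J * idx_sign I) *\<^sub>R (Lderiv k I F x * Lderiv k J G x))"
  using sum_omega[of h idx_sign "\<lambda>I. Lderiv k I F x" "\<lambda>J. Lderiv k J G x"]
  by (simp add: pbracket_def eps_D\<tau> assms sum_negf)

text \<open>
\<open>F\<close> is homogeneous of degree \<open>d\<close> with smooth coefficients on the subset \<open>U\<close> of the domain of \<open>k\<close>.
\<close>

definition smooth_homog :: "('m, 'v) coords \<Rightarrow> 'm set \<Rightarrow> nat \<Rightarrow> ('m \<Rightarrow> spoly) \<Rightarrow> bool" where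
  "smooth_homog k U d F \<longleftrightarrow> (\<forall>x\<in>U. homog r n d (F x)) \<and> (\<forall>S K. chart_smooth E k U (\<lambda>x. coef (F x) S K))"

lemma smooth_homog_homog: "smooth_homog k U d F \<Longrightarrow> x \<in> U \<Longrightarrow> homog r n d (F x)" by (simp add: smooth_homog_def)

lemma smooth_homog_coef: "smooth_homog k U d F \<Longrightarrow> chart_smooth E k U (\<lambda>x. coef (F x) S K)" by (simp add: smooth_homog_def)

lemma smooth_homogI: "(\<And>x. x \<in> U \<Longrightarrow> homog r n d (F x)) \<Longrightarrow> (\<And>S K. chart_smooth E k U (\<lambda>x. coef (F x) S K)) \<Longrightarrow> smooth_homog k U d F"
  by (simp add: smooth_homog_def)

lemma smooth_homog_subset: "smooth_homog k U d F \<Longrightarrow> V \<subseteq> U \<Longrightarrow> smooth_homog k V d F"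
  by (intro smooth_homogI) (auto intro: smooth_homog_homog chart_smooth_subset[OF smooth_homog_coef])

lemma smooth_homog_parity: "smooth_homog k U d F \<Longrightarrow> x \<in> U \<Longrightarrow> eps (F x) = (- 1) ^ d *\<^sub>R F x"
  by (rule homog_eps[OF smooth_homog_homog])

end

text \<open>An open subset \<open>U\<close> of the domain of a coordinate system \<open>k\<close>.\<close>

locale local_coords = metric_bundle E
  for E :: "('m::{t2_space, second_countable_topology}, 'v::real_vector, 'z) metric_bundle_scheme" +
  fixes k :: "('m, 'v) coords" and U :: "'m set"
  assumes k: "k \<in> coord_systems E" and U: "open U" "U \<subseteq> patch k"
begin

lemma smooth_homog_cong:
  assumes "smooth_homog k U d F" "\<And>x. x \<in> U \<Longrightarrow> F x = G x"
  shows "smooth_homog k U d G"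
proof (rule smooth_homogI)
  show "homog r n d (G x)" if "x \<in> U" for x using smooth_homog_homog[OF assms(1) that] assms(2)[OF that] by simp
  show "chart_smooth E k U (\<lambda>x. coef (G x) S K)" for S K
    by (rule chart_smooth_cong[OF k U _ smooth_homog_coef[OF assms(1)]]) (simp add: assms(2))
qed

lemma smooth_homog_zero: "smooth_homog k U d (\<lambda>x. 0)" by (simp add: smooth_homog_def chart_smooth_const)

lemma smooth_homog_add: "smooth_homog k U d F \<Longrightarrow> smooth_homog k U d G \<Longrightarrow> smooth_homog k U d (\<lambda>x. F x + G x)"
  by (rule smooth_homogI) (auto intro: homog_add smooth_homog_homog chart_smooth_add[OF k U] smooth_homog_coef)

lemma smooth_homog_scaleR: "smooth_homog k U d F \<Longrightarrow> smooth_homog k U d (\<lambda>x. c *\<^sub>R F x)"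
  by (rule smooth_homogI) (auto intro: homog_scaleR smooth_homog_homog chart_smooth_mult[OF k U chart_smooth_const] smooth_homog_coef)

lemma smooth_homog_minus: "smooth_homog k U d F \<Longrightarrow> smooth_homog k U d (\<lambda>x. - F x)"
  using smooth_homog_scaleR[of d F "-1"] by simp

lemma smooth_homog_diff: "smooth_homog k U d F \<Longrightarrow> smooth_homog k U d G \<Longrightarrow> smooth_homog k U d (\<lambda>x. F x - G x)"
  using smooth_homog_add[OF _ smooth_homog_minus, of d F G] by simp

lemma smooth_homog_sum: "(\<And>i. i \<in> I \<Longrightarrow> smooth_homog k U d (F i)) \<Longrightarrow> smooth_homog k U d (\<lambda>x. \<Sum>i\<in>I. F i x)"
  by (induction I rule: infinite_finite_induct) (auto intro: smooth_homog_zero smooth_homog_add)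

lemma smooth_homog_mult:
  assumes "smooth_homog k U d F" "smooth_homog k U e G" shows "smooth_homog k U (d + e) (\<lambda>x. F x * G x)"
proof (rule smooth_homogI)
  show "homog r n (d + e) (F x * G x)" if "x \<in> U" for x
    using assms that by (intro homog_mult smooth_homog_homog)
  fix S K
  note smooth_homog_coef[OF assms(1)] smooth_homog_coef[OF assms(2)]
  thus "chart_smooth E k U (\<lambda>x. coef (F x * G x) S K)"
    unfolding coef_mult super_mult_def by (intro chart_smooth_sum chart_smooth_mult chart_smooth_const k U)
qed

lemma smooth_homog_eps: "smooth_homog k U d F \<Longrightarrow> smooth_homog k U d (\<lambda>x. eps (F x))"
  by (rule smooth_homog_cong[OF smooth_homog_scaleR[where c = "(- 1) ^ d"]]) (auto simp: smooth_homog_parity)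

lemma smooth_homog_Dp:
  assumes "smooth_homog k U (d + 2) F" shows "smooth_homog k U d (\<lambda>x. Dp i (F x))"
proof (rule smooth_homogI)
  show "homog r n d (Dp i (F x))" if "x \<in> U" for x
    using assms that by (intro homog_Dp smooth_homog_homog)
  show "chart_smooth E k U (\<lambda>x. coef (Dp i (F x)) S K)" for S K
    unfolding Dp.rep_eq dp_def by (intro chart_smooth_mult[OF k U chart_smooth_const] smooth_homog_coef[OF assms])
qed

lemma smooth_homog_D\<tau>:
  assumes "smooth_homog k U (Suc d) F" shows "smooth_homog k U d (\<lambda>x. D\<tau> c (F x))"
proof (rule smooth_homogI)
  show "homog r n d (D\<tau> c (F x))" if "x \<in> U" for x
    using assms that by (intro homog_D\<tau> smooth_homog_homog)
  show "chart_smooth E k U (\<lambda>x. coef (D\<tau> c (F x)) S K)" for S K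
    unfolding D\<tau>.rep_eq dtau_left_def
    by (cases "c \<in> S") (auto intro: chart_smooth_mult[OF k U chart_smooth_const] chart_smooth_const smooth_homog_coef[OF assms])
qed

lemma smooth_homog_deriv:
  assumes "smooth_homog k U d F" "m \<in> U" "l < n"
  shows "has_sderiv (q_coord k m l) (\<lambda>t. F (coord_curve k m l t)) (Dq k l F m)"
proof -
  let ?D = "\<lambda>S K. dq k l (\<lambda>x. coef (F x) S K) m"
  have z: "?D S K = 0" if "(S, K) \<notin> homset r n d" for S K
  proof -
    have "?D S K = dq k l (\<lambda>x. 0) m"
    proof (rule dq_cong[OF k U assms(2,3)])
      fix x assume "x \<in> U"
      hence "supp (F x) \<subseteq> homset r n d" using smooth_homog_homog[OF assms(1)] by (simp add: homog_homset)
      thus "coef (F x) S K = 0" using that by (auto simp: supp_def)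
    qed
    also have "\<dots> = 0" by (rule dq_eqI) simp
    finally show ?thesis .
  qed
  have sub: "{(S, K). ?D S K \<noteq> 0} \<subseteq> homset r n d" using z by blast
  have "finite S" if "?D S K \<noteq> 0" for S K
    using z[of S K] that homset_finite_fst[of S K r n d] by blast
  with finite_subset[OF sub finite_homset]
  have "finite {(S, K). ?D S K \<noteq> 0} \<and> (\<forall>S K. ?D S K \<noteq> 0 \<longrightarrow> finite S)" by simp
  hence c: "coef (Dq k l F m) S K = ?D S K" for S K
    unfolding Dq_def by (subst Spoly_inverse) auto
  show ?thesis unfolding has_sderiv_def c
    by (intro allI chart_smooth_deriv[OF k U(2) assms(2,3)] smooth_homog_coef[OF assms(1)])
qed

lemma coef_Dq:
  assumes "smooth_homog k U d F" "m \<in> U" "l < n"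
  shows "coef (Dq k l F m) S K = dq k l (\<lambda>x. coef (F x) S K) m"
  using smooth_homog_deriv[OF assms, unfolded has_sderiv_def, rule_format, of S K] by (rule dq_eqI[symmetric])

lemma smooth_homog_Dq:
  assumes "smooth_homog k U d F" "l < n" shows "smooth_homog k U d (Dq k l F)"
proof (rule smooth_homogI)
  fix x assume x: "x \<in> U"
  show "homog r n d (Dq k l F x)"
    by (rule has_sderiv_homog[OF smooth_homog_deriv[OF assms(1) x assms(2)]])
       (rule eventually_mono[OF coord_curve_eventually[OF k U x assms(2)]], rule smooth_homog_homog[OF assms(1)])
next
  fix S K
  show "chart_smooth E k U (\<lambda>x. coef (Dq k l F x) S K)"
    by (rule chart_smooth_cong[OF k U _ chart_smooth_dq[OF k U assms(2) smooth_homog_coef[OF assms(1), of S K]]])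
       (simp add: coef_Dq[OF assms(1) _ assms(2)])
qed

lemma coord_curve_0: "m \<in> U \<Longrightarrow> coord_curve k m l (q_coord k m l) = m"
  using coord_curve_self[OF k] U by auto

lemma Dq_cong:
  assumes "m \<in> U" "l < n" "\<And>x. x \<in> U \<Longrightarrow> F x = G x"
  shows "Dq k l F m = Dq k l G m"
  unfolding Dq_def
proof (intro arg_cong[of _ _ Spoly] ext)
  fix S K show "dq k l (\<lambda>x. coef (F x) S K) m = dq k l (\<lambda>x. coef (G x) S K) m"
    by (rule dq_cong[OF k U assms(1,2)]) (simp add: assms(3))
qed

lemma Dq_Dp: "smooth_homog k U d F \<Longrightarrow> m \<in> U \<Longrightarrow> l < n \<Longrightarrow> Dq k l (\<lambda>x. Dp i (F x)) m = Dp i (Dq k l F m)"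
  by (rule Dq_eqI) (rule has_sderiv_Dp[OF smooth_homog_deriv])

lemma Dq_D\<tau>: "smooth_homog k U d F \<Longrightarrow> m \<in> U \<Longrightarrow> l < n \<Longrightarrow> Dq k l (\<lambda>x. D\<tau> i (F x)) m = D\<tau> i (Dq k l F m)"
  by (rule Dq_eqI) (rule has_sderiv_D\<tau>[OF smooth_homog_deriv])

lemma Dq_eps:
  assumes "smooth_homog k U d F" "m \<in> U" "l < n" shows "eps (Dq k l F m) = (- 1) ^ d *\<^sub>R Dq k l F m"
  using smooth_homog_parity[OF smooth_homog_Dq] assms by blast

lemma Dq_Dq:
  assumes "smooth_homog k U d F" "m \<in> U" "i < n" "j < n"
  shows "Dq k i (Dq k j F) m = Dq k j (Dq k i F) m"
proof (rule coef_inject_ext)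
  fix S K
  have *: "coef (Dq k a (Dq k b F) m) S K = dq k a (dq k b (\<lambda>x. coef (F x) S K)) m" if "a < n" "b < n" for a b
  proof -
    have "coef (Dq k a (Dq k b F) m) S K = dq k a (\<lambda>x. coef (Dq k b F x) S K) m"
      by (rule coef_Dq[OF smooth_homog_Dq[OF assms(1) that(2)] assms(2) that(1)])
    also have "\<dots> = dq k a (dq k b (\<lambda>x. coef (F x) S K)) m"
      by (rule dq_cong[OF k U assms(2) that(1)]) (simp add: coef_Dq[OF assms(1) _ that(2)])
    finally show ?thesis .
  qed
  show "coef (Dq k i (Dq k j F) m) S K = coef (Dq k j (Dq k i F) m) S K"
    unfolding *[OF assms(3,4)] *[OF assms(4,3)]
    by (rule dq_commute[OF k U assms(2-4) smooth_homog_coef[OF assms(1)]])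
qed

lemma smooth_homog_pbracket:
  assumes "smooth_homog k U (d + 2) F" "smooth_homog k U (e + 2) G"
  shows "smooth_homog k U (d + e + 2) (pbracket k h F G)"
proof -
  have "smooth_homog k U ((d + 2) + e) (\<lambda>x. Dq k s F x * Dp s (G x))" if "s < n" for s
    using assms that by (intro smooth_homog_mult smooth_homog_Dq smooth_homog_Dp)
  moreover have "smooth_homog k U (d + (e + 2)) (\<lambda>x. Dp s (F x) * Dq k s G x)" if "s < n" for s
    using assms that by (intro smooth_homog_mult smooth_homog_Dq smooth_homog_Dp)
  moreover have "smooth_homog k U ((d + 1) + (e + 1)) (\<lambda>x. eps (D\<tau> a (F x)) * D\<tau> b (G x))" for a b
    using assms by (intro smooth_homog_mult smooth_homog_eps smooth_homog_D\<tau>) auto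
  ultimately show ?thesis unfolding pbracket_def
    by (intro smooth_homog_add smooth_homog_sum smooth_homog_diff smooth_homog_scaleR) (auto simp: add_ac numeral_2_eq_2)
qed

lemma pbracket_cong:
  assumes "m \<in> U" "\<And>x. x \<in> U \<Longrightarrow> F x = F' x" "\<And>x. x \<in> U \<Longrightarrow> G x = G' x"
  shows "pbracket k h F G m = pbracket k h F' G' m"
  unfolding pbracket_def using assms(2,3)[OF assms(1)] Dq_cong[OF assms(1) _ assms(2)] Dq_cong[OF assms(1) _ assms(3)]
  by (intro arg_cong2[of _ _ _ _ "(+)"] sum.cong) auto

lemma smooth_homog_Lderiv:
  assumes "smooth_homog k U (d + 2) F" "I \<in> indices"
  obtains d' where "smooth_homog k U d' (Lderiv k I F)" "(- 1) ^ d' = (- 1) ^ d * idx_sign I"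
proof (cases I)
  case (IQ i)
  hence "i < n" using assms(2) by (auto simp: indices_def)
  thus ?thesis using that[of "d + 2"] smooth_homog_Dq[OF assms(1)] IQ by (auto simp: Lderiv_def[abs_def])
next
  case (IP i)
  thus ?thesis using that[of d] smooth_homog_Dp[OF assms(1)] by (auto simp: Lderiv_def[abs_def])
next
  case (IT a)
  have "smooth_homog k U (Suc (d + 1)) F" using assms by simp
  thus ?thesis using that[of "d + 1"] smooth_homog_D\<tau> IT by (auto simp: Lderiv_def[abs_def])
qed

lemma eps_Lderiv:
  assumes "smooth_homog k U d F" "I \<in> indices" "m \<in> U"
  shows "eps (Lderiv k I F m) = ((- 1) ^ d * idx_sign I) *\<^sub>R Lderiv k I F m"
  using assms by (cases I) (auto simp: Dq_eps eps_Dp eps_D\<tau> smooth_homog_parity indices_def)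

lemma Lderiv_Lderiv:
  assumes "smooth_homog k U d F" "I \<in> indices" "J \<in> indices" "m \<in> U"
  shows "Lderiv k I (Lderiv k J F) m = (if idx_sign I = - 1 \<and> idx_sign J = - 1 then - 1 else 1) *\<^sub>R Lderiv k J (Lderiv k I F) m"
proof -
  have e: "Lderiv k (IP i) F = (\<lambda>x. Dp i (F x))" "Lderiv k (IT i) F = (\<lambda>x. D\<tau> i (F x))" "Lderiv k (IQ i) F = Dq k i F" for i
    by (auto simp: fun_eq_iff)
  show ?thesis
    using assms by (cases I; cases J)
      (auto simp: e indices_def Dq_Dq Dq_Dp Dq_D\<tau> D\<tau>_Dp Dp_Dp intro: D\<tau>_D\<tau>)
qed

lemma Lderiv_pbracket:
  assumes F: "smooth_homog k U (d + 2) F" and G: "smooth_homog k U (e + 2) G" and d: "odd d" and m: "m \<in> U" and K: "K \<in> indices"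
  shows "Lderiv k K (pbracket k h F G) m = (\<Sum>I\<in>indices. \<Sum>J\<in>indices. omega h I J *\<^sub>R
     (Lderiv k K (Lderiv k I F) m * Lderiv k J G m + (if idx_sign K = - 1 then eps (Lderiv k I F m) else Lderiv k I F m) * Lderiv k K (Lderiv k J G) m))"
proof -
  let ?B = "\<lambda>x. \<Sum>I\<in>indices. \<Sum>J\<in>indices. omega h I J *\<^sub>R (Lderiv k I F x * Lderiv k J G x)"
  have eq: "pbracket k h F G x = ?B x" if "x \<in> U" for x
    by (rule pbracket_odd) (use smooth_homog_parity[OF F that] d in simp)
  show ?thesis
  proof (cases K)
    case (IQ i)
    hence i: "i < n" using K by (auto simp: indices_def)
    have "Dq k i (pbracket k h F G) m = Dq k i ?B m" by (rule Dq_cong[OF m i eq])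
    also have "\<dots> = (\<Sum>I\<in>indices. \<Sum>J\<in>indices. omega h I J *\<^sub>R
       (Dq k i (Lderiv k I F) m * Lderiv k J G (coord_curve k m i (q_coord k m i)) +
        Lderiv k I F (coord_curve k m i (q_coord k m i)) * Dq k i (Lderiv k J G) m))"
    proof (rule Dq_eqI, intro has_sderiv_sum has_sderiv_scaleR_const has_sderiv_mult)
      fix I J assume "I \<in> indices" "J \<in> indices"
      then obtain d1 d2 where "smooth_homog k U d1 (Lderiv k I F)" "smooth_homog k U d2 (Lderiv k J G)" using smooth_homog_Lderiv F G by metis
      thus "has_sderiv (q_coord k m i) (\<lambda>t. Lderiv k I F (coord_curve k m i t)) (Dq k i (Lderiv k I F) m)"
        "has_sderiv (q_coord k m i) (\<lambda>t. Lderiv k J G (coord_curve k m i t)) (Dq k i (Lderiv k J G) m)"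
        using smooth_homog_deriv m i by blast+
    qed
    finally show ?thesis using IQ by (simp add: coord_curve_0[OF m])
  next
    case (IP i)
    show ?thesis unfolding IP by (simp add: eq[OF m] Dp_mult)
  next
    case (IT a)
    show ?thesis unfolding IT by (simp add: eq[OF m] D\<tau>_mult)
  qed
qed

text \<open>
The derivatives have the required symmetries for \<open>I \<in> indices\<close> only; \<open>R I\<close> in the proof replaces them by 0
for the other values of \<open>I\<close>.
\<close>

lemma pbracket_jacobi:
  assumes A: "smooth_homog k U (a + 2) A" "odd a" and B: "smooth_homog k U (b + 2) B" "odd b" and C: "smooth_homog k U (c + 2) C" "even c"
    and m: "m \<in> U" and h: "mat_tp h = h"
  shows "pbracket k h A (pbracket k h B C) m = pbracket k h (pbracket k h A B) C m - pbracket k h B (pbracket k h A C) m"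
proof -
  have par: "eps (A m) = - A m" "eps (B m) = - B m" "eps (pbracket k h A B m) = pbracket k h A B m"
    using smooth_homog_parity[OF A(1) m] smooth_homog_parity[OF B(1) m] smooth_homog_parity[OF smooth_homog_pbracket[OF A(1) B(1)] m] A(2) B(2) by auto
  define R where "R I (x::spoly) = (if I \<in> indices then x else 0)" for I x
  have sL: "eps (R I (Lderiv k J F m)) = ((- 1) ^ d * idx_sign J) *\<^sub>R R I (Lderiv k J F m)" if "smooth_homog k U d F" "I \<in> indices \<Longrightarrow> J \<in> indices" for F d I J
    using eps_Lderiv[OF that(1) _ m] that(2) by (auto simp: R_def)
  have LL: "R I (R J (Lderiv k I (Lderiv k J F) m)) = (if idx_sign I = - 1 \<and> idx_sign J = - 1 then - 1 else 1) *\<^sub>R R J (R I (Lderiv k J (Lderiv k I F) m))"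
    if "smooth_homog k U d F" for F d I J
    using Lderiv_Lderiv[OF that _ _ m, of I J] by (auto simp: R_def)
  have Le: "eps (R I (R J (Lderiv k I (Lderiv k J A) m))) = (- idx_sign I * idx_sign J) *\<^sub>R R I (R J (Lderiv k I (Lderiv k J A) m))" for I J
  proof (cases "I \<in> indices \<and> J \<in> indices")
    case True
    then obtain d' where "smooth_homog k U d' (Lderiv k J A)" "(- 1) ^ d' = (- 1) ^ a * idx_sign J" using smooth_homog_Lderiv[OF A(1)] by metis
    from eps_Lderiv[OF this(1), of I m] this(2) True A(2) m show ?thesis by (simp add: R_def mult_ac)
  qed (auto simp: R_def)
  have pA: "eps (R I (Lderiv k I A m)) = - idx_sign I *\<^sub>R R I (Lderiv k I A m)" for I using sL[OF A(1), of I I] A(2) by simp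
  have pB: "eps (R I (Lderiv k I B m)) = - idx_sign I *\<^sub>R R I (Lderiv k I B m)" for I using sL[OF B(1), of I I] B(2) by simp
  have pC: "eps (R I (Lderiv k I C m)) = idx_sign I *\<^sub>R R I (Lderiv k I C m)" for I using sL[OF C(1), of I I] C(2) by simp
  note J = jacobi_pointwise[where s = idx_sign and \<omega> = "omega h" and X = indices and
      a = "\<lambda>I. R I (Lderiv k I A m)" and b = "\<lambda>I. R I (Lderiv k I B m)" and c = "\<lambda>I. R I (Lderiv k I C m)" and
      ?a2.0 = "\<lambda>I J. R I (R J (Lderiv k I (Lderiv k J A) m))" and ?b2.0 = "\<lambda>I J. R I (R J (Lderiv k I (Lderiv k J B) m))" and
      ?c2.0 = "\<lambda>I J. R I (R J (Lderiv k I (Lderiv k J C) m))",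
      OF idx_sign_cases omega_par omega_sym[OF h] pA pB pC LL[OF A(1)] LL[OF B(1)] LL[OF C(1)] Le]
  have 1: "pbracket k h F (pbracket k h G C) m = (\<Sum>I\<in>indices. \<Sum>J\<in>indices. omega h I J *\<^sub>R (R I (Lderiv k I F m) * (\<Sum>K\<in>indices. \<Sum>L\<in>indices. omega h K L *\<^sub>R
       (R J (R K (Lderiv k J (Lderiv k K G) m)) * R L (Lderiv k L C m) +
       (if idx_sign J = -1 then eps (R K (Lderiv k K G m)) else R K (Lderiv k K G m)) * R J (R L (Lderiv k J (Lderiv k L C) m))))))"
    if "eps (F m) = - F m" "smooth_homog k U (g + 2) G" "odd g" for F G g
    unfolding pbracket_odd[of F m, OF that(1)]
    by (intro sum.cong refl) (simp add: Lderiv_pbracket[OF that(2) C(1) that(3) m] R_def cong: sum.cong if_cong)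
  have 2: "pbracket k h (pbracket k h A B) C m = (\<Sum>K\<in>indices. \<Sum>L\<in>indices. (omega h K L * idx_sign K) *\<^sub>R ((\<Sum>I\<in>indices. \<Sum>J\<in>indices. omega h I J *\<^sub>R
       (R K (R I (Lderiv k K (Lderiv k I A) m)) * R J (Lderiv k J B m) +
       (if idx_sign K = -1 then eps (R I (Lderiv k I A m)) else R I (Lderiv k I A m)) * R K (R J (Lderiv k K (Lderiv k J B) m)))) * R L (Lderiv k L C m)))"
    unfolding pbracket_even[of "pbracket k h A B" m, OF par(3)]
    by (intro sum.cong refl) (simp add: Lderiv_pbracket[OF A(1) B(1) A(2) m] R_def cong: sum.cong if_cong)
  show ?thesis unfolding 1[of A b B, OF par(1) B] 1[of B a A, OF par(2) A] 2 by (rule J)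
qed

lemma pbracket_skew:
  assumes F: "smooth_homog k U f F" and G: "smooth_homog k U g G" "odd g" and m: "m \<in> U" and h: "mat_tp h = h"
  shows "pbracket k h F G m = (if odd f then pbracket k h G F m else - pbracket k h G F m)"
proof -
  have parG: "eps (G m) = - G m" using smooth_homog_parity[OF G(1) m] G(2) by simp
  have comm: "Lderiv k J G m * Lderiv k I F m = (if odd f \<and> idx_sign I = 1 then - 1 else 1) *\<^sub>R (Lderiv k I F m * Lderiv k J G m)"
    if "I \<in> indices" "J \<in> indices" "idx_sign I = idx_sign J" for I J
  proof (cases "idx_sign J = 1")
    case True
    hence "eps (Lderiv k J G m) = - Lderiv k J G m" using eps_Lderiv[OF G(1) that(2) m] G(2) by simp
    from odd_mult_commute[OF this] True that(3) eps_Lderiv[OF F that(1) m] show ?thesis by auto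
  next
    case False
    hence J: "idx_sign J = - 1" using idx_sign_cases by blast
    hence "eps (Lderiv k J G m) = Lderiv k J G m" using eps_Lderiv[OF G(1) that(2) m] G(2) by simp
    from even_mult_commute[OF this] J that(3) show ?thesis by auto
  qed
  have "pbracket k h G F m = (\<Sum>I\<in>indices. \<Sum>J\<in>indices. omega h J I *\<^sub>R (Lderiv k J G m * Lderiv k I F m))"
    unfolding pbracket_odd[of G m, OF parG] by (rule sum.swap)
  also have "\<dots> = (\<Sum>I\<in>indices. \<Sum>J\<in>indices. (omega h I J * (if odd f then 1 else - idx_sign I)) *\<^sub>R (Lderiv k I F m * Lderiv k J G m))"
  proof (intro sum.cong refl)
    fix I J assume IJ: "I \<in> indices" "J \<in> indices"
    show "omega h J I *\<^sub>R (Lderiv k J G m * Lderiv k I F m) = (omega h I J * (if odd f then 1 else - idx_sign I)) *\<^sub>R (Lderiv k I F m * Lderiv k J G m)"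
    proof (cases "omega h I J = 0")
      case True
      thus ?thesis using omega_sym[OF h, of J I] by simp
    next
      case False
      show ?thesis using comm[OF IJ omega_par[OF False]] omega_sym[OF h, of J I] idx_sign_cases[of I] by auto
    qed
  qed
  finally have *: "pbracket k h G F m = \<dots>" .
  show ?thesis
  proof (cases "odd f")
    case True
    hence "eps (F m) = - F m" using smooth_homog_parity[OF F m] by simp
    from pbracket_odd[of F m, OF this] * True show ?thesis by simp
  next
    case False
    hence "eps (F m) = F m" using smooth_homog_parity[OF F m] by simp
    from pbracket_even[of F m, OF this] * False show ?thesis by (simp add: sum_negf)
  qed
qed

lemma pbracket_minus_right:
  assumes "smooth_homog k U g G" "m \<in> U" shows "pbracket k h F (\<lambda>x. - G x) m = - pbracket k h F G m"
proof -
  have "Dq k s (\<lambda>x. - G x) m = - Dq k s G m" if "s < n" for s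
    by (rule Dq_eqI) (use has_sderiv_scaleR_const[OF smooth_homog_deriv[OF assms that], of "-1"] in simp)
  thus ?thesis by (simp add: pbracket_def sum_subtractf sum_negf)
qed

lemma pbracket_zero_left:
  assumes "m \<in> U" shows "pbracket k h (\<lambda>x. 0) G m = 0"
proof -
  have "Dq k s (\<lambda>x. 0) m = 0" for s by (rule Dq_eqI) (rule has_sderiv_const)
  thus ?thesis by (simp add: pbracket_def)
qed

text \<open>
The computation on which the theorem rests, in one coordinate system.
\<close>

proposition deformed_square:
  assumes \<Theta>: "smooth_homog k U 3 \<Theta>" and N: "smooth_homog k U 2 N" and h: "mat_tp h = h"
    and square: "\<And>x. x \<in> U \<Longrightarrow> pbracket k h \<Theta> \<Theta> x = 0" and m: "m \<in> U"
  shows "pbracket k h \<Theta> (pbracket k h (pbracket k h N \<Theta>) N) m = pbracket k h (pbracket k h N \<Theta>) (pbracket k h N \<Theta>) m"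
proof -
  let ?B = "pbracket k h"
  have \<Theta>': "smooth_homog k U (1 + 2) \<Theta>" and N': "smooth_homog k U (0 + 2) N" using \<Theta> N by (auto simp: numeral_3_eq_3 numeral_2_eq_2)
  have \<Theta>N: "smooth_homog k U (1 + 2) (?B \<Theta> N)" using smooth_homog_pbracket[OF \<Theta>' N'] by simp
  have N\<Theta>: "smooth_homog k U (1 + 2) (?B N \<Theta>)" using smooth_homog_pbracket[OF N' \<Theta>'] by simp
  have sk: "?B N \<Theta> x = - ?B \<Theta> N x" if "x \<in> U" for x using pbracket_skew[OF N \<Theta> _ that h] by simp
  have 1: "?B \<Theta> (?B \<Theta> N) x = 0" if "x \<in> U" for x
  proof -
    have "?B \<Theta> (?B \<Theta> N) x = ?B (?B \<Theta> \<Theta>) N x - ?B \<Theta> (?B \<Theta> N) x"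
      by (rule pbracket_jacobi[OF \<Theta>' _ \<Theta>' _ N' _ that h]) auto
    also have "?B (?B \<Theta> \<Theta>) N x = ?B (\<lambda>x. 0) N x" by (rule pbracket_cong[OF that]) (simp_all add: square)
    finally have "2 *\<^sub>R ?B \<Theta> (?B \<Theta> N) x = 0" by (simp add: pbracket_zero_left[OF that] scaleR_2 eq_neg_iff_add_eq_0)
    thus ?thesis by simp
  qed
  have 2: "?B \<Theta> (?B N \<Theta>) x = 0" if "x \<in> U" for x
  proof -
    have "?B \<Theta> (?B N \<Theta>) x = ?B \<Theta> (\<lambda>x. - ?B \<Theta> N x) x" by (rule pbracket_cong[OF that]) (simp_all add: sk)
    thus ?thesis using pbracket_minus_right[OF \<Theta>N that] 1[OF that] by simp
  qed
  have "?B \<Theta> (?B (?B N \<Theta>) N) m = ?B (?B \<Theta> (?B N \<Theta>)) N m - ?B (?B N \<Theta>) (?B \<Theta> N) m"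
    by (rule pbracket_jacobi[OF \<Theta>' _ N\<Theta> _ N' _ m h]) auto
  also have "?B (?B \<Theta> (?B N \<Theta>)) N m = ?B (\<lambda>x. 0) N m" by (rule pbracket_cong[OF m]) (simp_all add: 2)
  also have "\<dots> = 0" by (rule pbracket_zero_left[OF m])
  also have "?B (?B N \<Theta>) (?B \<Theta> N) m = ?B (?B N \<Theta>) (\<lambda>x. - ?B N \<Theta> x) m"
    by (rule pbracket_cong[OF m]) (simp_all add: sk)
  also have "\<dots> = - ?B (?B N \<Theta>) (?B N \<Theta>) m" by (rule pbracket_minus_right[OF N\<Theta> m])
  finally show ?thesis by simp
qed

end

section \<open>Graded functions as families of superpolynomials\<close>

context metric_bundle
begin

text \<open>
The local expression of a function in the coordinate system \<open>k\<close>, as an element of the type \<open>spoly\<close>. It is meaningful for graded functions only.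
\<close>

definition local_expr :: "('m, 'v) coords \<Rightarrow> ('m, 'v) family \<Rightarrow> 'm \<Rightarrow> spoly" where
  "local_expr k F x = Spoly (F k x)"

lemma coef_local_expr:
  assumes "F \<in> graded_functions E d" shows "coef (local_expr k F x) = F k x"
  unfolding local_expr_def
proof (rule Spoly_inverse)
  have "F k x S K \<noteq> 0 \<Longrightarrow> (S, K) \<in> homset r n d" for S K
    using assms by (simp add: graded_functions_def homset_def)
  hence "{(S, K). F k x S K \<noteq> 0} \<subseteq> homset r n d" "\<And>S K. F k x S K \<noteq> 0 \<Longrightarrow> finite S"
    using homset_finite_fst by blast+
  thus "F k x \<in> {A. finite {(S, K). A S K \<noteq> 0} \<and> (\<forall>S K. A S K \<noteq> 0 \<longrightarrow> finite S)}"
    using finite_subset finite_homset by blast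
qed

lemma smooth_homog_local_expr:
  assumes F: "F \<in> graded_functions E d" and k: "k \<in> \<K>"
  shows "smooth_homog k (patch k) d (local_expr k F)"
proof (rule smooth_homogI)
  fix x show "homog r n d (local_expr k F x)" unfolding homog_def coef_local_expr[OF F]
    using F unfolding graded_functions_def by blast
next
  fix S K show "chart_smooth E k (patch k) (\<lambda>x. coef (local_expr k F x) S K)"
    unfolding coef_local_expr[OF F] chart_smooth_def using F k unfolding graded_functions_def by blast
qed

text \<open>
The matrix \<open>g\<^sup>a\<^sup>b\<close>.
\<close>

definition gram_inv :: "('m, 'v) coords \<Rightarrow> 'm \<Rightarrow> nat \<Rightarrow> nat \<Rightarrow> real" where
  "gram_inv k m = inverse_matrix r (gram E k m)"

lemma local_coords_patch: "k \<in> \<K> \<Longrightarrow> local_coords E k (patch k)"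
  using chart_props(1) metric_bundle_axioms by (simp add: local_coords_def local_coords_axioms_def)

lemma bracket_eq_pbracket:
  assumes F: "F \<in> graded_functions E d" and G: "G \<in> graded_functions E e" and k: "k \<in> \<K>" and m: "m \<in> patch k"
  shows "bracket E F G k m = coef (pbracket k (gram_inv k m) (local_expr k F) (local_expr k G) m)"
proof (intro ext)
  fix S K
  interpret local_coords E k "patch k" by (rule local_coords_patch[OF k])
  have DF: "coef (Dq k i (local_expr k F) m) = (\<lambda>S K. dq k i (\<lambda>x. F k x S K) m)" if "i < n" for i
    using coef_Dq[OF smooth_homog_local_expr[OF F k] m that] by (simp add: coef_local_expr[OF F] fun_eq_iff)
  have DG: "coef (Dq k i (local_expr k G) m) = (\<lambda>S K. dq k i (\<lambda>x. G k x S K) m)" if "i < n" for i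
    using coef_Dq[OF smooth_homog_local_expr[OF G k] m that] by (simp add: coef_local_expr[OF G] fun_eq_iff)
  show "bracket E F G k m S K = coef (pbracket k (gram_inv k m) (local_expr k F) (local_expr k G) m) S K"
    using k m unfolding bracket_def pbracket_def gram_inv_def
    by (simp add: coef_mult DF DG Dp.rep_eq D\<tau>.rep_eq D\<tau>R.rep_eq coef_local_expr[OF F] coef_local_expr[OF G] flip: D\<tau>R_eq)
qed

lemma local_expr_bracket:
  assumes "F \<in> graded_functions E d" "G \<in> graded_functions E e" "k \<in> \<K>" "m \<in> patch k"
  shows "local_expr k (bracket E F G) m = pbracket k (gram_inv k m) (local_expr k F) (local_expr k G) m"
  unfolding local_expr_def[of k "bracket E F G"] bracket_eq_pbracket[OF assms] by (rule coef_inverse)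

lemma gram_inv_const: "k \<in> \<K> \<Longrightarrow> x \<in> patch k \<Longrightarrow> y \<in> patch k \<Longrightarrow> gram_inv k x = gram_inv k y"
  unfolding gram_inv_def by (rule inverse_gram_const)

lemma frame_change_inverse:
  assumes "(U, e) \<in> frames E" "(U', e') \<in> frames E" "m \<in> U" "m \<in> U'"
  shows "mat_mult r (\<lambda>b a. component E e' m (e a m) b) (\<lambda>a b. component E e m (e' b m) a) = mat_one r"
proof (intro ext)
  fix b c
  let ?C = "\<lambda>b a. component E e' m (e a m) b" and ?B = "\<lambda>a b. component E e m (e' b m) a"
  show "mat_mult r ?C ?B b c = mat_one r b c"
  proof (cases "b < r \<and> c < r")
    case True
    have "e' c m = (\<Sum>a<r. ?B a c *\<^sub>R e a m)"
      using comp_expand[OF assms(1,3) frame_in_fibre[OF assms(2,4)], of c] True by simp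
    also have "\<dots> = (\<Sum>a<r. ?B a c *\<^sub>R (\<Sum>b<r. ?C b a *\<^sub>R e' b m))"
      by (intro sum.cong) (simp_all add: comp_expand[OF assms(2,4) frame_in_fibre[OF assms(1,3)]])
    also have "\<dots> = (\<Sum>b<r. (\<Sum>a<r. ?C b a * ?B a c) *\<^sub>R e' b m)"
      unfolding scaleR_sum_right scaleR_sum_left scaleR_scaleR by (subst sum.swap) (simp add: mult.commute)
    finally have "component E e' m (e' c m) b = (\<Sum>a<r. ?C b a * ?B a c)"
      using comp_sum[OF assms(2,4), of b "\<lambda>b. \<Sum>a<r. ?C b a * ?B a c"] True by simp
    moreover have "e' c m = (\<Sum>b<r. mat_one r b c *\<^sub>R e' b m)"
      using True by (simp add: mat_one_def if_distrib[of "\<lambda>x. x *\<^sub>R _"] cong: if_cong)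
    hence "component E e' m (e' c m) b = mat_one r b c"
      using comp_sum[OF assms(2,4), of b "\<lambda>b. mat_one r b c"] True by simp
    ultimately show ?thesis using True by (simp add: mat_mult_def)
  qed (auto simp: mat_mult_def mat_one_def)
qed

lemma gram_change:
  assumes "k \<in> \<K>" "k' \<in> \<K>" "m \<in> patch k" "m \<in> patch k'" "a < r" "d < r"
  shows "gram E k m a d = (\<Sum>b<r. \<Sum>c<r. gram E k' m b c *
    (component E (e_frame k') m (e_frame k a m) b * component E (e_frame k') m (e_frame k d m) c))"
proof -
  let ?C = "\<lambda>b a. component E (e_frame k') m (e_frame k a m) b"
  note f = frame_in_fibre[OF coord_systemsD(2)[OF assms(1)] assms(3)]
  note f' = frame_in_fibre[OF coord_systemsD(2)[OF assms(2)] assms(4)]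
  note ex = comp_expand[OF coord_systemsD(2)[OF assms(2)] assms(4) f, symmetric]
  have "gram E k m a d = form E m (\<Sum>b<r. ?C b a *\<^sub>R e_frame k' b m) (e_frame k d m)"
    unfolding gram_def using ex[OF assms(5)] by simp
  also have "\<dots> = (\<Sum>b<r. ?C b a * form E m (e_frame k' b m) (e_frame k d m))"
    using f f' assms by (intro form_sum_left) auto
  also have "\<dots> = (\<Sum>b<r. ?C b a * form E m (e_frame k' b m) (\<Sum>c<r. ?C c d *\<^sub>R e_frame k' c m))"
    using ex[OF assms(6)] by simp
  also have "\<dots> = (\<Sum>b<r. ?C b a * (\<Sum>c<r. ?C c d * form E m (e_frame k' b m) (e_frame k' c m)))"
    using f f' assms by (intro sum.cong arg_cong2[of _ _ _ _ "(*)"] form_sum_right) auto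
  finally show ?thesis by (simp add: gram_def sum_distrib_left mult_ac)
qed

lemma dq_sum_mult:
  assumes "k \<in> \<K>" "U \<subseteq> patch k" "m \<in> U" "s < n"
    "\<And>i. i \<in> I \<Longrightarrow> chart_smooth E k U (f i)" "\<And>i. i \<in> I \<Longrightarrow> chart_smooth E k U (g i)"
  shows "dq k s (\<lambda>x. \<Sum>i\<in>I. f i x * g i x) m = (\<Sum>i\<in>I. dq k s (f i) m * g i m + f i m * dq k s (g i) m)"
proof (rule dq_eqI)
  have m: "coord_curve k m s (q_coord k m s) = m" using coord_curve_self[OF assms(1)] assms(2,3) by blast
  have "((\<lambda>t. \<Sum>i\<in>I. f i (coord_curve k m s t) * g i (coord_curve k m s t)) has_real_derivative
    (\<Sum>i\<in>I. dq k s (f i) m * g i (coord_curve k m s (q_coord k m s)) + dq k s (g i) m * f i (coord_curve k m s (q_coord k m s))))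
     (at (q_coord k m s))"
    by (intro DERIV_sum DERIV_mult chart_smooth_deriv[OF assms(1-4)] assms(5,6))
  thus "((\<lambda>t. \<Sum>i\<in>I. f i (coord_curve k m s t) * g i (coord_curve k m s t)) has_real_derivative
    (\<Sum>i\<in>I. dq k s (f i) m * g i m + f i m * dq k s (g i) m)) (at (q_coord k m s))"
    by (simp add: m mult.commute)
qed

end

section \<open>Invariance of the bracket under coordinate changes\<close>

lemma sum3_rotate: "(\<Sum>a\<in>A. \<Sum>b\<in>B. \<Sum>c\<in>C. f a b c) = (\<Sum>b\<in>B. \<Sum>c\<in>C. \<Sum>a\<in>A. f a b c)"
  by (subst sum.swap) (intro sum.cong refl sum.swap)

lemma sum3_reverse: "(\<Sum>a\<in>A. \<Sum>b\<in>B. \<Sum>c\<in>C. f a b c) = (\<Sum>c\<in>C. \<Sum>b\<in>B. \<Sum>a\<in>A. f a b c)"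
  unfolding sum3_rotate[of _ C] by (intro sum.swap)

text \<open>
Two coordinate systems \<open>k\<close>, \<open>k'\<close> and a point \<open>m\<close> in the overlap \<open>\<U>\<close> of their domains.
\<close>

locale overlap = metric_bundle E
  for E :: "('m::{t2_space, second_countable_topology}, 'v::real_vector, 'z) metric_bundle_scheme" +
  fixes k k' :: "('m, 'v) coords" and m :: 'm
  assumes k: "k \<in> coord_systems E" and k': "k' \<in> coord_systems E"
    and m: "m \<in> patch k" and m': "m \<in> patch k'"
begin

abbreviation "\<U> \<equiv> patch k \<inter> patch k'"

lemma \<U>: "open \<U>" "\<U> \<subseteq> patch k" "\<U> \<subseteq> patch k'" "m \<in> \<U>"
  using chart_props(1)[OF k] chart_props(1)[OF k'] m m' by (auto intro: open_Int)

sublocale loc: local_coords E k \<U>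
  by unfold_locales (use k \<U> in auto)

text \<open>
With \<open>e\<^sub>a = C\<^sup>b\<^sub>a e'\<^sub>b\<close> and \<open>e'\<^sub>b = B\<^sup>a\<^sub>b e\<^sub>a\<close>: the matrices \<open>C\<close>, \<open>B\<close> and their derivatives \<open>dC\<close>, \<open>dB\<close> in the base
coordinates of \<open>k\<close>; the Gram matrix \<open>g'\<close> of \<open>k'\<close>, which does not depend on the point, and its inverse
\<open>h'\<close>; the Jacobian \<open>J\<close> of the change of base coordinates and its inverse \<open>A\<close>. Then \<open>T a\<close> and \<open>P i\<close> are the
coordinates \<open>\<tau>\<^sup>a\<close> and \<open>p\<^sub>i\<close> of \<open>k\<close> in terms of those of \<open>k'\<close>, \<open>V s a\<close> and \<open>Y s i\<close> their derivatives
in the \<open>s\<close>-th base coordinate of \<open>k\<close> (with \<open>\<tau>'\<close> and \<open>p'\<close> fixed), and \<open>W i b\<close> the derivative of \<open>P i\<close> in \<open>\<tau>'\<^sup>b\<close>.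
The matrices \<open>conn s = (\<partial>\<^sub>s C) B\<close>, as \<open>conn_tau s b = \<Sum> (conn s)\<^sup>b\<^sub>d \<tau>'\<^sup>d\<close>, determine \<open>V\<close>, \<open>W\<close> and the
antisymmetric part of \<open>Y\<close>.
\<close>

definition "Cmat x b a = component E (e_frame k') x (e_frame k a x) b"
definition "Bmat x a b = component E (e_frame k) x (e_frame k' b x) a"
definition "g' = gram E k' m"
definition "h' = gram_inv k' m"
definition "dB s a b = dq k s (\<lambda>x. Bmat x a b) m"
definition "dC s b a = dq k s (\<lambda>x. Cmat x b a) m"
definition "J i l = dq k i (\<lambda>x. q_coord k' x l) m"
definition "A l s = dq k' l (\<lambda>x. q_coord k x s) m"
definition "T x a = (\<Sum>b<r. Bmat x a b *\<^sub>R \<tau> b)"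
definition "P x i = (\<Sum>j<n. dq k i (\<lambda>x. q_coord k' x j) x *\<^sub>R p_gen j) + (1/2) *\<^sub>R (\<Sum>a<r. \<Sum>b<r. \<Sum>c<r.
   (g' b c * dq k i (\<lambda>x. Cmat x b a) x) *\<^sub>R (\<tau> c * T x a))"
definition "V s a = (\<Sum>b<r. dB s a b *\<^sub>R \<tau> b)"
definition "Y s i = (\<Sum>j<n. dq k s (dq k i (\<lambda>x. q_coord k' x j)) m *\<^sub>R p_gen j) + (1/2) *\<^sub>R (\<Sum>a<r. \<Sum>b<r. \<Sum>c<r.
   (g' b c * dq k s (dq k i (\<lambda>x. Cmat x b a)) m) *\<^sub>R (\<tau> c * T m a) + (g' b c * dC i b a) *\<^sub>R (\<tau> c * V s a))"
definition "W i b = D\<tau> b (P m i)"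
definition "conn s = mat_mult r (dC s) (Bmat m)"
definition "conn_tau s b = (\<Sum>d<r. conn s b d *\<^sub>R \<tau> d)"

lemma T_odd: "eps (T x a) = - T x a"
  by (simp add: T_def sum_negf)

lemma P_even: "eps (P x i) = P x i"
  by (simp add: P_def T_odd)

sublocale sub: super_substitution "T x" "P x" for x
  by unfold_locales (rule T_odd P_even)+

lemma V_odd: "eps (V s a) = - V s a"
  by (simp add: V_def sum_negf)

lemma Y_even: "eps (Y s i) = Y s i"
  by (simp add: Y_def T_odd V_odd)

lemma W_odd: "eps (W s b) = - W s b"
  by (simp add: W_def eps_D\<tau> P_even)

lemma conn_tau_odd: "eps (conn_tau s b) = - conn_tau s b"
  by (simp add: conn_tau_def sum_negf)

lemma CB: "x \<in> \<U> \<Longrightarrow> mat_mult r (Cmat x) (Bmat x) = mat_one r"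
  using frame_change_inverse[OF coord_systemsD(2)[OF k] coord_systemsD(2)[OF k'], of x] by (simp add: Cmat_def[abs_def] Bmat_def[abs_def])

lemma BC: "x \<in> \<U> \<Longrightarrow> mat_mult r (Bmat x) (Cmat x) = mat_one r"
  using frame_change_inverse[OF coord_systemsD(2)[OF k'] coord_systemsD(2)[OF k], of x] by (simp add: Cmat_def[abs_def] Bmat_def[abs_def])

lemma chart_smooth_B: "a < r \<Longrightarrow> b < r \<Longrightarrow> chart_smooth E k \<U> (\<lambda>x. Bmat x a b)"
  using frames_compatible[OF coord_systemsD(2)[OF k'] coord_systemsD(2)[OF k]] chart_smooth_smooth_fun[OF k, of \<U>]
  by (simp add: smooth_frame_change_def Bmat_def Int_ac)

lemma chart_smooth_C: "a < r \<Longrightarrow> b < r \<Longrightarrow> chart_smooth E k \<U> (\<lambda>x. Cmat x a b)"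
  using frames_compatible[OF coord_systemsD(2)[OF k] coord_systemsD(2)[OF k']] chart_smooth_smooth_fun[OF k, of \<U>]
  by (simp add: smooth_frame_change_def Cmat_def Int_ac)

lemma chart_smooth_q: "j < n \<Longrightarrow> chart_smooth E k \<U> (\<lambda>x. q_coord k' x j)"
  by (rule chart_smooth_transition[OF k k'])

lemma g'_sym: "a < r \<Longrightarrow> b < r \<Longrightarrow> g' a b = g' b a"
  unfolding g'_def by (rule gram_sym[OF k' m'])

lemma h'_props: "mat_mult r h' g' = mat_one r" "mat_mult r g' h' = mat_one r" "mat_tp h' = h'"
  using inverse_gram[OF k' m'] by (simp_all add: h'_def g'_def gram_inv_def)

lemma dq_const: "dq k s (\<lambda>x. c) m = 0"
  by (rule dq_eqI) simp

lemma dBC: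
  assumes s: "s < n"
  shows "mat_mult r (dB s) (Cmat m) = (\<lambda>a c. - mat_mult r (Bmat m) (dC s) a c)"
proof (intro ext)
  fix a c
  show "mat_mult r (dB s) (Cmat m) a c = - mat_mult r (Bmat m) (dC s) a c"
  proof (cases "a < r \<and> c < r")
    case True
    have "0 = dq k s (\<lambda>x. mat_one r a c) m" by (simp add: dq_const)
    also have "\<dots> = dq k s (\<lambda>x. \<Sum>b<r. Bmat x a b * Cmat x b c) m"
    proof (rule dq_cong[OF k \<U>(1,2,4) s])
      fix x assume "x \<in> \<U>"
      from BC[OF this] have "mat_mult r (Bmat x) (Cmat x) a c = mat_one r a c" by simp
      thus "mat_one r a c = (\<Sum>b<r. Bmat x a b * Cmat x b c)" using True by (simp add: mat_mult_def)
    qed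
    also have "\<dots> = (\<Sum>b<r. dB s a b * Cmat m b c + Bmat m a b * dC s b c)"
      unfolding dB_def dC_def
      by (rule dq_sum_mult[OF k \<U>(2,4) s]) (use True chart_smooth_B chart_smooth_C in auto)
    finally show ?thesis using True by (simp add: mat_mult_def sum.distrib)
  qed (auto simp: mat_mult_def)
qed

lemma dB_eq:
  assumes "s < n"
  shows "mat_trunc r (dB s) = (\<lambda>a c. - mat_mult r (Bmat m) (conn s) a c)"
proof -
  have "mat_trunc r (dB s) = mat_mult r (dB s) (mat_mult r (Cmat m) (Bmat m))" by (simp add: CB[OF \<U>(4)])
  also have "\<dots> = mat_mult r (mat_mult r (dB s) (Cmat m)) (Bmat m)" by (simp add: mat_mult_assoc)
  also have "\<dots> = (\<lambda>a c. - mat_mult r (Bmat m) (conn s) a c)"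
    unfolding dBC[OF assms] mat_mult_minus by (simp add: mat_mult_assoc conn_def)
  finally show ?thesis .
qed

lemma gram_eq_mat_mult: "mat_trunc r (gram E k m) = mat_mult r (mat_tp (Cmat m)) (mat_mult r g' (Cmat m))"
proof (intro ext)
  fix a d
  show "mat_trunc r (gram E k m) a d = mat_mult r (mat_tp (Cmat m)) (mat_mult r g' (Cmat m)) a d"
  proof (cases "a < r \<and> d < r")
    case True
    thus ?thesis using gram_change[OF k k' m m', of a d]
      by (simp add: mat_trunc_def mat_mult_def mat_tp_def g'_def Cmat_def sum_distrib_left mult_ac)
  qed (auto simp: mat_trunc_def mat_mult_def)
qed

lemma metric_compat:
  assumes s: "s < n"
  shows "mat_mult r (mat_tp (dC s)) (mat_mult r g' (Cmat m)) = (\<lambda>a d. - mat_mult r (mat_tp (Cmat m)) (mat_mult r g' (dC s)) a d)"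
proof (intro ext)
  fix a d
  show "mat_mult r (mat_tp (dC s)) (mat_mult r g' (Cmat m)) a d = - mat_mult r (mat_tp (Cmat m)) (mat_mult r g' (dC s)) a d"
  proof (cases "a < r \<and> d < r")
    case True
    let ?I = "{..<r} \<times> {..<r}"
    have "0 = dq k s (\<lambda>x. gram E k m a d) m" by (simp add: dq_const)
    also have "\<dots> = dq k s (\<lambda>x. \<Sum>p\<in>?I. (g' (fst p) (snd p) * Cmat x (fst p) a) * Cmat x (snd p) d) m"
    proof (rule dq_cong[OF k \<U>(1,2,4) s])
      fix x assume x: "x \<in> \<U>"
      have "gram E k m a d = gram E k x a d" using coord_systemsD(3)[OF k] True x m by blast
      also have "\<dots> = (\<Sum>b<r. \<Sum>c<r. gram E k' x b c * (Cmat x b a * Cmat x c d))"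
        unfolding Cmat_def using gram_change[OF k k'] x True by auto
      also have "\<dots> = (\<Sum>b<r. \<Sum>c<r. g' b c * (Cmat x b a * Cmat x c d))"
        unfolding g'_def by (intro sum.cong refl arg_cong2[of _ _ _ _ "(*)"] coord_systemsD(3)[OF k']) (use x m' in auto)
      finally show "gram E k m a d = (\<Sum>p\<in>?I. (g' (fst p) (snd p) * Cmat x (fst p) a) * Cmat x (snd p) d)"
        by (simp add: sum.cartesian_product split_def mult.assoc)
    qed
    also have "\<dots> = (\<Sum>p\<in>?I. dq k s (\<lambda>x. g' (fst p) (snd p) * Cmat x (fst p) a) m * Cmat m (snd p) d +
       (g' (fst p) (snd p) * Cmat m (fst p) a) * dC s (snd p) d)"
      unfolding dC_def
      by (rule dq_sum_mult[OF k \<U>(2,4) s]) (use True in \<open>auto intro!: chart_smooth_C chart_smooth_mult[OF k \<U>(1,2)] chart_smooth_const\<close>)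
    also have "\<dots> = (\<Sum>p\<in>?I. (g' (fst p) (snd p) * dC s (fst p) a) * Cmat m (snd p) d +
       (g' (fst p) (snd p) * Cmat m (fst p) a) * dC s (snd p) d)"
    proof (intro sum.cong refl arg_cong2[of _ _ _ _ "(+)"] arg_cong2[of _ _ _ _ "(*)"])
      fix p assume p: "p \<in> ?I"
      show "dq k s (\<lambda>x. g' (fst p) (snd p) * Cmat x (fst p) a) m = g' (fst p) (snd p) * dC s (fst p) a"
        using dq_sum_mult[OF k \<U>(2,4) s, of "{()}" "\<lambda>_ _. g' (fst p) (snd p)" "\<lambda>_ x. Cmat x (fst p) a"] p True
        by (auto simp: dC_def dq_const chart_smooth_const chart_smooth_C)
    qed
    also have "\<dots> = (\<Sum>b<r. \<Sum>c<r. g' b c * dC s b a * Cmat m c d) + (\<Sum>b<r. \<Sum>c<r. g' b c * Cmat m b a * dC s c d)"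
      by (simp add: sum.distrib sum.cartesian_product split_def)
    finally show ?thesis using True
      by (simp add: mat_mult_def mat_tp_def sum_distrib_left mult_ac)
  qed (auto simp: mat_mult_def)
qed

text \<open>
Differentiating \<open>g = C\<^sup>T g' C\<close>, where \<open>g\<close> and \<open>g'\<close> are constant, shows that \<open>(\<partial>\<^sub>s C) B\<close> is skew-symmetric for \<open>g'\<close>.
\<close>

lemma conn_skew:
  assumes s: "s < n"
  shows "mat_mult r (mat_tp (conn s)) g' = (\<lambda>a d. - mat_mult r g' (conn s) a d)"
proof -
  have "mat_mult r (mat_mult r (mat_tp (Bmat m)) (mat_mult r (mat_tp (dC s)) (mat_mult r g' (Cmat m)))) (Bmat m) = mat_mult r (mat_tp (conn s)) g'"
    by (simp add: mat_mult_assoc CB[OF \<U>(4)] conn_def mat_tp_mat_mult)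
  moreover have "mat_mult r (mat_mult r (mat_tp (Bmat m)) (mat_mult r (mat_tp (Cmat m)) (mat_mult r g' (dC s)))) (Bmat m) = mat_mult r g' (conn s)"
  proof -
    have "mat_mult r (mat_tp (Bmat m)) (mat_tp (Cmat m)) = mat_one r" using arg_cong[OF CB[OF \<U>(4)], of mat_tp] by (simp add: mat_tp_mat_mult)
    thus ?thesis by (simp add: mat_mult_assoc[symmetric]) (simp add: mat_mult_assoc conn_def)
  qed
  ultimately show ?thesis using metric_compat[OF s] by (simp add: mat_mult_minus)
qed

lemma conn_skew': "s < n \<Longrightarrow> b < r \<Longrightarrow> c < r \<Longrightarrow> (\<Sum>\<beta><r. g' \<beta> c * conn s \<beta> b) = - (\<Sum>\<beta><r. g' b \<beta> * conn s \<beta> c)"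
  using fun_cong[OF fun_cong[OF conn_skew, of s b], of c] by (simp add: mat_mult_def mat_tp_def mult.commute)

lemma V_eq:
  assumes "s < n" "a < r"
  shows "V s a = - (\<Sum>b<r. Bmat m a b *\<^sub>R conn_tau s b)"
proof -
  have *: "dB s a d = - (\<Sum>b<r. Bmat m a b * conn s b d)" if "d < r" for d
    using fun_cong[OF fun_cong[OF dB_eq[OF assms(1)], of a], of d] assms(2) that by (simp add: mat_trunc_def mat_mult_def)
  have "V s a = - (\<Sum>d<r. \<Sum>b<r. (Bmat m a b * conn s b d) *\<^sub>R \<tau> d)"
    unfolding V_def by (simp add: * scaleR_sum_left sum_negf)
  also have "(\<Sum>d<r. \<Sum>b<r. (Bmat m a b * conn s b d) *\<^sub>R \<tau> d) = (\<Sum>b<r. Bmat m a b *\<^sub>R conn_tau s b)"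
    unfolding conn_tau_def scaleR_sum_right scaleR_scaleR by (rule sum.swap)
  finally show ?thesis .
qed

lemma conn_tau_eq:
  assumes "b < r" shows "conn_tau s b = (\<Sum>a<r. dC s b a *\<^sub>R T m a)"
proof -
  have "conn_tau s b = (\<Sum>d<r. \<Sum>a<r. (dC s b a * Bmat m a d) *\<^sub>R \<tau> d)"
    unfolding conn_tau_def conn_def using assms by (intro sum.cong) (auto simp: mat_mult_def scaleR_sum_left)
  also have "\<dots> = (\<Sum>a<r. dC s b a *\<^sub>R T m a)"
    unfolding T_def scaleR_sum_right scaleR_scaleR by (rule sum.swap)
  finally show ?thesis .
qed

lemma D\<tau>_tau: "D\<tau> b (\<tau> c) = (if b = c then 1 else 0)"
  using D\<tau>_\<tau>_mult[of b c 1] by simp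

lemma D\<tau>_p_gen: "D\<tau> b (p_gen c) = 0"
  using D\<tau>_p_gen_mult[of b c 1] by simp

lemma Dp_tau: "Dp i (\<tau> c) = 0"
  using Dp_\<tau>_mult[of i c 1] by simp

lemma Dp_p_gen: "Dp i (p_gen c) = (if i = c then 1 else 0)"
  using Dp_p_gen_mult[of i c 1] by simp

lemma D\<tau>_T: "b < r \<Longrightarrow> D\<tau> b (T x a) = Bmat x a b *\<^sub>R 1"
  by (simp add: T_def D\<tau>_tau if_distrib[of "\<lambda>y. _ *\<^sub>R y"] cong: if_cong)

lemma Dp_T: "Dp i (T x a) = 0"
  by (simp add: T_def Dp_tau)

lemma Dp_P: "l < n \<Longrightarrow> Dp l (P m i) = J i l *\<^sub>R 1"
  by (simp add: P_def Dp_\<tau>_mult Dp_T Dp_p_gen J_def if_distrib[of "\<lambda>y. _ *\<^sub>R y"] cong: if_cong)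

lemma W_eq:
  assumes i: "i < n" and b: "b < r"
  shows "W i b = (\<Sum>\<beta><r. g' \<beta> b *\<^sub>R conn_tau i \<beta>)"
proof -
  have 1: "(\<Sum>a<r. \<Sum>\<beta><r. \<Sum>c<r. (g' \<beta> c * dC i \<beta> a) *\<^sub>R (if b = c then T m a else 0)) = (\<Sum>\<beta><r. g' \<beta> b *\<^sub>R conn_tau i \<beta>)"
  proof -
    have "(\<Sum>a<r. \<Sum>\<beta><r. \<Sum>c<r. (g' \<beta> c * dC i \<beta> a) *\<^sub>R (if b = c then T m a else 0)) =
      (\<Sum>a<r. \<Sum>\<beta><r. (g' \<beta> b * dC i \<beta> a) *\<^sub>R T m a)"
      using b by (simp add: if_distrib[of "\<lambda>y. _ *\<^sub>R y"] cong: if_cong)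
    also have "\<dots> = (\<Sum>\<beta><r. g' \<beta> b *\<^sub>R conn_tau i \<beta>)"
      by (subst sum.swap) (intro sum.cong, auto simp: conn_tau_eq scaleR_sum_right)
    finally show ?thesis .
  qed
  have 2: "(\<Sum>a<r. \<Sum>\<beta><r. \<Sum>c<r. (g' \<beta> c * dC i \<beta> a * Bmat m a b) *\<^sub>R \<tau> c) = - (\<Sum>\<beta><r. g' \<beta> b *\<^sub>R conn_tau i \<beta>)"
  proof -
    have "(\<Sum>a<r. \<Sum>\<beta><r. \<Sum>c<r. (g' \<beta> c * dC i \<beta> a * Bmat m a b) *\<^sub>R \<tau> c) =
       (\<Sum>c<r. \<Sum>\<beta><r. \<Sum>a<r. (g' \<beta> c * dC i \<beta> a * Bmat m a b) *\<^sub>R \<tau> c)"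
      by (rule sum3_reverse)
    also have "\<dots> = (\<Sum>c<r. (\<Sum>\<beta><r. g' \<beta> c * conn i \<beta> b) *\<^sub>R \<tau> c)"
      using b by (intro sum.cong) (auto simp: conn_def mat_mult_def scaleR_sum_left sum_distrib_left mult.assoc intro!: sum.cong)
    also have "\<dots> = - (\<Sum>c<r. \<Sum>\<beta><r. (g' b \<beta> * conn i \<beta> c) *\<^sub>R \<tau> c)"
      by (simp add: conn_skew'[OF i b] scaleR_sum_left sum_negf)
    also have "(\<Sum>c<r. \<Sum>\<beta><r. (g' b \<beta> * conn i \<beta> c) *\<^sub>R \<tau> c) = (\<Sum>\<beta><r. g' b \<beta> *\<^sub>R conn_tau i \<beta>)"
      unfolding conn_tau_def scaleR_sum_right scaleR_scaleR by (rule sum.swap)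
    also have "\<dots> = (\<Sum>\<beta><r. g' \<beta> b *\<^sub>R conn_tau i \<beta>)" using g'_sym b by (intro sum.cong) auto
    finally show ?thesis .
  qed
  have "W i b = (1/2) *\<^sub>R ((\<Sum>a<r. \<Sum>\<beta><r. \<Sum>c<r. (g' \<beta> c * dC i \<beta> a) *\<^sub>R (if b = c then T m a else 0)) -
     (\<Sum>a<r. \<Sum>\<beta><r. \<Sum>c<r. (g' \<beta> c * dC i \<beta> a * Bmat m a b) *\<^sub>R \<tau> c))"
    unfolding W_def P_def using b
    by (simp add: D\<tau>_p_gen D\<tau>_\<tau>_mult D\<tau>_T dC_def scaleR_diff_right sum_subtractf)
  also have "\<dots> = (\<Sum>\<beta><r. g' \<beta> b *\<^sub>R conn_tau i \<beta>)" unfolding 1 2 by (simp flip: scaleR_2)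
  finally show ?thesis .
qed

lemma W_eq':
  assumes "i < n" "b < r"
  shows "W i b = (\<Sum>\<beta><r. g' b \<beta> *\<^sub>R conn_tau i \<beta>)"
  unfolding W_eq[OF assms] using assms(2) g'_sym by (intro sum.cong) auto

text \<open>
\<open>{\<tau>\<^sup>a, p\<^sub>s} = 0\<close>, computed in the coordinates \<open>k'\<close>.
\<close>

lemma W_contraction:
  assumes s: "s < n" and a: "a < r"
  shows "(\<Sum>b<r. \<Sum>c<r. (h' b c * Bmat m a b) *\<^sub>R W s c) = - V s a"
proof -
  have "(\<Sum>b<r. \<Sum>c<r. (h' b c * Bmat m a b) *\<^sub>R W s c) = (\<Sum>b<r. \<Sum>c<r. \<Sum>\<beta><r. (Bmat m a b * (h' b c * g' c \<beta>)) *\<^sub>R conn_tau s \<beta>)"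
    by (intro sum.cong refl) (simp add: W_eq'[OF s] scaleR_sum_right mult_ac)
  also have "\<dots> = (\<Sum>b<r. \<Sum>\<beta><r. (Bmat m a b * mat_mult r h' g' b \<beta>) *\<^sub>R conn_tau s \<beta>)"
    by (rule trans[OF sum.cong[OF refl sum.swap]]) (simp add: mat_mult_def sum_distrib_left scaleR_sum_left)
  also have "\<dots> = (\<Sum>b<r. Bmat m a b *\<^sub>R conn_tau s b)"
    unfolding h'_props by (simp add: mat_one_def if_distrib[of "\<lambda>y. _ * y"] if_distrib[of "\<lambda>y. y *\<^sub>R _"] cong: if_cong)
  finally show ?thesis using V_eq[OF s a] by simp
qed

lemma h'_sym: "h' b c = h' c b" using fun_cong[OF fun_cong[OF h'_props(3), of c], of b] by (simp add: mat_tp_def)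

lemma W_contraction':
  assumes "s < n" "a < r"
  shows "(\<Sum>b<r. \<Sum>c<r. (h' b c * Bmat m a c) *\<^sub>R W s b) = - V s a"
  using W_contraction[OF assms] by (subst sum.swap) (simp add: h'_sym)

text \<open>
The part of \<open>Y s i\<close> that is not symmetric in \<open>s\<close> and \<open>i\<close>, up to the factor \<open>\<onehalf>\<close>.
\<close>

definition "Qf i s = (\<Sum>b<r. \<Sum>d<r. g' b d *\<^sub>R (conn_tau i b * conn_tau s d))"

lemma Qf_skew: "Qf s i = - Qf i s"
proof -
  have "conn_tau s b * conn_tau i d = - (conn_tau i d * conn_tau s b)" for b d
    using odd_mult_commute[OF conn_tau_odd, of s b "conn_tau i d"] by (simp add: conn_tau_odd)
  hence "Qf s i = - (\<Sum>b<r. \<Sum>d<r. g' b d *\<^sub>R (conn_tau i d * conn_tau s b))"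
    unfolding Qf_def by (simp add: sum_negf)
  also have "(\<Sum>b<r. \<Sum>d<r. g' b d *\<^sub>R (conn_tau i d * conn_tau s b)) = Qf i s"
    unfolding Qf_def by (subst sum.swap) (intro sum.cong refl, simp add: g'_sym)
  finally show ?thesis .
qed

lemma Qf_Y:
  assumes s: "s < n" and i: "i < n"
  shows "(\<Sum>a<r. \<Sum>b<r. \<Sum>c<r. (g' b c * dC i b a) *\<^sub>R (\<tau> c * V s a)) = Qf i s"
proof -
  have "(\<Sum>a<r. \<Sum>b<r. \<Sum>c<r. (g' b c * dC i b a) *\<^sub>R (\<tau> c * V s a)) =
     (\<Sum>b<r. \<Sum>c<r. g' b c *\<^sub>R (\<tau> c * (\<Sum>a<r. dC i b a *\<^sub>R V s a)))"
    by (subst sum3_rotate) (simp add: sum_distrib_left scaleR_sum_right)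
  also have "\<dots> = (\<Sum>b<r. \<Sum>c<r. g' b c *\<^sub>R (\<tau> c * - (\<Sum>d<r. conn i b d *\<^sub>R conn_tau s d)))"
  proof (intro sum.cong refl)
    fix b c assume b: "b \<in> {..<r}"
    have "(\<Sum>a<r. dC i b a *\<^sub>R V s a) = - (\<Sum>a<r. \<Sum>d<r. (dC i b a * Bmat m a d) *\<^sub>R conn_tau s d)"
      by (simp add: V_eq[OF s] scaleR_sum_right sum_negf)
    also have "(\<Sum>a<r. \<Sum>d<r. (dC i b a * Bmat m a d) *\<^sub>R conn_tau s d) = (\<Sum>d<r. conn i b d *\<^sub>R conn_tau s d)"
      using b by (subst sum.swap) (simp add: conn_def mat_mult_def scaleR_sum_left)
    finally show "g' b c *\<^sub>R (\<tau> c * (\<Sum>a<r. dC i b a *\<^sub>R V s a)) = g' b c *\<^sub>R (\<tau> c * - (\<Sum>d<r. conn i b d *\<^sub>R conn_tau s d))"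
      by simp
  qed
  also have "\<dots> = - (\<Sum>d<r. \<Sum>c<r. (\<Sum>b<r. g' b c * conn i b d) *\<^sub>R (\<tau> c * conn_tau s d))"
    unfolding scaleR_sum_left by (subst sum3_reverse) (simp add: sum_distrib_left scaleR_sum_right sum_negf)
  also have "\<dots> = (\<Sum>d<r. \<Sum>c<r. \<Sum>b<r. (g' d b * conn i b c) *\<^sub>R (\<tau> c * conn_tau s d))"
    by (simp add: conn_skew'[OF i] sum_negf scaleR_sum_left)
  also have "\<dots> = (\<Sum>d<r. \<Sum>b<r. g' d b *\<^sub>R (conn_tau i b * conn_tau s d))"
    unfolding conn_tau_def[of i]
    by (rule trans[OF sum.cong[OF refl sum.swap]]) (simp add: sum_distrib_right scaleR_sum_right)
  also have "\<dots> = Qf i s"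
    unfolding Qf_def by (subst sum.swap) (intro sum.cong refl, simp add: g'_sym)
  finally show ?thesis .
qed

text \<open>
\<open>{p\<^sub>i, p\<^sub>j} = 0\<close>, computed in the coordinates \<open>k'\<close>.
\<close>

lemma dP_antisym:
  assumes i: "i < n" and j: "j < n"
  shows "Y j i - Y i j = (\<Sum>b<r. \<Sum>c<r. h' b c *\<^sub>R (W i b * W j c))"
proof -
  have Yq: "Y s i = ((\<Sum>j<n. dq k s (dq k i (\<lambda>x. q_coord k' x j)) m *\<^sub>R p_gen j) + (1/2) *\<^sub>R (\<Sum>a<r. \<Sum>b<r. \<Sum>c<r.
     (g' b c * dq k s (dq k i (\<lambda>x. Cmat x b a)) m) *\<^sub>R (\<tau> c * T m a))) + (1/2) *\<^sub>R Qf i s" if "s < n" "i < n" for s i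
    unfolding Y_def Qf_Y[OF that, symmetric] by (simp add: sum.distrib scaleR_add_right)
  have c1: "dq k j (dq k i (\<lambda>x. q_coord k' x l)) m = dq k i (dq k j (\<lambda>x. q_coord k' x l)) m" if "l < n" for l
    by (rule dq_commute[OF k \<U>(1,2,4) j i chart_smooth_q[OF that]])
  have c2: "dq k j (dq k i (\<lambda>x. Cmat x b a)) m = dq k i (dq k j (\<lambda>x. Cmat x b a)) m" if "a < r" "b < r" for a b
    by (rule dq_commute[OF k \<U>(1,2,4) j i chart_smooth_C[OF that(2,1)]])
  have "Y j i - Y i j = (1/2) *\<^sub>R Qf i j - (1/2) *\<^sub>R Qf j i"
  proof -
    have "(\<Sum>l<n. dq k j (dq k i (\<lambda>x. q_coord k' x l)) m *\<^sub>R p_gen l) = (\<Sum>l<n. dq k i (dq k j (\<lambda>x. q_coord k' x l)) m *\<^sub>R p_gen l)"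
      by (rule sum.cong[OF refl]) (use c1 in auto)
    moreover have "(\<Sum>a<r. \<Sum>b<r. \<Sum>c<r. (g' b c * dq k j (dq k i (\<lambda>x. Cmat x b a)) m) *\<^sub>R (\<tau> c * T m a)) =
      (\<Sum>a<r. \<Sum>b<r. \<Sum>c<r. (g' b c * dq k i (dq k j (\<lambda>x. Cmat x b a)) m) *\<^sub>R (\<tau> c * T m a))"
    proof (intro sum.cong refl)
      fix a b c assume "a \<in> {..<r}" "b \<in> {..<r}"
      thus "(g' b c * dq k j (dq k i (\<lambda>x. Cmat x b a)) m) *\<^sub>R (\<tau> c * T m a) =
        (g' b c * dq k i (dq k j (\<lambda>x. Cmat x b a)) m) *\<^sub>R (\<tau> c * T m a)" using c2[of a b] by simp
    qed
    ultimately show ?thesis unfolding Yq[OF j i] Yq[OF i j] by simp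
  qed
  also have "\<dots> = Qf i j" unfolding Qf_skew[of j i] by (simp flip: scaleR_2)
  also have "\<dots> = (\<Sum>b<r. \<Sum>c<r. h' b c *\<^sub>R (W i b * W j c))"
  proof -
    have "(\<Sum>b<r. \<Sum>c<r. h' b c *\<^sub>R (W i b * W j c)) = (\<Sum>b<r. W i b * (\<Sum>c<r. h' b c *\<^sub>R W j c))"
      by (simp add: sum_distrib_left)
    also have "\<dots> = (\<Sum>b<r. W i b * conn_tau j b)"
    proof (intro sum.cong refl arg_cong2[of _ _ _ _ "(*)"])
      fix b assume b: "b \<in> {..<r}"
      have "(\<Sum>c<r. h' b c *\<^sub>R W j c) = (\<Sum>c<r. \<Sum>\<beta><r. (h' b c * g' c \<beta>) *\<^sub>R conn_tau j \<beta>)"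
        by (intro sum.cong refl) (simp add: W_eq'[OF j] scaleR_sum_right)
      also have "\<dots> = (\<Sum>\<beta><r. mat_mult r h' g' b \<beta> *\<^sub>R conn_tau j \<beta>)"
        using b by (subst sum.swap) (simp add: mat_mult_def scaleR_sum_left)
      also have "\<dots> = conn_tau j b" unfolding h'_props using b
        by (simp add: mat_one_def if_distrib[of "\<lambda>y. y *\<^sub>R _"] cong: if_cong)
      finally show "(\<Sum>c<r. h' b c *\<^sub>R W j c) = conn_tau j b" .
    qed
    also have "\<dots> = (\<Sum>b<r. \<Sum>\<beta><r. g' \<beta> b *\<^sub>R (conn_tau i \<beta> * conn_tau j b))"
      by (intro sum.cong refl) (simp add: W_eq[OF i] sum_distrib_right)
    also have "\<dots> = Qf i j" unfolding Qf_def by (rule sum.swap)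
    finally show ?thesis ..
  qed
  finally show ?thesis .
qed

text \<open>
\<open>{\<tau>\<^sup>a, \<tau>\<^sup>d} = g\<^sup>a\<^sup>d\<close>, computed in the coordinates \<open>k'\<close>.
\<close>

lemma gram_inv_change:
  assumes "a < r" "d < r"
  shows "(\<Sum>b<r. \<Sum>c<r. h' b c * (Bmat m a b * Bmat m d c)) = gram_inv k m a d"
proof -
  let ?X = "mat_mult r (Bmat m) (mat_mult r h' (mat_tp (Bmat m)))"
  have tt: "mat_mult r (mat_tp (Bmat m)) (mat_tp (Cmat m)) = mat_one r" using arg_cong[OF CB[OF \<U>(4)], of mat_tp] by (simp add: mat_tp_mat_mult)
  have "mat_mult r ?X (gram E k m) = mat_mult r ?X (mat_trunc r (gram E k m))" by simp
  also have "\<dots> = mat_mult r (mat_mult r (Bmat m) h') (mat_mult r (mat_mult r (mat_tp (Bmat m)) (mat_tp (Cmat m))) (mat_mult r g' (Cmat m)))"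
    unfolding gram_eq_mat_mult by (simp only: mat_mult_assoc)
  also have "\<dots> = mat_mult r (Bmat m) (mat_mult r (mat_mult r h' g') (Cmat m))" unfolding tt by (simp add: mat_mult_assoc)
  also have "\<dots> = mat_one r" unfolding h'_props by (simp add: BC[OF \<U>(4)])
  finally have "mat_trunc r ?X = gram_inv k m" unfolding gram_inv_def by (rule inverse_gram(5)[OF k m])
  hence "gram_inv k m = mat_mult r (Bmat m) (mat_mult r h' (mat_tp (Bmat m)))" by simp
  thus ?thesis using assms by (simp add: mat_mult_def mat_tp_def sum_distrib_left mult_ac)
qed

lemma deriv_in_k:
  assumes "l < n" "chart_smooth E k \<U> f"
  shows "((\<lambda>t. f (coord_curve k' m l t)) has_real_derivative (\<Sum>s<n. A l s * dq k s f m)) (at (q_coord k' m l))"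
  unfolding A_def using chart_chain[OF k k' \<U>(1) order_refl \<U>(4) assms] .

lemma coord_curve'_0: "coord_curve k' m l (q_coord k' m l) = m"
  by (rule coord_curve_self[OF k' m'])

lemma sum_scaleR_swap: "(\<Sum>s<n. x s *\<^sub>R (\<Sum>a\<in>X. f s a)) = (\<Sum>a\<in>X. \<Sum>s<n. x s *\<^sub>R (f s a :: spoly))"
  unfolding scaleR_sum_right by (rule sum.swap)

lemma has_sderiv_T:
  assumes l: "l < n" and a: "a < r"
  shows "has_sderiv (q_coord k' m l) (\<lambda>t. T (coord_curve k' m l t) a) (\<Sum>s<n. A l s *\<^sub>R V s a)"
proof -
  have "(\<Sum>s<n. A l s *\<^sub>R V s a) = (\<Sum>b<r. (\<Sum>s<n. A l s * dB s a b) *\<^sub>R \<tau> b)"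
    unfolding V_def sum_scaleR_swap by (simp add: scaleR_sum_left)
  thus ?thesis unfolding T_def dB_def
    by (simp only:) (intro has_sderiv_sum has_sderiv_scaleR_fun deriv_in_k[OF l chart_smooth_B], use a in auto)
qed

lemma has_sderiv_P:
  assumes l: "l < n" and i: "i < n"
  shows "has_sderiv (q_coord k' m l) (\<lambda>t. P (coord_curve k' m l t) i) (\<Sum>s<n. A l s *\<^sub>R Y s i)"
proof -
  let ?t = "q_coord k' m l"
  let ?D = "(\<Sum>j<n. (\<Sum>s<n. A l s * dq k s (dq k i (\<lambda>x. q_coord k' x j)) m) *\<^sub>R p_gen j) +
    (1/2) *\<^sub>R (\<Sum>a<r. \<Sum>b<r. \<Sum>c<r.
       (g' b c * (\<Sum>s<n. A l s * dq k s (dq k i (\<lambda>x. Cmat x b a)) m)) *\<^sub>R (\<tau> c * T (coord_curve k' m l ?t) a) +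
       (g' b c * dq k i (\<lambda>x. Cmat x b a) (coord_curve k' m l ?t)) *\<^sub>R (\<tau> c * (\<Sum>s<n. A l s *\<^sub>R V s a)))"
  have "has_sderiv ?t (\<lambda>t. P (coord_curve k' m l t) i) ?D"
    unfolding P_def
    by (intro has_sderiv_add has_sderiv_sum has_sderiv_scaleR_fun has_sderiv_scaleR_const has_sderiv_scaleR DERIV_cmult has_sderiv_mult_const has_sderiv_T[OF l]
        deriv_in_k[OF l chart_smooth_dq[OF k \<U>(1,2) i]] chart_smooth_q chart_smooth_C) auto
  moreover have "?D = (\<Sum>s<n. A l s *\<^sub>R Y s i)"
  proof -
    have "(\<Sum>s<n. A l s *\<^sub>R Y s i) =
      (\<Sum>s<n. A l s *\<^sub>R (\<Sum>j<n. dq k s (dq k i (\<lambda>x. q_coord k' x j)) m *\<^sub>R p_gen j)) +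
      (1/2) *\<^sub>R (\<Sum>s<n. A l s *\<^sub>R (\<Sum>a<r. \<Sum>b<r. \<Sum>c<r.
         (g' b c * dq k s (dq k i (\<lambda>x. Cmat x b a)) m) *\<^sub>R (\<tau> c * T m a) + (g' b c * dC i b a) *\<^sub>R (\<tau> c * V s a)))"
      unfolding Y_def scaleR_add_right sum.distrib scaleR_sum_right by (simp add: mult.commute)
    also have "\<dots> = ?D"
      unfolding sum_scaleR_swap coord_curve'_0 dC_def[symmetric]
    proof (intro arg_cong2[of _ _ _ _ "(+)"] arg_cong[of _ _ "scaleR (1/2)"] sum.cong refl)
      fix j show "(\<Sum>s<n. A l s *\<^sub>R dq k s (dq k i (\<lambda>x. q_coord k' x j)) m *\<^sub>R p_gen j) =
        (\<Sum>s<n. A l s * dq k s (dq k i (\<lambda>x. q_coord k' x j)) m) *\<^sub>R p_gen j"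
        by (simp add: scaleR_sum_left)
    next
      fix a b c
      have 1: "(\<Sum>s<n. A l s *\<^sub>R (x * y s) *\<^sub>R Z) = (x * (\<Sum>s<n. A l s * y s)) *\<^sub>R Z" for x y and Z :: spoly
        by (simp add: scaleR_sum_left sum_distrib_left mult.left_commute)
      have 2: "(\<Sum>s<n. A l s *\<^sub>R x *\<^sub>R (Z * v s)) = x *\<^sub>R (Z * (\<Sum>s<n. A l s *\<^sub>R v s))" for x v and Z :: spoly
        by (simp add: scaleR_sum_right sum_distrib_left mult.commute)
      show "(\<Sum>s<n. A l s *\<^sub>R ((g' b c * dq k s (dq k i (\<lambda>x. Cmat x b a)) m) *\<^sub>R (\<tau> c * T m a) + (g' b c * dC i b a) *\<^sub>R (\<tau> c * V s a))) =
        (g' b c * (\<Sum>s<n. A l s * dq k s (dq k i (\<lambda>x. Cmat x b a)) m)) *\<^sub>R (\<tau> c * T m a) +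
        (g' b c * dC i b a) *\<^sub>R (\<tau> c * (\<Sum>s<n. A l s *\<^sub>R V s a))"
        unfolding scaleR_add_right sum.distrib 1 2 ..
    qed
    finally show ?thesis ..
  qed
  ultimately show ?thesis by simp
qed

lemma has_sderiv_smooth:
  assumes l: "l < n" and F: "smooth_homog k \<U> d F"
  shows "has_sderiv (q_coord k' m l) (\<lambda>t. F (coord_curve k' m l t)) (\<Sum>s<n. A l s *\<^sub>R Dq k s F m)"
  unfolding has_sderiv_def
proof (intro allI)
  fix S K
  have "coef (\<Sum>s<n. A l s *\<^sub>R Dq k s F m) S K = (\<Sum>s<n. A l s * dq k s (\<lambda>x. coef (F x) S K) m)"
    using loc.coef_Dq[OF F \<U>(4)] by simp
  thus "((\<lambda>t. coef (F (coord_curve k' m l t)) S K) has_real_derivative coef (\<Sum>s<n. A l s *\<^sub>R Dq k s F m) S K) (at (q_coord k' m l))"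
    using deriv_in_k[OF l smooth_homog_coef[OF F, of S K]] by simp
qed

lemma coef_T: "coef (T x a) = tau_change E k k' x a"
  by (intro ext) (simp add: T_def tau_change_def \<tau>.rep_eq Bmat_def)

lemma coef_P:
  assumes "x \<in> \<U>" shows "coef (P x i) = p_change E k k' x i"
proof (intro ext)
  fix S K
  have "gram E k' x b c = g' b c" if "b < r" "c < r" for b c
    unfolding g'_def using coord_systemsD(3)[OF k' that] assms m' by blast
  thus "coef (P x i) S K = p_change E k k' x i S K"
    by (simp add: P_def p_change_def p_gen.rep_eq coef_mult \<tau>.rep_eq coef_T Cmat_def)
qed

lemma super_subst_eq_hom:
  "x \<in> \<U> \<Longrightarrow> super_subst (tau_change E k k' x) (p_change E k k' x) (coef Q) = coef (hom (T x) (P x) Q)"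
  unfolding coef_hom coef_T by (simp add: coef_P)

lemma local_expr_change:
  assumes F: "F \<in> graded_functions E d" and x: "x \<in> \<U>"
  shows "local_expr k' F x = hom (T x) (P x) (local_expr k F x)"
proof (rule coef_inject[THEN iffD1])
  have "F k' x = super_subst (tau_change E k k' x) (p_change E k k' x) (F k x)"
    using F k k' x unfolding graded_functions_def by blast
  thus "coef (local_expr k' F x) = coef (hom (T x) (P x) (local_expr k F x))"
    by (simp add: coef_local_expr[OF F] flip: super_subst_eq_hom[OF x])
qed

text \<open>
The chain rule for a graded function in the base directions of \<open>k'\<close>; the derivatives are those in the base coordinates of \<open>k\<close>, contracted with \<open>A\<close>.
\<close>

lemma Dq_change:
  assumes F: "F \<in> graded_functions E d" and l: "l < n"
  shows "Dq k' l (local_expr k' F) m = (\<Sum>s<n. A l s *\<^sub>R (hom (T m) (P m) (Dq k s (local_expr k F) m) +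
     ((\<Sum>a<r. V s a * hom (T m) (P m) (D\<tau> a (local_expr k F m))) + (\<Sum>i<n. Y s i * hom (T m) (P m) (Dp i (local_expr k F m))))))"
proof (rule Dq_eqI)
  let ?c = "coord_curve k' m l" and ?t = "q_coord k' m l" and ?\<Phi> = "hom (T m) (P m)"
  have smF: "smooth_homog k \<U> d (local_expr k F)" by (rule smooth_homog_subset[OF smooth_homog_local_expr[OF F k]]) simp
  have ev: "\<forall>\<^sub>F t in nhds ?t. ?c t \<in> \<U>" by (rule coord_curve_eventually[OF k' \<U>(1,3,4) l])
  have 1: "has_sderiv ?t (\<lambda>t. hom (T (?c t)) (P (?c t)) (local_expr k F (?c t)))
    (hom (T (?c ?t)) (P (?c ?t)) (\<Sum>s<n. A l s *\<^sub>R Dq k s (local_expr k F) m) +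
    ((\<Sum>a<r. (\<Sum>s<n. A l s *\<^sub>R V s a) * hom (T (?c ?t)) (P (?c ?t)) (D\<tau> a (local_expr k F (?c ?t)))) +
     (\<Sum>i<n. (\<Sum>s<n. A l s *\<^sub>R Y s i) * hom (T (?c ?t)) (P (?c ?t)) (Dp i (local_expr k F (?c ?t))))))"
  proof (rule has_sderiv_hom[where d = d and T = "\<lambda>t. T (?c t)" and P = "\<lambda>t. P (?c t)" and F = "\<lambda>t. local_expr k F (?c t)" and
        X = "\<lambda>a. \<Sum>s<n. A l s *\<^sub>R V s a" and Y = "\<lambda>i. \<Sum>s<n. A l s *\<^sub>R Y s i" and D = "\<Sum>s<n. A l s *\<^sub>R Dq k s (local_expr k F) m"])
    show "eps (T (?c t) c) = - T (?c t) c" for t c by (rule T_odd)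
    show "eps (P (?c t) i) = P (?c t) i" for t i by (rule P_even)
    show "eps (\<Sum>s<n. A l s *\<^sub>R V s c) = - (\<Sum>s<n. A l s *\<^sub>R V s c)" for c by (simp add: V_odd sum_negf)
    show "eps (\<Sum>s<n. A l s *\<^sub>R Y s i) = (\<Sum>s<n. A l s *\<^sub>R Y s i)" for i by (simp add: Y_even)
    show "\<forall>\<^sub>F t in nhds ?t. homog r n d (local_expr k F (?c t))"
      using ev by (rule eventually_mono) (rule smooth_homog_homog[OF smF])
    show "has_sderiv ?t (\<lambda>t. local_expr k F (?c t)) (\<Sum>s<n. A l s *\<^sub>R Dq k s (local_expr k F) m)"
      by (rule has_sderiv_smooth[OF l smF])
  qed (fact has_sderiv_T[OF l] has_sderiv_P[OF l])+
  have 2: "\<forall>\<^sub>F t in nhds ?t. hom (T (?c t)) (P (?c t)) (local_expr k F (?c t)) = local_expr k' F (?c t)"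
    using ev by (rule eventually_mono) (rule local_expr_change[OF F, symmetric])
  have "has_sderiv ?t (\<lambda>t. local_expr k' F (?c t)) (?\<Phi> (\<Sum>s<n. A l s *\<^sub>R Dq k s (local_expr k F) m) +
    ((\<Sum>a<r. (\<Sum>s<n. A l s *\<^sub>R V s a) * ?\<Phi> (D\<tau> a (local_expr k F m))) +
     (\<Sum>i<n. (\<Sum>s<n. A l s *\<^sub>R Y s i) * ?\<Phi> (Dp i (local_expr k F m)))))"
    using has_sderiv_cong[OF 2 1] unfolding coord_curve'_0 .
  moreover have "?\<Phi> (\<Sum>s<n. A l s *\<^sub>R Dq k s (local_expr k F) m) +
    ((\<Sum>a<r. (\<Sum>s<n. A l s *\<^sub>R V s a) * ?\<Phi> (D\<tau> a (local_expr k F m))) +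
     (\<Sum>i<n. (\<Sum>s<n. A l s *\<^sub>R Y s i) * ?\<Phi> (Dp i (local_expr k F m)))) =
    (\<Sum>s<n. A l s *\<^sub>R (?\<Phi> (Dq k s (local_expr k F) m) +
     ((\<Sum>a<r. V s a * ?\<Phi> (D\<tau> a (local_expr k F m))) + (\<Sum>i<n. Y s i * ?\<Phi> (Dp i (local_expr k F m))))))"
    unfolding scaleR_add_right sum.distrib sum_scaleR_swap by (simp add: sum_distrib_right)
  ultimately show "has_sderiv ?t (\<lambda>t. local_expr k' F (?c t)) (\<Sum>s<n. A l s *\<^sub>R (?\<Phi> (Dq k s (local_expr k F) m) +
     ((\<Sum>a<r. V s a * ?\<Phi> (D\<tau> a (local_expr k F m))) + (\<Sum>i<n. Y s i * ?\<Phi> (Dp i (local_expr k F m))))))"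
    by (simp only:)
qed

lemma homog_supp_weak: "homog r n d Q \<Longrightarrow> supp Q \<subseteq> {(S, K). S \<subseteq> {..<r} \<and> set_mset K \<subseteq> {..<n}}"
  unfolding homog_supp by (erule subset_trans) auto

lemma Dp_change:
  assumes "homog r n d B" "l < n"
  shows "Dp l (hom (T m) (P m) B) = (\<Sum>i<n. J i l *\<^sub>R hom (T m) (P m) (Dp i B))"
proof -
  have "Dp l (hom (T m) (P m) B) = (\<Sum>a<r. 0 * hom (T m) (P m) (D\<tau> a B)) + (\<Sum>i<n. (J i l *\<^sub>R 1) * hom (T m) (P m) (Dp i B))"
    by (rule sub.hom_chain_rel[OF homog_supp_weak[OF assms(1)], where R = "\<lambda>A D. Dp l (hom (T m) (P m) A) = D" and s = 1])
       (simp_all add: Dp_mult Dp_T Dp_P[OF assms(2)])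
  thus ?thesis by simp
qed

lemma D\<tau>_change:
  assumes "homog r n d B" "b < r"
  shows "D\<tau> b (hom (T m) (P m) B) = (\<Sum>a<r. Bmat m a b *\<^sub>R hom (T m) (P m) (D\<tau> a B)) + (\<Sum>i<n. W i b * hom (T m) (P m) (Dp i B))"
proof -
  have W: "T m c * W i b = - (W i b * T m c)" for i c
    using odd_mult_commute[OF T_odd, of m c "W i b"] by (simp add: W_odd)
  have "D\<tau> b (hom (T m) (P m) B) = (\<Sum>a<r. (Bmat m a b *\<^sub>R 1) * hom (T m) (P m) (D\<tau> a B)) + (\<Sum>i<n. W i b * hom (T m) (P m) (Dp i B))"
    by (rule sub.hom_chain_rel[OF homog_supp_weak[OF assms(1)], where R = "\<lambda>A D. D\<tau> b (hom (T m) (P m) A) = D" and s = "- 1"])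
       (simp_all add: D\<tau>_mult D\<tau>_T[OF assms(2)] T_odd P_even W W_def[symmetric])
  thus ?thesis by simp
qed

lemma jacobian_contraction: "i < n \<Longrightarrow> s < n \<Longrightarrow> (\<Sum>l<n. J i l * A l s) = (if s = i then 1 else 0)"
  unfolding J_def A_def by (rule jacobian_inverse[OF k k' m m'])

proposition bracket_change:
  assumes F: "F \<in> graded_functions E d" and G: "G \<in> graded_functions E e"
  shows "pbracket k' (gram_inv k' m) (local_expr k' F) (local_expr k' G) m = hom (T m) (P m) (pbracket k (gram_inv k m) (local_expr k F) (local_expr k G) m)"
proof -
  let ?\<Phi> = "hom (T m) (P m)" and ?F = "local_expr k F" and ?G = "local_expr k G"
  let ?d = "\<lambda>F s. ?\<Phi> (Dq k s F m) + ((\<Sum>a<r. V s a * ?\<Phi> (D\<tau> a (F m))) + (\<Sum>i<n. Y s i * ?\<Phi> (Dp i (F m))))"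
  let ?t = "\<lambda>F b. (\<Sum>a<r. Bmat m a b *\<^sub>R ?\<Phi> (D\<tau> a (F m))) + (\<Sum>i<n. W i b * ?\<Phi> (Dp i (F m)))"
  have hF: "homog r n d (?F m)" and hG: "homog r n e (?G m)"
    using smooth_homog_homog[OF smooth_homog_local_expr[OF F k] m] smooth_homog_homog[OF smooth_homog_local_expr[OF G k] m] .
  have fF: "local_expr k' F m = ?\<Phi> (?F m)" and fG: "local_expr k' G m = ?\<Phi> (?G m)"
    using local_expr_change F G \<U>(4) by blast+
  have contract: "(\<Sum>l<n. (\<Sum>s<n. A l s *\<^sub>R x s) * (\<Sum>i<n. J i l *\<^sub>R y i)) = (\<Sum>s<n. x s * y s)" for x y :: "nat \<Rightarrow> spoly"
  proof -
    have "(\<Sum>l<n. (\<Sum>s<n. A l s *\<^sub>R x s) * (\<Sum>i<n. J i l *\<^sub>R y i)) = (\<Sum>l<n. \<Sum>s<n. \<Sum>i<n. (J i l * A l s) *\<^sub>R (x s * y i))"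
      unfolding sum_product by (simp add: mult.commute)
    also have "\<dots> = (\<Sum>s<n. \<Sum>i<n. (\<Sum>l<n. J i l * A l s) *\<^sub>R (x s * y i))"
      by (subst sum3_rotate) (simp add: scaleR_sum_left)
    also have "\<dots> = (\<Sum>s<n. \<Sum>i<n. if i = s then x s * y s else 0)"
      by (intro sum.cong refl) (use jacobian_contraction in auto)
    finally show ?thesis by simp
  qed
  have contract': "(\<Sum>l<n. (\<Sum>i<n. J i l *\<^sub>R y i) * (\<Sum>s<n. A l s *\<^sub>R x s)) = (\<Sum>s<n. y s * x s)" for x y :: "nat \<Rightarrow> spoly"
  proof -
    have "(\<Sum>l<n. (\<Sum>i<n. J i l *\<^sub>R y i) * (\<Sum>s<n. A l s *\<^sub>R x s)) = (\<Sum>l<n. \<Sum>i<n. \<Sum>s<n. (J i l * A l s) *\<^sub>R (y i * x s))"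
      unfolding sum_product by (simp add: mult.commute)
    also have "\<dots> = (\<Sum>i<n. \<Sum>s<n. (\<Sum>l<n. J i l * A l s) *\<^sub>R (y i * x s))"
      by (subst sum3_rotate) (simp add: scaleR_sum_left)
    also have "\<dots> = (\<Sum>i<n. \<Sum>s<n. if s = i then y i * x i else 0)"
      by (intro sum.cong refl) (use jacobian_contraction in auto)
    finally show ?thesis by simp
  qed
  have "pbracket k' (gram_inv k' m) (local_expr k' F) (local_expr k' G) m =
     (\<Sum>l<n. (\<Sum>s<n. A l s *\<^sub>R ?d ?F s) * (\<Sum>i<n. J i l *\<^sub>R ?\<Phi> (Dp i (?G m))) -
        (\<Sum>i<n. J i l *\<^sub>R ?\<Phi> (Dp i (?F m))) * (\<Sum>s<n. A l s *\<^sub>R ?d ?G s)) +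
     (\<Sum>b<r. \<Sum>c<r. h' b c *\<^sub>R (eps (?t ?F b) * ?t ?G c))"
    unfolding pbracket_def h'_def[symmetric] fF fG
  proof (intro arg_cong2[of _ _ _ _ "(+)"] sum.cong refl)
    fix l assume "l \<in> {..<n}"
    hence l: "l < n" by simp
    show "Dq k' l (local_expr k' F) m * Dp l (?\<Phi> (?G m)) - Dp l (?\<Phi> (?F m)) * Dq k' l (local_expr k' G) m =
      (\<Sum>s<n. A l s *\<^sub>R ?d ?F s) * (\<Sum>i<n. J i l *\<^sub>R ?\<Phi> (Dp i (?G m))) -
        (\<Sum>i<n. J i l *\<^sub>R ?\<Phi> (Dp i (?F m))) * (\<Sum>s<n. A l s *\<^sub>R ?d ?G s)"
      unfolding Dq_change[OF F l] Dq_change[OF G l] Dp_change[OF hF l] Dp_change[OF hG l] ..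
  next
    fix b c assume "b \<in> {..<r}" "c \<in> {..<r}"
    hence bc: "b < r" "c < r" by simp_all
    show "h' b c *\<^sub>R (eps (D\<tau> b (?\<Phi> (?F m))) * D\<tau> c (?\<Phi> (?G m))) = h' b c *\<^sub>R (eps (?t ?F b) * ?t ?G c)"
      unfolding D\<tau>_change[OF hF bc(1)] D\<tau>_change[OF hG bc(2)] ..
  qed
  also have "\<dots> = (\<Sum>s<n. ?d ?F s * ?\<Phi> (Dp s (?G m)) - ?\<Phi> (Dp s (?F m)) * ?d ?G s) +
     (\<Sum>b<r. \<Sum>c<r. h' b c *\<^sub>R (eps (?t ?F b) * ?t ?G c))"
    by (simp only: sum_subtractf contract contract')
  also have "\<dots> = ?\<Phi> ((\<Sum>s<n. Dq k s ?F m * Dp s (?G m) - Dp s (?F m) * Dq k s ?G m) +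
     (\<Sum>a<r. \<Sum>d<r. gram_inv k m a d *\<^sub>R (eps (D\<tau> a (?F m)) * D\<tau> d (?G m))))"
  proof (rule sub.bracket_invariance_pointwise[where \<sigma> = "(- 1) ^ d" and h = "gram_inv k m"])
    show "eps (D\<tau> a (?F m)) = - ((- 1) ^ d) *\<^sub>R D\<tau> a (?F m)" for a
      by (simp add: eps_D\<tau> homog_eps[OF hF])
    show "eps (Dp i (?F m)) = (- 1) ^ d *\<^sub>R Dp i (?F m)" for i
      by (simp add: eps_Dp homog_eps[OF hF])
    show "(- 1) ^ d * (- 1) ^ d = (1::real)" by (simp flip: power_mult_distrib)
  qed (fact V_odd W_odd Y_even gram_inv_change W_contraction W_contraction' dP_antisym)+
  finally show ?thesis by (simp add: pbracket_def)
qed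

end

context metric_bundle
begin

text \<open>
Both degrees are at least 2, which suffices here and avoids a case distinction for the truncated subtraction of degrees.
\<close>

proposition bracket_graded:
  assumes F: "F \<in> graded_functions E (d + 2)" and G: "G \<in> graded_functions E (e + 2)"
  shows "bracket E F G \<in> graded_functions E (d + e + 2)"
  unfolding graded_functions_def
proof (intro CollectI conjI ballI allI impI)
  fix k m S K assume nz: "bracket E F G k m S K \<noteq> 0"
  show k: "k \<in> \<K>" and m: "m \<in> patch k" using nz by (auto simp: bracket_def split: if_splits)
  interpret local_coords E k "patch k" by (rule local_coords_patch[OF k])
  have "homog r n (d + e + 2) (pbracket k (gram_inv k m) (local_expr k F) (local_expr k G) m)"
    by (rule smooth_homog_homog[OF smooth_homog_pbracket[OF smooth_homog_local_expr[OF F k] smooth_homog_local_expr[OF G k]] m])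
  from homogD[OF this, of S K] nz
  show "S \<subseteq> {..<r}" "set_mset K \<subseteq> {..<n}" "card S + 2 * size K = d + e + 2"
    unfolding bracket_eq_pbracket[OF F G k m] by blast+
next
  fix k S K assume k: "k \<in> \<K>"
  interpret local_coords E k "patch k" by (rule local_coords_patch[OF k])
  \<comment> \<open>an arbitrary choice if the domain is empty\<close>
  define h where "h = gram_inv k (SOME x. x \<in> patch k)"
  have h: "gram_inv k x = h" if "x \<in> patch k" for x
    unfolding h_def using gram_inv_const[OF k that someI[of "\<lambda>x. x \<in> patch k", OF that]] .
  have "chart_smooth E k (patch k) (\<lambda>x. coef (pbracket k h (local_expr k F) (local_expr k G) x) S K)"
    by (rule smooth_homog_coef[OF smooth_homog_pbracket[OF smooth_homog_local_expr[OF F k] smooth_homog_local_expr[OF G k]]])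
  hence "chart_smooth E k (patch k) (\<lambda>x. bracket E F G k x S K)"
    by (rule chart_smooth_cong[OF k U, rotated]) (simp add: bracket_eq_pbracket[OF F G k] h)
  thus "smooth_on n (q_coord k ` patch k) (\<lambda>x. bracket E F G k (inv_into (patch k) (q_coord k) x) S K)"
    by (simp add: chart_smooth_def)
next
  fix k k' m assume k: "k \<in> \<K>" and k': "k' \<in> \<K>" and mo: "m \<in> patch k \<inter> patch k'"
  interpret overlap E k k' m by unfold_locales (use k k' mo in auto)
  show "bracket E F G k' m = super_subst (tau_change E k k' m) (p_change E k k' m) (bracket E F G k m)"
    using mo unfolding bracket_eq_pbracket[OF F G k m] bracket_eq_pbracket[OF F G k' m']
    by (simp add: super_subst_eq_hom bracket_change[OF F G])
qed

section \<open>The function associated with a skew-symmetric endomorphism\<close>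

text \<open>
The coefficients \<open>\<langle>N e\<^sub>a, e\<^sub>b\<rangle>\<close>, and the function \<open>\<onehalf> \<langle>N e\<^sub>a, e\<^sub>b\<rangle> \<tau>\<^sup>a \<tau>\<^sup>b\<close> in a coordinate system and as a family.
\<close>

definition endo_coeff :: "('m \<Rightarrow> 'v \<Rightarrow> 'v) \<Rightarrow> ('m, 'v) coords \<Rightarrow> 'm \<Rightarrow> nat \<Rightarrow> nat \<Rightarrow> real" where
  "endo_coeff N k m a b = form E m (N m (e_frame k a m)) (e_frame k b m)"

definition endo_spoly :: "('m \<Rightarrow> 'v \<Rightarrow> 'v) \<Rightarrow> ('m, 'v) coords \<Rightarrow> 'm \<Rightarrow> spoly" where
  "endo_spoly N k m = (1/2) *\<^sub>R (\<Sum>a<r. \<Sum>b<r. endo_coeff N k m a b *\<^sub>R (\<tau> a * \<tau> b))"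

definition endo_function :: "('m \<Rightarrow> 'v \<Rightarrow> 'v) \<Rightarrow> ('m, 'v) family" where
  "endo_function N = (\<lambda>k m S K. if k \<in> \<K> \<and> m \<in> patch k then coef (endo_spoly N k m) S K else 0)"

lemma endo_fibre: "bundle_endomorphism E N \<Longrightarrow> v \<in> fibre E m \<Longrightarrow> N m v \<in> fibre E m"
  unfolding bundle_endomorphism_def by blast

lemma endo_sum:
  assumes N: "bundle_endomorphism E N" and v: "\<And>x. x \<in> X \<Longrightarrow> v x \<in> fibre E m" and X: "finite X"
  shows "N m (\<Sum>x\<in>X. c x *\<^sub>R v x) = (\<Sum>x\<in>X. c x *\<^sub>R N m (v x))"
  using X v
proof (induction X rule: finite_induct)
  case empty
  have "N m (0 *\<^sub>R 0) = 0 *\<^sub>R N m 0"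
    using N subspace_0[OF fibre_subspace[of m]] unfolding bundle_endomorphism_def by blast
  thus ?case by simp
next
  case (insert x X)
  have 1: "c x *\<^sub>R v x \<in> fibre E m" using insert.prems by (intro subspace_scale fibre_subspace) auto
  have 2: "(\<Sum>x\<in>X. c x *\<^sub>R v x) \<in> fibre E m" using insert.prems
    by (intro subspace_sum subspace_scale fibre_subspace) auto
  have "N m (c x *\<^sub>R v x + (\<Sum>x\<in>X. c x *\<^sub>R v x)) = N m (c x *\<^sub>R v x) + N m (\<Sum>x\<in>X. c x *\<^sub>R v x)"
    using N 1 2 unfolding bundle_endomorphism_def by blast
  moreover have "N m (c x *\<^sub>R v x) = c x *\<^sub>R N m (v x)"
    using N insert.prems[of x] unfolding bundle_endomorphism_def by blast
  ultimately show ?case using insert by simp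
qed

lemma endo_coeff_skew:
  assumes "skew_endomorphism E N" "k \<in> \<K>" "m \<in> patch k" "a < r" "b < r"
  shows "endo_coeff N k m a b = - endo_coeff N k m b a"
proof -
  note f = frame_in_fibre[OF coord_systemsD(2)[OF assms(2)] assms(3)]
  have "bundle_endomorphism E N" using assms(1) by (simp add: skew_endomorphism_def)
  have "form E m (N m (e_frame k a m)) (e_frame k b m) + form E m (e_frame k a m) (N m (e_frame k b m)) = 0"
    using assms(1) f[OF assms(4)] f[OF assms(5)] unfolding skew_endomorphism_def by blast
  moreover have "form E m (e_frame k a m) (N m (e_frame k b m)) = form E m (N m (e_frame k b m)) (e_frame k a m)"
    by (rule form_sym) (use f assms endo_fibre[OF \<open>bundle_endomorphism E N\<close>] in auto)
  ultimately show ?thesis by (simp add: endo_coeff_def)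
qed

lemma endo_coeff_change:
  assumes N: "bundle_endomorphism E N" and k: "k \<in> \<K>" "m \<in> patch k" and v: "v \<in> fibre E m" "w \<in> fibre E m"
  shows "form E m (N m v) w = (\<Sum>a<r. \<Sum>b<r. component E (e_frame k) m v a * component E (e_frame k) m w b * endo_coeff N k m a b)"
proof -
  let ?c = "component E (e_frame k) m"
  note f = frame_in_fibre[OF coord_systemsD(2)[OF k(1)] k(2)]
  note ex = comp_expand[OF coord_systemsD(2)[OF k(1)] k(2)]
  have "form E m (N m v) w = form E m (N m (\<Sum>a<r. ?c v a *\<^sub>R e_frame k a m)) w"
    using ex[OF v(1)] by simp
  also have "\<dots> = form E m (\<Sum>a<r. ?c v a *\<^sub>R N m (e_frame k a m)) w"
    using f by (subst endo_sum[OF N]) auto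
  also have "\<dots> = (\<Sum>a<r. ?c v a * form E m (N m (e_frame k a m)) w)"
    using f v endo_fibre[OF N] by (intro form_sum_left) auto
  also have "\<dots> = (\<Sum>a<r. ?c v a * (\<Sum>b<r. ?c w b * endo_coeff N k m a b))"
  proof (intro sum.cong refl arg_cong2[of _ _ _ _ "(*)"])
    fix a assume a: "a \<in> {..<r}"
    have "form E m (N m (e_frame k a m)) w = form E m (N m (e_frame k a m)) (\<Sum>b<r. ?c w b *\<^sub>R e_frame k b m)"
      using ex[OF v(2)] by simp
    also have "\<dots> = (\<Sum>b<r. ?c w b * endo_coeff N k m a b)"
      unfolding endo_coeff_def using f a endo_fibre[OF N] by (intro form_sum_right) auto
    finally show "form E m (N m (e_frame k a m)) w = (\<Sum>b<r. ?c w b * endo_coeff N k m a b)" .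
  qed
  finally show ?thesis by (simp add: sum_distrib_left mult_ac)
qed

lemma chart_smooth_endo_coeff:
  assumes N: "bundle_endomorphism E N" and k: "k \<in> \<K>" and ab: "a < r" "b < r"
  shows "chart_smooth E k (patch k) (\<lambda>m. endo_coeff N k m a b)"
proof -
  interpret local_coords E k "patch k" by (rule local_coords_patch[OF k])
  have 1: "chart_smooth E k (patch k) (\<lambda>m. component E (e_frame k) m (N m (e_frame k a m)) c)" if "c < r" for c
    using chart_smooth_smooth_fun[OF k, of "patch k"] N coord_systemsD(2)[OF k] ab that unfolding bundle_endomorphism_def by fastforce
  have 2: "chart_smooth E k (patch k) (\<lambda>m. form E m (e_frame k c m) (e_frame k b m))" if "c < r" for c
    using chart_smooth_smooth_fun[OF k form_smooth[OF coord_systemsD(2)[OF k] that ab(2)]] by simp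
  have "chart_smooth E k (patch k) (\<lambda>m. \<Sum>c<r. component E (e_frame k) m (N m (e_frame k a m)) c * form E m (e_frame k c m) (e_frame k b m))"
    by (intro chart_smooth_sum chart_smooth_mult U k 1 2) auto
  thus ?thesis
  proof (rule chart_smooth_cong[OF k U, rotated])
    fix m assume m: "m \<in> patch k"
    note f = frame_in_fibre[OF coord_systemsD(2)[OF k] m]
    have "(\<Sum>c<r. component E (e_frame k) m (N m (e_frame k a m)) c * form E m (e_frame k c m) (e_frame k b m)) =
      form E m (\<Sum>c<r. component E (e_frame k) m (N m (e_frame k a m)) c *\<^sub>R e_frame k c m) (e_frame k b m)"
      using f ab by (intro form_sum_left[symmetric]) auto
    thus "(\<Sum>c<r. component E (e_frame k) m (N m (e_frame k a m)) c * form E m (e_frame k c m) (e_frame k b m)) = endo_coeff N k m a b"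
      using comp_expand[OF coord_systemsD(2)[OF k] m endo_fibre[OF N f[OF ab(1)]]] by (simp add: endo_coeff_def)
  qed
qed

lemma homog_tau: "a < r \<Longrightarrow> homog r n 1 (\<tau> a)"
  by (auto simp: homog_def \<tau>.rep_eq tau_var_def split: if_splits)

lemma homog_endo_spoly: "homog r n 2 (endo_spoly N k m)"
proof -
  have "homog r n (1 + 1) (\<tau> a * \<tau> b)" if "a < r" "b < r" for a b
    using that by (intro homog_mult homog_tau)
  thus ?thesis unfolding endo_spoly_def by (intro homog_scaleR homog_sum) (auto simp: numeral_2_eq_2)
qed

lemma endo_function_graded:
  assumes N: "bundle_endomorphism E N"
  shows "endo_function N \<in> graded_functions E 2"
  unfolding graded_functions_def
proof (intro CollectI conjI ballI allI impI)
  fix k m S K assume nz: "endo_function N k m S K \<noteq> 0"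
  show k: "k \<in> \<K>" and m: "m \<in> patch k" using nz by (auto simp: endo_function_def split: if_splits)
  from homogD[OF homog_endo_spoly, of N k m S K] nz k m
  show "S \<subseteq> {..<r}" "set_mset K \<subseteq> {..<n}" "card S + 2 * size K = 2" by (auto simp: endo_function_def)
next
  fix k S K assume k: "k \<in> \<K>"
  interpret local_coords E k "patch k" by (rule local_coords_patch[OF k])
  have "chart_smooth E k (patch k) (\<lambda>x. coef (endo_spoly N k x) S K)"
    unfolding endo_spoly_def coef_scaleR coef_sum
    by (intro chart_smooth_mult chart_smooth_sum chart_smooth_endo_coeff N k U chart_smooth_const) auto
  hence "chart_smooth E k (patch k) (\<lambda>x. endo_function N k x S K)"
    by (rule chart_smooth_cong[OF k U, rotated]) (simp add: endo_function_def k)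
  thus "smooth_on n (q_coord k ` patch k) (\<lambda>x. endo_function N k (inv_into (patch k) (q_coord k) x) S K)"
    by (simp add: chart_smooth_def)
next
  fix k k' m assume k: "k \<in> \<K>" and k': "k' \<in> \<K>" and mo: "m \<in> patch k \<inter> patch k'"
  interpret overlap E k k' m by unfold_locales (use k k' mo in auto)
  have ht: "hom (T m) (P m) (\<tau> b) = T m b" for b using sub.hom_\<tau>_mult[of m b 1] by simp
  have "hom (T m) (P m) (endo_spoly N k m) = (1/2) *\<^sub>R (\<Sum>a<r. \<Sum>b<r. endo_coeff N k m a b *\<^sub>R (T m a * T m b))"
    by (simp add: endo_spoly_def ht)
  also have "(\<Sum>a<r. \<Sum>b<r. endo_coeff N k m a b *\<^sub>R (T m a * T m b)) =
    (\<Sum>a<r. \<Sum>b<r. \<Sum>c<r. \<Sum>d<r. (Bmat m a c * Bmat m b d * endo_coeff N k m a b) *\<^sub>R (\<tau> c * \<tau> d))"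
    unfolding T_def sum_product scaleR_sum_right by (simp add: mult_ac)
  also have "\<dots> = (\<Sum>c<r. \<Sum>d<r. \<Sum>a<r. \<Sum>b<r. (Bmat m a c * Bmat m b d * endo_coeff N k m a b) *\<^sub>R (\<tau> c * \<tau> d))"
    by (rule sum4_swap)
  also have "\<dots> = (\<Sum>c<r. \<Sum>d<r. endo_coeff N k' m c d *\<^sub>R (\<tau> c * \<tau> d))"
  proof (intro sum.cong refl)
    fix c d assume cd: "c \<in> {..<r}" "d \<in> {..<r}"
    have "endo_coeff N k' m c d = (\<Sum>a<r. \<Sum>b<r. Bmat m a c * Bmat m b d * endo_coeff N k m a b)"
      unfolding endo_coeff_def[of N k'] Bmat_def
      by (rule endo_coeff_change[OF N k m]) (use frame_in_fibre[OF coord_systemsD(2)[OF k'] m'] cd in auto)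
    thus "(\<Sum>a<r. \<Sum>b<r. (Bmat m a c * Bmat m b d * endo_coeff N k m a b) *\<^sub>R (\<tau> c * \<tau> d)) = endo_coeff N k' m c d *\<^sub>R (\<tau> c * \<tau> d)"
      by (simp add: scaleR_sum_left)
  qed
  finally have "hom (T m) (P m) (endo_spoly N k m) = endo_spoly N k' m" by (simp add: endo_spoly_def)
  moreover have "endo_function N k m = coef (endo_spoly N k m)" "endo_function N k' m = coef (endo_spoly N k' m)"
    using k k' m m' by (auto simp: endo_function_def)
  ultimately show "endo_function N k' m = super_subst (tau_change E k k' m) (p_change E k k' m) (endo_function N k m)"
    using super_subst_eq_hom[OF mo, of "endo_spoly N k m"] by simp
qed

text \<open>
Neither factor depends on \<open>p\<close>, so only the \<open>\<tau>\<close>-part of the bracket contributes, and it can be evaluated at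
each point separately.
\<close>

lemma endo_function_bracket:
  assumes N: "skew_endomorphism E N" and u: "u \<in> sections E"
  shows "section_function E (\<lambda>m. N m (u m)) = bracket E (section_function E u) (endo_function N)"
proof (intro ext)
  fix k m S K
  show "section_function E (\<lambda>m. N m (u m)) k m S K = bracket E (section_function E u) (endo_function N) k m S K"
  proof (cases "k \<in> \<K> \<and> m \<in> patch k")
    case False
    thus ?thesis by (auto simp: section_function_def bracket_def)
  next
    case True
    hence k: "k \<in> \<K>" and m: "m \<in> patch k" by auto
    have Nb: "bundle_endomorphism E N" using N by (simp add: skew_endomorphism_def)
    have um: "u m \<in> fibre E m" using u by (simp add: sections_def)
    note f = frame_in_fibre[OF coord_systemsD(2)[OF k] m]
    let ?e = "e_frame k" and ?w = "component E (e_frame k) m (u m)" and ?h = "gram_inv k m"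
    define ua where "ua a = form E m (u m) (?e a m)" for a
    define Us where "Us = (\<Sum>b<r. ua b *\<^sub>R \<tau> b)"
    have t: "D\<tau> b (\<tau> c) = (if b = c then 1 else 0)" "Dp b (\<tau> c) = 0" for b c
      using D\<tau>_\<tau>_mult[of b c 1] Dp_\<tau>_mult[of b c 1] by simp_all
    have sec: "section_function E u k m = coef Us"
      using k m by (intro ext) (simp add: section_function_def Us_def ua_def \<tau>.rep_eq)
    have endo_function: "endo_function N k m = coef (endo_spoly N k m)" using k m by (auto simp: endo_function_def)
    have z: "super_mult f (\<lambda>S K. 0) = (\<lambda>S K. 0)" "super_mult (\<lambda>S K. 0) f = (\<lambda>S K. 0)" for f
      by (auto simp: super_mult_def)
    have dp: "dp i (section_function E u k m) = (\<lambda>S K. 0)" "dp i (endo_function N k m) = (\<lambda>S K. 0)" for i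
      unfolding sec endo_function Dp.rep_eq[symmetric] by (simp_all add: Us_def endo_spoly_def t Dp_\<tau>_mult fun_eq_iff)
    have DU: "D\<tau>R a Us = ua a *\<^sub>R 1" if "a < r" for a
      using that unfolding D\<tau>R_eq Us_def
      by (simp add: t if_distrib[of "\<lambda>y. _ *\<^sub>R y"] cong: if_cong)
    have Dn: "D\<tau> b (endo_spoly N k m) = (\<Sum>d<r. endo_coeff N k m b d *\<^sub>R \<tau> d)" if b: "b < r" for b
    proof -
      have "(\<Sum>a<r. \<Sum>d<r. endo_coeff N k m a d *\<^sub>R D\<tau> b (\<tau> a * \<tau> d)) =
        (\<Sum>a<r. \<Sum>d<r. if a = b then endo_coeff N k m b d *\<^sub>R \<tau> d else 0) - (\<Sum>a<r. \<Sum>d<r. if d = b then endo_coeff N k m a b *\<^sub>R \<tau> a else 0)"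
        unfolding sum_subtractf[symmetric] by (intro sum.cong refl) (auto simp: D\<tau>_\<tau>_mult t)
      also have "\<dots> = (\<Sum>d<r. endo_coeff N k m b d *\<^sub>R \<tau> d) - (\<Sum>a<r. endo_coeff N k m a b *\<^sub>R \<tau> a)"
        using b by (subst sum.swap) simp
      also have "(\<Sum>a<r. endo_coeff N k m a b *\<^sub>R \<tau> a) = - (\<Sum>d<r. endo_coeff N k m b d *\<^sub>R \<tau> d)"
        unfolding sum_negf[symmetric] by (intro sum.cong refl) (use endo_coeff_skew[OF N k m _ b] in simp)
      finally show ?thesis by (simp add: endo_spoly_def flip: scaleR_2)
    qed
    have w: "(\<Sum>a<r. ?h a b * ua a) = ?w b" if b: "b < r" for b
    proof -
      have "ua a = (\<Sum>c<r. ?w c * gram E k m c a)" if "a < r" for a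
      proof -
        have "ua a = form E m (\<Sum>c<r. ?w c *\<^sub>R ?e c m) (?e a m)"
          unfolding ua_def using comp_expand[OF coord_systemsD(2)[OF k] m um] by simp
        also have "\<dots> = (\<Sum>c<r. ?w c * gram E k m c a)"
          unfolding gram_def using f that by (intro form_sum_left) auto
        finally show ?thesis .
      qed
      hence "(\<Sum>a<r. ?h a b * ua a) = (\<Sum>a<r. \<Sum>c<r. ?w c * (gram E k m c a * ?h a b))"
        by (simp add: sum_distrib_left mult_ac)
      also have "\<dots> = (\<Sum>c<r. ?w c * mat_mult r (gram E k m) ?h c b)"
        using b by (subst sum.swap) (simp add: mat_mult_def sum_distrib_left)
      also have "\<dots> = ?w b" unfolding gram_inv_def inverse_gram(2)[OF k m]
        using b by (simp add: mat_one_def if_distrib[of "\<lambda>y. _ * y"] cong: if_cong)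
      finally show ?thesis .
    qed
    have "bracket E (section_function E u) (endo_function N) k m S K =
       coef (\<Sum>a<r. \<Sum>b<r. ?h a b *\<^sub>R (D\<tau>R a Us * D\<tau> b (endo_spoly N k m))) S K"
      using k m unfolding bracket_def gram_inv_def
      by (simp add: dp z) (simp add: sec endo_function coef_mult D\<tau>R.rep_eq D\<tau>.rep_eq)
    also have "(\<Sum>a<r. \<Sum>b<r. ?h a b *\<^sub>R (D\<tau>R a Us * D\<tau> b (endo_spoly N k m))) =
        (\<Sum>b<r. (\<Sum>a<r. ?h a b * ua a) *\<^sub>R (\<Sum>d<r. endo_coeff N k m b d *\<^sub>R \<tau> d))"
      by (subst sum.swap) (simp add: DU Dn scaleR_sum_left)
    also have "\<dots> = (\<Sum>b<r. \<Sum>d<r. (?w b * endo_coeff N k m b d) *\<^sub>R \<tau> d)"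
      by (simp add: w scaleR_sum_right)
    also have "\<dots> = (\<Sum>d<r. (\<Sum>b<r. ?w b * endo_coeff N k m b d) *\<^sub>R \<tau> d)"
      by (subst sum.swap) (simp add: scaleR_sum_left)
    also have "\<dots> = (\<Sum>d<r. form E m (N m (u m)) (?e d m) *\<^sub>R \<tau> d)"
    proof (intro sum.cong refl arg_cong2[of _ _ _ _ scaleR])
      fix d assume d: "d \<in> {..<r}"
      have "form E m (N m (u m)) (?e d m) = form E m (N m (\<Sum>b<r. ?w b *\<^sub>R ?e b m)) (?e d m)"
        using comp_expand[OF coord_systemsD(2)[OF k] m um] by simp
      also have "\<dots> = form E m (\<Sum>b<r. ?w b *\<^sub>R N m (?e b m)) (?e d m)"
        using f by (subst endo_sum[OF Nb]) auto
      also have "\<dots> = (\<Sum>b<r. ?w b * endo_coeff N k m b d)"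
        unfolding endo_coeff_def using f d endo_fibre[OF Nb] by (intro form_sum_left) auto
      finally show "(\<Sum>b<r. ?w b * endo_coeff N k m b d) = form E m (N m (u m)) (?e d m)" ..
    qed
    finally show ?thesis using k m by (simp add: section_function_def \<tau>.rep_eq)
  qed
qed

lemma tilde_graded:
  assumes "skew_endomorphism E N"
  shows "tilde E N \<in> graded_functions E 2"
proof -
  have "\<exists>F. F \<in> graded_functions E 2 \<and>
     (\<forall>u\<in>sections E. section_function E (\<lambda>m. N m (u m)) = bracket E (section_function E u) F)"
    using endo_function_graded endo_function_bracket assms by (intro exI[of _ "endo_function N"]) (simp add: skew_endomorphism_def)
  from someI_ex[OF this] show ?thesis unfolding tilde_def by (rule conjunct1)
qed

lemma deformed_square_global:
  assumes \<Theta>: "courant_structure E \<Theta>" and N: "N \<in> graded_functions E 2"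
  shows "bracket E \<Theta> (bracket E (bracket E N \<Theta>) N) = bracket E (bracket E N \<Theta>) (bracket E N \<Theta>)"
proof (intro ext)
  fix k m S K
  have \<Theta>3: "\<Theta> \<in> graded_functions E 3" and sq: "bracket E \<Theta> \<Theta> = zero_function"
    using \<Theta> by (auto simp: courant_structure_def)
  have N\<Theta>: "bracket E N \<Theta> \<in> graded_functions E 3"
    using bracket_graded[of N 0 \<Theta> 1] N \<Theta>3 by (simp add: numeral_eq_Suc)
  have b4: "bracket E \<Theta> \<Theta> \<in> graded_functions E 4"
    using bracket_graded[of \<Theta> 1 \<Theta> 1] \<Theta>3 by (simp add: numeral_eq_Suc)
  have N\<Theta>N: "bracket E (bracket E N \<Theta>) N \<in> graded_functions E 3"
    using bracket_graded[of "bracket E N \<Theta>" 1 N 0] N N\<Theta> by (simp add: numeral_eq_Suc)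
  show "bracket E \<Theta> (bracket E (bracket E N \<Theta>) N) k m S K = bracket E (bracket E N \<Theta>) (bracket E N \<Theta>) k m S K"
  proof (cases "k \<in> \<K> \<and> m \<in> patch k")
    case False
    thus ?thesis by (auto simp: bracket_def)
  next
    case True
    hence k: "k \<in> \<K>" and m: "m \<in> patch k" by auto
    interpret local_coords E k "patch k" by (rule local_coords_patch[OF k])
    let ?h = "gram_inv k m" and ?\<Theta> = "local_expr k \<Theta>" and ?N = "local_expr k N"
    let ?B = "pbracket k ?h"
    have local_expr: "local_expr k (bracket E F G) x = ?B (local_expr k F) (local_expr k G) x"
      if "F \<in> graded_functions E d" "G \<in> graded_functions E e" "x \<in> patch k" for F G d e x
      using local_expr_bracket[OF that(1,2) k that(3)] gram_inv_const[OF k that(3) m] by simp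
    have h: "mat_tp ?h = ?h" unfolding gram_inv_def by (rule inverse_gram(3)[OF k m])
    have sq0: "?B ?\<Theta> ?\<Theta> x = 0" if "x \<in> patch k" for x
    proof -
      have "?B ?\<Theta> ?\<Theta> x = local_expr k (bracket E \<Theta> \<Theta>) x" using local_expr[OF \<Theta>3 \<Theta>3 that] by simp
      also have "\<dots> = 0"
        by (rule coef_inject_ext) (simp only: coef_local_expr[OF b4], simp add: sq zero_function_def)
      finally show ?thesis .
    qed
    have "bracket E \<Theta> (bracket E (bracket E N \<Theta>) N) k m = coef (?B ?\<Theta> (local_expr k (bracket E (bracket E N \<Theta>) N)) m)"
      by (rule bracket_eq_pbracket[OF \<Theta>3 N\<Theta>N k m])
    also have "?B ?\<Theta> (local_expr k (bracket E (bracket E N \<Theta>) N)) m = ?B ?\<Theta> (?B (?B ?N ?\<Theta>) ?N) m"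
    proof (rule pbracket_cong[OF m refl])
      fix x assume x: "x \<in> patch k"
      show "local_expr k (bracket E (bracket E N \<Theta>) N) x = ?B (?B ?N ?\<Theta>) ?N x"
        unfolding local_expr[OF N\<Theta> N x] by (rule pbracket_cong[OF x local_expr[OF N \<Theta>3] refl])
    qed
    also have "\<dots> = ?B (?B ?N ?\<Theta>) (?B ?N ?\<Theta>) m"
      by (rule deformed_square[OF smooth_homog_local_expr[OF \<Theta>3 k] smooth_homog_local_expr[OF N k] h sq0 m])
    also have "\<dots> = ?B (local_expr k (bracket E N \<Theta>)) (local_expr k (bracket E N \<Theta>)) m"
      by (rule pbracket_cong[OF m local_expr[OF N \<Theta>3, symmetric] local_expr[OF N \<Theta>3, symmetric]])
    also have "coef \<dots> = bracket E (bracket E N \<Theta>) (bracket E N \<Theta>) k m"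
      by (rule bracket_eq_pbracket[OF N\<Theta> N\<Theta> k m, symmetric])
    finally show ?thesis by simp
  qed
qed

end

theorem theorem3p9:
  fixes E :: "('m::{t2_space, second_countable_topology}, 'v::real_vector) metric_bundle"
    and \<Theta> :: "('m, 'v) family"
    and N :: "'m \<Rightarrow> 'v \<Rightarrow> 'v"
  assumes "metric_bundle E"
    and "courant_structure E \<Theta>"
    and "skew_endomorphism E N"
  shows "courant_structure E (bracket E (tilde E N) \<Theta>) \<longleftrightarrow> weak_deforming_tensor E \<Theta> N"
proof -
  interpret metric_bundle E by (rule assms(1))
  have N: "tilde E N \<in> graded_functions E 2" by (rule tilde_graded[OF assms(3)])
  have \<Theta>: "\<Theta> \<in> graded_functions E 3" using assms(2) by (simp add: courant_structure_def)
  have "bracket E (tilde E N) \<Theta> \<in> graded_functions E 3"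
    using bracket_graded[of "tilde E N" 0 \<Theta> 1] N \<Theta> by (simp add: numeral_eq_Suc)
  thus ?thesis
    using assms(3) deformed_square_global[OF assms(2) N]
    by (simp add: courant_structure_def weak_deforming_tensor_def d_Theta_def)
qed

end
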